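(* Let $\zeta=(\lambda,\nu,t,1)$ be any ribbon zesting data with $\epsilon\equiv1$. Then for every oriented, framed, $A$-colored link $L$, $$\mathcal{J}_\zeta(L)=Z(L,\phi),$$ i.e. the zest invariant of $L$ is the shadow rack cocycle invariant that arises from $A$ and the Boltzmann weights $\phi_i(a,b)=\nu(i,b,a)^{-1}t(a,b)\nu(i,a,b)$.
   Context: **Categories.** $\Bbbk$ is an algebraically closed field of characteristic $0$ and $\mathcal{C}$ is a strict ribbon fusion category over $\Bbbk$ with unit $\mathbf 1$, braiding $\beta_{X,Y}:X\otimes Y\to Y\otimes X$, twists $\theta$, quantum dimension $\dim$, and (co)evaluations $\mathrm{ev}_X:X^*\otimes X\to\mathbf 1$, $\mathrm{coev}'_X:\mathbf 1\to X^*\otimes X$. For an endomorphism $f$ of a simple object, $f=\langle f\rangle\,\mathrm{id}$. $A$ (finite abelian, identity $e$) is the universal grading group, $\mathcal{C}=\bigoplus_{a\in A}\mathcal{C}_a$. $\mathrm{Inv}(\mathcal{C}_e)$ denotes (the full subcategory of) invertible objects in $\mathcal{C}_e$. For $\eta$ invertible, $\chi_\eta:A\to\Bbbk^\times$ is the character with $\beta_{\eta,X}\circ\beta_{X,\eta}=\chi_\eta(a)\,\mathrm{id}_{X\otimes\eta}$ for simple $X\in\mathcal{C}_a$. **Ribbon zesting data** $\zeta=(\lambda,\nu,t,\epsilon)$: (a) $\lambda:A\times A\to\mathrm{Inv}(\mathcal{C}_e)$ with $\lambda(e,a)=\lambda(a,e)=\mathbf 1$; put $\omega(a,b;c)=\chi_{\lambda(a,b)}(c)$.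 (b) isomorphisms $\nu(a,b,c):\lambda(a,b)\otimes\lambda(ab,c)\to\lambda(b,c)\otimes\lambda(a,bc)$, equal to identities when one of $a,b,c$ is $e$, with $(\nu(b,c,d)\otimes\mathrm{id})(\mathrm{id}\otimes\nu(a,bc,d))(\nu(a,b,c)\otimes\mathrm{id})=(\mathrm{id}_{\lambda(c,d)}\otimes\nu(a,b,cd))(\beta_{\lambda(a,b),\lambda(c,d)}\otimes\mathrm{id})(\mathrm{id}_{\lambda(a,b)}\otimes\nu(ab,c,d))$. (c) isomorphisms $t(a,b):\lambda(a,b)\to\lambda(b,a)$, identities when $a$ or $b$ is $e$, with $\nu(b,c,a)(\mathrm{id}\otimes t(a,bc))\nu(a,b,c)=(t(a,c)\otimes\mathrm{id})\nu(b,a,c)(t(a,b)\otimes\mathrm{id})$ and $\omega(a,b;c)\,\nu(c,a,b)^{-1}(\mathrm{id}\otimes t(ab,c))\nu(a,b,c)^{-1}=(t(a,c)\otimes\mathrm{id})\nu(a,c,b)^{-1}(t(b,c)\otimes\mathrm{id})$. (d) $\epsilon:A\to\Bbbk^\times$, $\epsilon(e)=1$, $\epsilon(ab)/(\epsilon(a)\epsilon(b))=\dim\lambda(a,b)$, $\epsilon(a)^2=1$. All conditions are for all $a,b,c,d\in A$. Write $\lambda(a)=\lambda(a,a^{-1})$, $\nu(a)=\nu(a,a^{-1},a):\lambda(a)\to\lambda(a^{-1})$. **Numerical convention.** $\lambda$ is taken to be a strict symmetric cocycle on objects: $\lambda(a,b)\otimes\lambda(ab,c)=\lambda(b,c)\otimes\lambda(a,bc)$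 and $\lambda(a,b)=\lambda(b,a)$. Then $\nu(a,b,c)$ and $t(a,b)$ are endomorphisms of invertible objects and are identified with scalars $\langle\nu(a,b,c)\rangle,\langle t(a,b)\rangle\in\Bbbk^\times$; likewise $\phi_i(a,b)\in\Bbbk^\times$. **$A$-colored tangles.** An $A$-colored tangle is an oriented framed tangle with each component labelled by an element of $A$. Diagrams are blackboard framed and read from top to bottom. A shadow coloring with base color $i$ labels the regions by elements of $A$: the leftmost region (for a link, the unbounded region) has color $i$, and crossing a strand colored $a$ from left to right multiplies the region color by $a$ if the strand points down and by $a^{-1}$ if it points up. If the rightmost region of $(i,T)$ is colored $j$, $|T|=i^{-1}j$. Boundary words are written $(i;\dots)$ with $a$ for a downward point and $a^*$ for an upward point. A crossing with both strands pointing down is positive if the over-strand goes from top left to bottom right, negative if it goes from top right to bottom left. **Zest invariant** $\mathcal{J}_\zeta$. On boundary points: $\mathcal{J}_\zeta(i;a)=\lambda(i,a)$, $\mathcal{J}_\zeta(i;a^* )=\lambda(a)^*\otimes\lambda(i,a^{-1})$; on words take tensor products from left to right, using for each point the color of the region to its left. On elementary tangles with left region color $i$: - *Crossing, left (top) strand over*, colors $a_1$ (top left), $a_2$ (top right); $\phi_i(a,b)=\nu(i,b,a)^{-1}\circ(t(a,b)\otimes\mathrm{id}_{\lambda(i,ab)})\circ\nu(i,a,b)$. Both down: $\phi_i(a_1,a_2)$. Only $a_2$ up: $(\mathrm{id}\otimes\phi_i(a_1,a_2^{-1}))\circ(\beta^{-1}_{\lambda(a_2)^*,\lambda(i,a_1)}\otimes\mathrm{id})$.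 Only $a_1$ up: $\omega(a_1,a_1^{-1};a_2)^{-1}(\beta_{\lambda(a_1)^*,\lambda(i,a_2)}\otimes\mathrm{id})\circ(\mathrm{id}\otimes\phi_i(a_1^{-1},a_2))$. Both up: $\omega(a_1,a_1^{-1};a_2)$ times the composite $\lambda(a_1)^*\otimes\lambda(i,a_1^{-1})\otimes\lambda(a_2)^*\otimes\lambda(ia_1^{-1},a_2^{-1})\to\lambda(a_2)^*\otimes\lambda(i,a_2^{-1})\otimes\lambda(a_1)^*\otimes\lambda(ia_2^{-1},a_1^{-1})$ obtained by braiding $\lambda(i,a_1^{-1})$ past $\lambda(a_2)^*$, then braiding $\lambda(a_1)^*$ past $\lambda(a_2)^*$, applying $\phi_i(a_1^{-1},a_2^{-1})$ to the last two factors, and braiding $\lambda(a_1)^*$ past $\lambda(i,a_2^{-1})$ (the braiding on $\mathrm{Inv}(\mathcal{C}_e)$ is symmetric). - *Crossing, right strand over*: the inverse of the value on the inverse crossing. - *Caps:* $(i;)\to(i;a,a^* )$: $\dim(\lambda(a))^{-1}(\beta_{\lambda(a)^*,\lambda(i,a)}\otimes\mathrm{id})(\mathrm{id}\otimes\nu(i,a,a^{-1})^{-1})\,\mathrm{coev}'_{\lambda(a)}$; $(i;)\to(i;a^*,a)$: $\dim(\lambda(a))^{-1}\epsilon(a)^{-1}(\mathrm{id}\otimes\nu(i,a^{-1},a)^{-1})(\mathrm{id}\otimes\nu(a))\,\mathrm{coev}'_{\lambda(a)}$. - *Cups:* $(i;a^*,a)\to(i;)$: $\mathrm{ev}_{\lambda(a)}(\mathrm{id}\otimes\nu(a)^{-1})(\mathrm{id}\otimes\nu(i,a^{-1},a))$;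 $(i;a,a^* )\to(i;)$: $\epsilon(a)\,\mathrm{ev}_{\lambda(a)}(\mathrm{id}\otimes\nu(i,a,a^{-1}))(\beta_{\lambda(i,a),\lambda(a)^*}\otimes\mathrm{id})$. Vertical strands go to identities. Extend by $\mathcal{J}_\zeta(i,T'\circ T)=\mathcal{J}_\zeta(i,T')\circ\mathcal{J}_\zeta(i,T)$ and $\mathcal{J}_\zeta(i,T_1\amalg T_2)=\mathcal{J}_\zeta(i,T_1)\otimes\mathcal{J}_\zeta(i|T_1|,T_2)$. This does not depend on the diagram; for a link $L$ it is a scalar in $\mathrm{End}(\mathbf 1)=\Bbbk$, independent of $i$, denoted $\mathcal{J}_\zeta(L)$. **Shadow rack cocycle invariant.** Given $\omega:A\times A^2\to\Bbbk^\times$ satisfying $\omega_i(b,c)\omega_{ib}(a,c)\omega_i(a,b)=\omega_{ic}(a,b)\omega_i(a,c)\omega_{ia}(b,c)$ for all $i,a,b,c$ (a shadow rack $2$-cocycle), and a shadow-colored diagram $D$, rotate each crossing $c$ so that both strands point down; let $i$ be the color of the region to its left and $a,b$ the colors of the incoming (top) left and right strands. Its Boltzmann weight is $\omega_i(a,b)$ if $c$ is positive and $\omega_i(b,a)^{-1}$ if $c$ is negative. $Z(D,\omega)$ is the product of the weights over all crossings; it is an invariant $Z(L,\omega)$ of the oriented framed $A$-colored link $L$ presented by $D$. The function $\phi$ is a shadow rack $2$-cocycle. *)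

theory Defs
  imports "HOL-Algebra.Group" "HOL-Computational_Algebra.Polynomial"
begin

section \<open>Strict ribbon fusion categories\<close>

text \<open>
  Composition is written in the usual order: \<open>g \<cdot> f\<close> is \<open>g\<close> after \<open>f\<close>. The duality consists of
  \<open>ev X : X* \<otimes> X \<rightarrow> 1\<close> and \<open>coev X : 1 \<rightarrow> X \<otimes> X*\<close>; the coevaluation \<open>1 \<rightarrow> X* \<otimes> X\<close> on the other
  side comes from the braiding and the twist (\<open>coevr\<close> below).
\<close>

record ('o, 'm, 'k) ribbon_structure =
  obj :: "'o set"
  arr :: "'m set"
  src :: "'m \<Rightarrow> 'o"
  tgt :: "'m \<Rightarrow> 'o"
  ident :: "'o \<Rightarrow> 'm" ("\<^bold>1\<index>")
  comp :: "'m \<Rightarrow> 'm \<Rightarrow> 'm" (infixr "\<cdot>\<index>" 70)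
  zmor :: "'o \<Rightarrow> 'o \<Rightarrow> 'm" ("\<^bold>0\<index>")
  madd :: "'m \<Rightarrow> 'm \<Rightarrow> 'm" (infixl "\<boxplus>\<index>" 65)
  smul :: "'k \<Rightarrow> 'm \<Rightarrow> 'm" (infixr "\<triangleright>\<index>" 68)
  unito :: "'o" ("\<I>\<index>")
  tenso :: "'o \<Rightarrow> 'o \<Rightarrow> 'o" (infixr "\<star>\<index>" 75)
  tensm :: "'m \<Rightarrow> 'm \<Rightarrow> 'm" (infixr "\<boxtimes>\<index>" 75)
  braid :: "'o \<Rightarrow> 'o \<Rightarrow> 'm" ("\<beta>\<index>")
  twist :: "'o \<Rightarrow> 'm" ("\<theta>\<index>")
  dual :: "'o \<Rightarrow> 'o"
  ev :: "'o \<Rightarrow> 'm"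
  coev :: "'o \<Rightarrow> 'm"

context
  fixes C :: "('o, 'm, 'k::field) ribbon_structure" (structure)
begin

definition homs :: "'o \<Rightarrow> 'o \<Rightarrow> 'm set" where
  "homs X Y = {f \<in> arr C. src C f = X \<and> tgt C f = Y}"

definition is_inverse :: "'m \<Rightarrow> 'm \<Rightarrow> bool" where
  "is_inverse f g \<longleftrightarrow> f \<in> arr C \<and> g \<in> homs (tgt C f) (src C f) \<and>
     g \<cdot> f = \<^bold>1 (src C f) \<and> f \<cdot> g = \<^bold>1 (tgt C f)"

definition is_iso :: "'m \<Rightarrow> bool" where
  "is_iso f \<longleftrightarrow> (\<exists>g. is_inverse f g)"

definition minv :: "'m \<Rightarrow> 'm" where
  "minv f = (THE g. is_inverse f g)"

definition isomorphic :: "'o \<Rightarrow> 'o \<Rightarrow> bool" where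
  "isomorphic X Y \<longleftrightarrow> (\<exists>f \<in> homs X Y. is_iso f)"

definition is_mono :: "'m \<Rightarrow> bool" where
  "is_mono f \<longleftrightarrow> f \<in> arr C \<and>
     (\<forall>W \<in> obj C. \<forall>g \<in> homs W (src C f). \<forall>h \<in> homs W (src C f). f \<cdot> g = f \<cdot> h \<longrightarrow> g = h)"

definition is_epi :: "'m \<Rightarrow> bool" where
  "is_epi f \<longleftrightarrow> f \<in> arr C \<and>
     (\<forall>W \<in> obj C. \<forall>g \<in> homs (tgt C f) W. \<forall>h \<in> homs (tgt C f) W. g \<cdot> f = h \<cdot> f \<longrightarrow> g = h)"

definition is_kernel :: "'m \<Rightarrow> 'm \<Rightarrow> bool" where
  "is_kernel f k \<longleftrightarrow> f \<in> arr C \<and> k \<in> arr C \<and> tgt C k = src C f \<and> f \<cdot> k = \<^bold>0 (src C k) (tgt C f) \<and>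
     (\<forall>W \<in> obj C. \<forall>h \<in> homs W (src C f). f \<cdot> h = \<^bold>0 W (tgt C f) \<longrightarrow>
        (\<exists>!u. u \<in> homs W (src C k) \<and> k \<cdot> u = h))"

definition is_cokernel :: "'m \<Rightarrow> 'm \<Rightarrow> bool" where
  "is_cokernel f q \<longleftrightarrow> f \<in> arr C \<and> q \<in> arr C \<and> src C q = tgt C f \<and> q \<cdot> f = \<^bold>0 (src C f) (tgt C q) \<and>
     (\<forall>W \<in> obj C. \<forall>h \<in> homs (tgt C f) W. h \<cdot> f = \<^bold>0 (src C f) W \<longrightarrow>
        (\<exists>!u. u \<in> homs (tgt C q) W \<and> u \<cdot> q = h))"

definition msum :: "'o \<Rightarrow> 'o \<Rightarrow> 'm list \<Rightarrow> 'm" where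
  "msum X Y fs = foldr (\<lambda>f g. f \<boxplus> g) fs (\<^bold>0 X Y)"

definition is_direct_sum :: "'o \<Rightarrow> 'o list \<Rightarrow> bool" where
  "is_direct_sum S Xs \<longleftrightarrow> S \<in> obj C \<and> set Xs \<subseteq> obj C \<and>
     (\<exists>\<iota> \<pi>. (\<forall>j < length Xs. \<iota> j \<in> homs (Xs ! j) S \<and> \<pi> j \<in> homs S (Xs ! j)) \<and>
        (\<forall>j < length Xs. \<forall>l < length Xs.
           \<pi> j \<cdot> \<iota> l = (if j = l then \<^bold>1 (Xs ! j) else \<^bold>0 (Xs ! l) (Xs ! j))) \<and>
        msum S S (map (\<lambda>j. \<iota> j \<cdot> \<pi> j) [0..<length Xs]) = \<^bold>1 S)"

definition is_zero :: "'o \<Rightarrow> bool" where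
  "is_zero X \<longleftrightarrow> X \<in> obj C \<and> \<^bold>1 X = \<^bold>0 X X"

definition simple :: "'o \<Rightarrow> bool" where
  "simple X \<longleftrightarrow> X \<in> obj C \<and> \<not> is_zero X \<and>
     (\<forall>f. is_mono f \<and> tgt C f = X \<longrightarrow> is_zero (src C f) \<or> is_iso f)"

definition invertible :: "'o \<Rightarrow> bool" where
  "invertible X \<longleftrightarrow> X \<in> obj C \<and> (\<exists>Y \<in> obj C. isomorphic (X \<star> Y) \<I> \<and> isomorphic (Y \<star> X) \<I>)"

text \<open>The scalar \<open>\<langle>f\<rangle>\<close> of an endomorphism; meaningful only if \<open>f\<close> is a multiple of a nonzero identity.\<close>

definition scalar :: "'m \<Rightarrow> 'k" where
  "scalar f = (THE c. f = c \<triangleright> \<^bold>1 (src C f))"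

definition coevr :: "'o \<Rightarrow> 'm" where
  "coevr X = (\<^bold>1 (dual C X) \<boxtimes> \<theta> X) \<cdot> \<beta> X (dual C X) \<cdot> coev C X"

definition qdim :: "'o \<Rightarrow> 'k" where
  "qdim X = scalar (ev C X \<cdot> coevr X)"

end

locale linear_category =
  fixes C :: "('o, 'm, 'k::{alg_closed_field, field_char_0}) ribbon_structure" (structure)
  assumes src_obj: "f \<in> arr C \<Longrightarrow> src C f \<in> obj C"
    and tgt_obj: "f \<in> arr C \<Longrightarrow> tgt C f \<in> obj C"
    and id_hom: "X \<in> obj C \<Longrightarrow> \<^bold>1 X \<in> homs C X X"
    and comp_hom: "\<lbrakk>f \<in> homs C X Y; g \<in> homs C Y Z\<rbrakk> \<Longrightarrow> g \<cdot> f \<in> homs C X Z"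
    and id_left: "f \<in> homs C X Y \<Longrightarrow> \<^bold>1 Y \<cdot> f = f"
    and id_right: "f \<in> homs C X Y \<Longrightarrow> f \<cdot> \<^bold>1 X = f"
    and comp_assoc: "\<lbrakk>f \<in> homs C W X; g \<in> homs C X Y; h \<in> homs C Y Z\<rbrakk>
      \<Longrightarrow> (h \<cdot> g) \<cdot> f = h \<cdot> (g \<cdot> f)"
    and zero_hom: "\<lbrakk>X \<in> obj C; Y \<in> obj C\<rbrakk> \<Longrightarrow> \<^bold>0 X Y \<in> homs C X Y"
    and add_hom: "\<lbrakk>f \<in> homs C X Y; g \<in> homs C X Y\<rbrakk> \<Longrightarrow> f \<boxplus> g \<in> homs C X Y"
    and smul_hom: "f \<in> homs C X Y \<Longrightarrow> c \<triangleright> f \<in> homs C X Y"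
    and add_assoc: "\<lbrakk>f \<in> homs C X Y; g \<in> homs C X Y; h \<in> homs C X Y\<rbrakk>
      \<Longrightarrow> (f \<boxplus> g) \<boxplus> h = f \<boxplus> (g \<boxplus> h)"
    and add_comm: "\<lbrakk>f \<in> homs C X Y; g \<in> homs C X Y\<rbrakk> \<Longrightarrow> f \<boxplus> g = g \<boxplus> f"
    and add_zero: "f \<in> homs C X Y \<Longrightarrow> \<^bold>0 X Y \<boxplus> f = f"
    and add_neg: "f \<in> homs C X Y \<Longrightarrow> f \<boxplus> (-1) \<triangleright> f = \<^bold>0 X Y"
    and smul_one: "f \<in> homs C X Y \<Longrightarrow> 1 \<triangleright> f = f"
    and smul_smul: "f \<in> homs C X Y \<Longrightarrow> c \<triangleright> (d \<triangleright> f) = (c * d) \<triangleright> f"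
    and smul_add: "\<lbrakk>f \<in> homs C X Y; g \<in> homs C X Y\<rbrakk> \<Longrightarrow> c \<triangleright> (f \<boxplus> g) = c \<triangleright> f \<boxplus> c \<triangleright> g"
    and add_smul: "f \<in> homs C X Y \<Longrightarrow> (c + d) \<triangleright> f = c \<triangleright> f \<boxplus> d \<triangleright> f"
    and comp_add_left: "\<lbrakk>f \<in> homs C X Y; g \<in> homs C Y Z; h \<in> homs C Y Z\<rbrakk>
      \<Longrightarrow> (g \<boxplus> h) \<cdot> f = g \<cdot> f \<boxplus> h \<cdot> f"
    and comp_add_right: "\<lbrakk>f \<in> homs C X Y; g \<in> homs C X Y; h \<in> homs C Y Z\<rbrakk>
      \<Longrightarrow> h \<cdot> (f \<boxplus> g) = h \<cdot> f \<boxplus> h \<cdot> g"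
    and comp_smul_left: "\<lbrakk>f \<in> homs C X Y; g \<in> homs C Y Z\<rbrakk> \<Longrightarrow> (c \<triangleright> g) \<cdot> f = c \<triangleright> (g \<cdot> f)"
    and comp_smul_right: "\<lbrakk>f \<in> homs C X Y; g \<in> homs C Y Z\<rbrakk> \<Longrightarrow> g \<cdot> (c \<triangleright> f) = c \<triangleright> (g \<cdot> f)"

locale abelian_category = linear_category +
  assumes zero_object: "\<exists>X. is_zero C X"
    and biproducts: "\<lbrakk>X \<in> obj C; Y \<in> obj C\<rbrakk> \<Longrightarrow> \<exists>S. is_direct_sum C S [X, Y]"
    and kernels: "f \<in> arr C \<Longrightarrow> \<exists>k. is_kernel C f k"
    and cokernels: "f \<in> arr C \<Longrightarrow> \<exists>q. is_cokernel C f q"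
    and mono_normal: "is_mono C f \<Longrightarrow> \<exists>g. is_kernel C g f"
    and epi_normal: "is_epi C f \<Longrightarrow> \<exists>g. is_cokernel C g f"

locale strict_monoidal_category = linear_category +
  assumes unit_obj: "\<I> \<in> obj C"
    and tens_obj: "\<lbrakk>X \<in> obj C; Y \<in> obj C\<rbrakk> \<Longrightarrow> X \<star> Y \<in> obj C"
    and tens_hom: "\<lbrakk>f \<in> homs C X X'; g \<in> homs C Y Y'\<rbrakk> \<Longrightarrow> f \<boxtimes> g \<in> homs C (X \<star> Y) (X' \<star> Y')"
    and tens_id: "\<lbrakk>X \<in> obj C; Y \<in> obj C\<rbrakk> \<Longrightarrow> \<^bold>1 X \<boxtimes> \<^bold>1 Y = \<^bold>1 (X \<star> Y)"
    and interchange: "\<lbrakk>f \<in> homs C X X'; f' \<in> homs C X' X''; g \<in> homs C Y Y'; g' \<in> homs C Y' Y''\<rbrakk>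
      \<Longrightarrow> (f' \<boxtimes> g') \<cdot> (f \<boxtimes> g) = (f' \<cdot> f) \<boxtimes> (g' \<cdot> g)"
    and tens_assoc_obj: "\<lbrakk>X \<in> obj C; Y \<in> obj C; Z \<in> obj C\<rbrakk> \<Longrightarrow> (X \<star> Y) \<star> Z = X \<star> (Y \<star> Z)"
    and tens_unit_left_obj: "X \<in> obj C \<Longrightarrow> \<I> \<star> X = X"
    and tens_unit_right_obj: "X \<in> obj C \<Longrightarrow> X \<star> \<I> = X"
    and tens_assoc: "\<lbrakk>f \<in> arr C; g \<in> arr C; h \<in> arr C\<rbrakk> \<Longrightarrow> (f \<boxtimes> g) \<boxtimes> h = f \<boxtimes> (g \<boxtimes> h)"
    and tens_unit_left: "f \<in> arr C \<Longrightarrow> \<^bold>1 \<I> \<boxtimes> f = f"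
    and tens_unit_right: "f \<in> arr C \<Longrightarrow> f \<boxtimes> \<^bold>1 \<I> = f"
    and tens_add_left: "\<lbrakk>f \<in> homs C X Y; g \<in> homs C X Y; h \<in> arr C\<rbrakk>
      \<Longrightarrow> (f \<boxplus> g) \<boxtimes> h = f \<boxtimes> h \<boxplus> g \<boxtimes> h"
    and tens_add_right: "\<lbrakk>f \<in> homs C X Y; g \<in> homs C X Y; h \<in> arr C\<rbrakk>
      \<Longrightarrow> h \<boxtimes> (f \<boxplus> g) = h \<boxtimes> f \<boxplus> h \<boxtimes> g"
    and tens_smul_left: "\<lbrakk>f \<in> arr C; g \<in> arr C\<rbrakk> \<Longrightarrow> (c \<triangleright> f) \<boxtimes> g = c \<triangleright> (f \<boxtimes> g)"
    and tens_smul_right: "\<lbrakk>f \<in> arr C; g \<in> arr C\<rbrakk> \<Longrightarrow> f \<boxtimes> (c \<triangleright> g) = c \<triangleright> (f \<boxtimes> g)"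

locale strict_ribbon_category = strict_monoidal_category +
  assumes dual_obj: "X \<in> obj C \<Longrightarrow> dual C X \<in> obj C"
    and ev_hom: "X \<in> obj C \<Longrightarrow> ev C X \<in> homs C (dual C X \<star> X) \<I>"
    and coev_hom: "X \<in> obj C \<Longrightarrow> coev C X \<in> homs C \<I> (X \<star> dual C X)"
    and zigzag: "X \<in> obj C \<Longrightarrow> (\<^bold>1 X \<boxtimes> ev C X) \<cdot> (coev C X \<boxtimes> \<^bold>1 X) = \<^bold>1 X"
    and zigzag_dual: "X \<in> obj C \<Longrightarrow> (ev C X \<boxtimes> \<^bold>1 (dual C X)) \<cdot> (\<^bold>1 (dual C X) \<boxtimes> coev C X) = \<^bold>1 (dual C X)"
    and braid_hom: "\<lbrakk>X \<in> obj C; Y \<in> obj C\<rbrakk> \<Longrightarrow> \<beta> X Y \<in> homs C (X \<star> Y) (Y \<star> X)"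
    and braid_iso: "\<lbrakk>X \<in> obj C; Y \<in> obj C\<rbrakk> \<Longrightarrow> is_iso C (\<beta> X Y)"
    and braid_natural: "\<lbrakk>f \<in> homs C X X'; g \<in> homs C Y Y'\<rbrakk>
      \<Longrightarrow> \<beta> X' Y' \<cdot> (f \<boxtimes> g) = (g \<boxtimes> f) \<cdot> \<beta> X Y"
    and hexagon_right: "\<lbrakk>X \<in> obj C; Y \<in> obj C; Z \<in> obj C\<rbrakk>
      \<Longrightarrow> \<beta> X (Y \<star> Z) = (\<^bold>1 Y \<boxtimes> \<beta> X Z) \<cdot> (\<beta> X Y \<boxtimes> \<^bold>1 Z)"
    and hexagon_left: "\<lbrakk>X \<in> obj C; Y \<in> obj C; Z \<in> obj C\<rbrakk>
      \<Longrightarrow> \<beta> (X \<star> Y) Z = (\<beta> X Z \<boxtimes> \<^bold>1 Y) \<cdot> (\<^bold>1 X \<boxtimes> \<beta> Y Z)"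
    and twist_hom: "X \<in> obj C \<Longrightarrow> \<theta> X \<in> homs C X X"
    and twist_iso: "X \<in> obj C \<Longrightarrow> is_iso C (\<theta> X)"
    and twist_natural: "f \<in> homs C X Y \<Longrightarrow> \<theta> Y \<cdot> f = f \<cdot> \<theta> X"
    and twist_tens: "\<lbrakk>X \<in> obj C; Y \<in> obj C\<rbrakk>
      \<Longrightarrow> \<theta> (X \<star> Y) = \<beta> Y X \<cdot> \<beta> X Y \<cdot> (\<theta> X \<boxtimes> \<theta> Y)"
    and twist_dual: "X \<in> obj C
      \<Longrightarrow> (\<theta> X \<boxtimes> \<^bold>1 (dual C X)) \<cdot> coev C X = (\<^bold>1 X \<boxtimes> \<theta> (dual C X)) \<cdot> coev C X"

locale strict_ribbon_fusion_category = abelian_category + strict_ribbon_category +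
  assumes finite_dim_homs: "\<lbrakk>X \<in> obj C; Y \<in> obj C\<rbrakk>
      \<Longrightarrow> \<exists>bs. set bs \<subseteq> homs C X Y \<and>
            (\<forall>f \<in> homs C X Y. \<exists>cs. length cs = length bs \<and> f = msum C X Y (map2 (smul C) cs bs))"
    and semisimple: "X \<in> obj C \<Longrightarrow> \<exists>Xs. is_direct_sum C X Xs \<and> (\<forall>Y \<in> set Xs. simple C Y)"
    and finitely_many_simples:
      "\<exists>S. finite S \<and> (\<forall>X \<in> S. simple C X) \<and> (\<forall>X. simple C X \<longrightarrow> (\<exists>Y \<in> S. isomorphic C X Y))"
    and end_unit: "f \<in> homs C \<I> \<I> \<Longrightarrow> \<exists>!c. f = c \<triangleright> \<^bold>1 \<I>"


section \<open>The universal grading\<close>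

text \<open>
  A grading by a group \<open>G\<close> is given by the degrees of the simple objects; the component
  \<open>\<C>\<^sub>a\<close> is the full additive subcategory generated by the simple objects of degree \<open>a\<close>.
\<close>

context
  fixes C :: "('o, 'm, 'k::field) ribbon_structure" (structure)
begin

definition grading :: "('g, 'b) monoid_scheme \<Rightarrow> ('o \<Rightarrow> 'g) \<Rightarrow> bool" where
  "grading G deg \<longleftrightarrow>
     (\<forall>X. simple C X \<longrightarrow> deg X \<in> carrier G) \<and>
     (\<forall>X Y. simple C X \<and> simple C Y \<and> isomorphic C X Y \<longrightarrow> deg X = deg Y) \<and>
     (\<forall>X Y Z. simple C X \<and> simple C Y \<and> simple C Z \<and>
        (\<exists>f \<in> homs C Z (X \<star> Y). is_mono C f) \<longrightarrow> deg Z = deg X \<otimes>\<^bsub>G\<^esub> deg Y)"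

text \<open>
  The support of a grading is a finite subgroup, so testing the universal property against groups
  on \<^typ>\<open>nat\<close> is enough. The factoring homomorphism is unique because \<open>deg\<close> is onto.
\<close>

definition universal_grading :: "('a, 'b) monoid_scheme \<Rightarrow> ('o \<Rightarrow> 'a) \<Rightarrow> bool" where
  "universal_grading A deg \<longleftrightarrow>
     grading A deg \<and>
     (\<forall>a \<in> carrier A. \<exists>X. simple C X \<and> deg X = a) \<and>
     (\<forall>(G :: nat monoid) d. group G \<and> grading G d \<longrightarrow>
        (\<exists>h \<in> hom A G. \<forall>X. simple C X \<longrightarrow> d X = h (deg X)))"

definition component :: "('o \<Rightarrow> 'a) \<Rightarrow> 'a \<Rightarrow> 'o set" where
  "component deg a = {X. \<exists>Xs. is_direct_sum C X Xs \<and> (\<forall>Y \<in> set Xs. simple C Y \<and> deg Y = a)}"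

definition chi :: "('o \<Rightarrow> 'a) \<Rightarrow> 'o \<Rightarrow> 'a \<Rightarrow> 'k" where
  "chi deg \<eta> a = (THE c. \<forall>X. simple C X \<and> X \<in> component deg a \<longrightarrow>
     \<beta> \<eta> X \<cdot> \<beta> X \<eta> = c \<triangleright> \<^bold>1 (X \<star> \<eta>))"

end

locale graded_ribbon_fusion_category =
  strict_ribbon_fusion_category C + comm_group A
  for C :: "('o, 'm, 'k::{alg_closed_field, field_char_0}) ribbon_structure" (structure)
    and A :: "('a, 'b) monoid_scheme" +
  fixes deg :: "'o \<Rightarrow> 'a"
  assumes finite_A: "finite (carrier A)"
    and universal: "universal_grading C A deg"


section \<open>Ribbon zesting data\<close>

record ('a, 'o, 'm, 'k) zesting =
  lam :: "'a \<Rightarrow> 'a \<Rightarrow> 'o"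
  nu :: "'a \<Rightarrow> 'a \<Rightarrow> 'a \<Rightarrow> 'm"
  tz :: "'a \<Rightarrow> 'a \<Rightarrow> 'm"
  eps :: "'a \<Rightarrow> 'k"

definition omega :: "('o, 'm, 'k::field) ribbon_structure \<Rightarrow> ('o \<Rightarrow> 'a) \<Rightarrow> ('a, 'o, 'm, 'k) zesting
    \<Rightarrow> 'a \<Rightarrow> 'a \<Rightarrow> 'a \<Rightarrow> 'k" where
  "omega C deg \<zeta> a b c = chi C deg (lam \<zeta> a b) c"

locale ribbon_zesting =
  graded_ribbon_fusion_category C A deg
  for C :: "('o, 'm, 'k::{alg_closed_field, field_char_0}) ribbon_structure" (structure)
    and A :: "('a, 'b) monoid_scheme" and deg :: "'o \<Rightarrow> 'a" +
  fixes \<zeta> :: "('a, 'o, 'm, 'k) zesting"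
  assumes lam_inv: "\<lbrakk>a \<in> carrier A; b \<in> carrier A\<rbrakk>
      \<Longrightarrow> invertible C (lam \<zeta> a b) \<and> lam \<zeta> a b \<in> component C deg \<one>\<^bsub>A\<^esub>"
    and lam_unit: "a \<in> carrier A \<Longrightarrow> lam \<zeta> \<one>\<^bsub>A\<^esub> a = \<I> \<and> lam \<zeta> a \<one>\<^bsub>A\<^esub> = \<I>"
    and nu_hom: "\<lbrakk>a \<in> carrier A; b \<in> carrier A; c \<in> carrier A\<rbrakk>
      \<Longrightarrow> nu \<zeta> a b c \<in> homs C (lam \<zeta> a b \<star> lam \<zeta> (a \<otimes>\<^bsub>A\<^esub> b) c) (lam \<zeta> b c \<star> lam \<zeta> a (b \<otimes>\<^bsub>A\<^esub> c))"
    and nu_iso: "\<lbrakk>a \<in> carrier A; b \<in> carrier A; c \<in> carrier A\<rbrakk> \<Longrightarrow> is_iso C (nu \<zeta> a b c)"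
    and nu_unit: "\<lbrakk>a \<in> carrier A; b \<in> carrier A; c \<in> carrier A;
        a = \<one>\<^bsub>A\<^esub> \<or> b = \<one>\<^bsub>A\<^esub> \<or> c = \<one>\<^bsub>A\<^esub>\<rbrakk>
      \<Longrightarrow> nu \<zeta> a b c = \<^bold>1 (lam \<zeta> a b \<star> lam \<zeta> (a \<otimes>\<^bsub>A\<^esub> b) c)"
    and nu_cocycle: "\<lbrakk>a \<in> carrier A; b \<in> carrier A; c \<in> carrier A; d \<in> carrier A\<rbrakk>
      \<Longrightarrow> (nu \<zeta> b c d \<boxtimes> \<^bold>1 (lam \<zeta> a (b \<otimes>\<^bsub>A\<^esub> c \<otimes>\<^bsub>A\<^esub> d)))
            \<cdot> (\<^bold>1 (lam \<zeta> b c) \<boxtimes> nu \<zeta> a (b \<otimes>\<^bsub>A\<^esub> c) d)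
            \<cdot> (nu \<zeta> a b c \<boxtimes> \<^bold>1 (lam \<zeta> (a \<otimes>\<^bsub>A\<^esub> b \<otimes>\<^bsub>A\<^esub> c) d))
        = (\<^bold>1 (lam \<zeta> c d) \<boxtimes> nu \<zeta> a b (c \<otimes>\<^bsub>A\<^esub> d))
            \<cdot> (\<beta> (lam \<zeta> a b) (lam \<zeta> c d) \<boxtimes> \<^bold>1 (lam \<zeta> (a \<otimes>\<^bsub>A\<^esub> b) (c \<otimes>\<^bsub>A\<^esub> d)))
            \<cdot> (\<^bold>1 (lam \<zeta> a b) \<boxtimes> nu \<zeta> (a \<otimes>\<^bsub>A\<^esub> b) c d)"
    and tz_hom: "\<lbrakk>a \<in> carrier A; b \<in> carrier A\<rbrakk> \<Longrightarrow> tz \<zeta> a b \<in> homs C (lam \<zeta> a b) (lam \<zeta> b a)"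
    and tz_iso: "\<lbrakk>a \<in> carrier A; b \<in> carrier A\<rbrakk> \<Longrightarrow> is_iso C (tz \<zeta> a b)"
    and tz_unit: "\<lbrakk>a \<in> carrier A; b \<in> carrier A; a = \<one>\<^bsub>A\<^esub> \<or> b = \<one>\<^bsub>A\<^esub>\<rbrakk>
      \<Longrightarrow> tz \<zeta> a b = \<^bold>1 (lam \<zeta> a b)"
    and tz_nu: "\<lbrakk>a \<in> carrier A; b \<in> carrier A; c \<in> carrier A\<rbrakk>
      \<Longrightarrow> nu \<zeta> b c a \<cdot> (\<^bold>1 (lam \<zeta> b c) \<boxtimes> tz \<zeta> a (b \<otimes>\<^bsub>A\<^esub> c)) \<cdot> nu \<zeta> a b c
        = (tz \<zeta> a c \<boxtimes> \<^bold>1 (lam \<zeta> b (a \<otimes>\<^bsub>A\<^esub> c)))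
            \<cdot> nu \<zeta> b a c
            \<cdot> (tz \<zeta> a b \<boxtimes> \<^bold>1 (lam \<zeta> (a \<otimes>\<^bsub>A\<^esub> b) c))"
    and tz_nu_inv: "\<lbrakk>a \<in> carrier A; b \<in> carrier A; c \<in> carrier A\<rbrakk>
      \<Longrightarrow> omega C deg \<zeta> a b c \<triangleright>
            (minv C (nu \<zeta> c a b) \<cdot> (\<^bold>1 (lam \<zeta> a b) \<boxtimes> tz \<zeta> (a \<otimes>\<^bsub>A\<^esub> b) c) \<cdot> minv C (nu \<zeta> a b c))
        = (tz \<zeta> a c \<boxtimes> \<^bold>1 (lam \<zeta> (a \<otimes>\<^bsub>A\<^esub> c) b))
            \<cdot> minv C (nu \<zeta> a c b)
            \<cdot> (tz \<zeta> b c \<boxtimes> \<^bold>1 (lam \<zeta> a (b \<otimes>\<^bsub>A\<^esub> c)))"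
    and eps_one: "eps \<zeta> \<one>\<^bsub>A\<^esub> = 1"
    and eps_dim: "\<lbrakk>a \<in> carrier A; b \<in> carrier A\<rbrakk>
      \<Longrightarrow> eps \<zeta> (a \<otimes>\<^bsub>A\<^esub> b) / (eps \<zeta> a * eps \<zeta> b) = qdim C (lam \<zeta> a b)"
    and eps_square: "a \<in> carrier A \<Longrightarrow> eps \<zeta> a ^ 2 = 1"

definition strict_symmetric_cocycle ::
    "('o, 'm, 'k) ribbon_structure \<Rightarrow> ('a, 'b) monoid_scheme \<Rightarrow> ('a \<Rightarrow> 'a \<Rightarrow> 'o) \<Rightarrow> bool" where
  "strict_symmetric_cocycle C A l \<longleftrightarrow>
     (\<forall>a \<in> carrier A. \<forall>b \<in> carrier A. l a b = l b a) \<and>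
     (\<forall>a \<in> carrier A. \<forall>b \<in> carrier A. \<forall>c \<in> carrier A.
        l a b \<star>\<^bsub>C\<^esub> l (a \<otimes>\<^bsub>A\<^esub> b) c = l b c \<star>\<^bsub>C\<^esub> l a (b \<otimes>\<^bsub>A\<^esub> c))"


section \<open>Colored tangle diagrams\<close>

text \<open>
  A boundary point \<open>Dn a\<close> is written \<open>a\<close> in boundary words, \<open>Up a\<close> is \<open>a*\<close>; \<open>flip\<close>
  (below \<open>p*\<close>) exchanges them. Blackboard framed
  diagrams are terms over elementary pieces, read from top to bottom:
  \<^item> \<open>OverL p q\<close> is the crossing with top boundary \<open>p, q\<close> and bottom boundary \<open>q, p\<close> whose strand
    from top left to bottom right is over; in \<open>OverR p q\<close> the other strand is over;
  \<^item> \<open>Cap p\<close> has empty top boundary and bottom boundary \<open>p, p*\<close>;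
  \<^item> \<open>Cup p\<close> has top boundary \<open>p, p*\<close> and empty bottom boundary;
  \<^item> \<open>Stack S T\<close> is \<open>S \<circ> T\<close>, that is \<open>T\<close> on top of \<open>S\<close>;
  \<^item> \<open>Juxt S T\<close> has \<open>S\<close> to the left of \<open>T\<close>.
\<close>

datatype 'a point = Dn (color: 'a) | Up (color: 'a)

datatype 'a tangle =
    Empty
  | Strand "'a point"
  | OverL "'a point" "'a point"
  | OverR "'a point" "'a point"
  | Cap "'a point"
  | Cup "'a point"
  | Stack "'a tangle" "'a tangle"
  | Juxt "'a tangle" "'a tangle"

primrec flip :: "'a point \<Rightarrow> 'a point" where
  "flip (Dn a) = Up a"
| "flip (Up a) = Dn a"

primrec upper :: "'a tangle \<Rightarrow> 'a point list" where
  "upper Empty = []"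
| "upper (Strand p) = [p]"
| "upper (OverL p q) = [p, q]"
| "upper (OverR p q) = [p, q]"
| "upper (Cap p) = []"
| "upper (Cup p) = [p, flip p]"
| "upper (Stack S T) = upper T"
| "upper (Juxt S T) = upper S @ upper T"

primrec lower :: "'a tangle \<Rightarrow> 'a point list" where
  "lower Empty = []"
| "lower (Strand p) = [p]"
| "lower (OverL p q) = [q, p]"
| "lower (OverR p q) = [q, p]"
| "lower (Cap p) = [p, flip p]"
| "lower (Cup p) = []"
| "lower (Stack S T) = lower S"
| "lower (Juxt S T) = lower S @ lower T"

primrec tangle_diagram :: "('a, 'b) monoid_scheme \<Rightarrow> 'a tangle \<Rightarrow> bool" where
  "tangle_diagram A Empty = True"
| "tangle_diagram A (Strand p) = (color p \<in> carrier A)"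
| "tangle_diagram A (OverL p q) = (color p \<in> carrier A \<and> color q \<in> carrier A)"
| "tangle_diagram A (OverR p q) = (color p \<in> carrier A \<and> color q \<in> carrier A)"
| "tangle_diagram A (Cap p) = (color p \<in> carrier A)"
| "tangle_diagram A (Cup p) = (color p \<in> carrier A)"
| "tangle_diagram A (Stack S T) = (tangle_diagram A S \<and> tangle_diagram A T \<and> upper S = lower T)"
| "tangle_diagram A (Juxt S T) = (tangle_diagram A S \<and> tangle_diagram A T)"

definition link_diagram :: "('a, 'b) monoid_scheme \<Rightarrow> 'a tangle \<Rightarrow> bool" where
  "link_diagram A D \<longleftrightarrow> tangle_diagram A D \<and> upper D = [] \<and> lower D = []"

text \<open>
  \<open>across A i p\<close> is the color of the region to the right of a strand through \<open>p\<close> if the region to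
  its left has color \<open>i\<close>. The regions of a shadow-colored diagram are determined by the base color;
  all functions below take the color of the leftmost region as an argument. The color of the
  rightmost region is the same along the top and the bottom boundary.
\<close>

primrec across :: "('a, 'b) monoid_scheme \<Rightarrow> 'a \<Rightarrow> 'a point \<Rightarrow> 'a" where
  "across A i (Dn a) = i \<otimes>\<^bsub>A\<^esub> a"
| "across A i (Up a) = i \<otimes>\<^bsub>A\<^esub> inv\<^bsub>A\<^esub> a"

definition rightmost :: "('a, 'b) monoid_scheme \<Rightarrow> 'a \<Rightarrow> 'a tangle \<Rightarrow> 'a" where
  "rightmost A i T = foldl (across A) i (upper T)"


section \<open>The zest invariant\<close>

context
  fixes C :: "('o, 'm, 'k::field) ribbon_structure" (structure)
    and A :: "('a, 'b) monoid_scheme"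
    and deg :: "'o \<Rightarrow> 'a"
    and \<zeta> :: "('a, 'o, 'm, 'k) zesting"
begin

definition lam1 :: "'a \<Rightarrow> 'o" where
  "lam1 a = lam \<zeta> a (inv\<^bsub>A\<^esub> a)"

definition nu1 :: "'a \<Rightarrow> 'm" where
  "nu1 a = nu \<zeta> a (inv\<^bsub>A\<^esub> a) a"

definition phi :: "'a \<Rightarrow> 'a \<Rightarrow> 'a \<Rightarrow> 'm" where
  "phi i a b = minv C (nu \<zeta> i b a) \<cdot> (tz \<zeta> a b \<boxtimes> \<^bold>1 (lam \<zeta> i (a \<otimes>\<^bsub>A\<^esub> b))) \<cdot> nu \<zeta> i a b"

primrec zest_point :: "'a \<Rightarrow> 'a point \<Rightarrow> 'o" where
  "zest_point i (Dn a) = lam \<zeta> i a"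
| "zest_point i (Up a) = dual C (lam1 a) \<star> lam \<zeta> i (inv\<^bsub>A\<^esub> a)"

fun zest_overL :: "'a \<Rightarrow> 'a point \<Rightarrow> 'a point \<Rightarrow> 'm" where
  "zest_overL i (Dn a) (Dn b) = phi i a b"
| "zest_overL i (Dn a) (Up b) =
     (\<^bold>1 (dual C (lam1 b)) \<boxtimes> phi i a (inv\<^bsub>A\<^esub> b)) \<cdot>
     (minv C (\<beta> (dual C (lam1 b)) (lam \<zeta> i a)) \<boxtimes> \<^bold>1 (lam \<zeta> (i \<otimes>\<^bsub>A\<^esub> a) (inv\<^bsub>A\<^esub> b)))"
| "zest_overL i (Up a) (Dn b) =
     inverse (omega C deg \<zeta> a (inv\<^bsub>A\<^esub> a) b) \<triangleright>
     ((\<beta> (dual C (lam1 a)) (lam \<zeta> i b) \<boxtimes> \<^bold>1 (lam \<zeta> (i \<otimes>\<^bsub>A\<^esub> b) (inv\<^bsub>A\<^esub> a))) \<cdot>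
      (\<^bold>1 (dual C (lam1 a)) \<boxtimes> phi i (inv\<^bsub>A\<^esub> a) b))"
| "zest_overL i (Up a) (Up b) =
     omega C deg \<zeta> a (inv\<^bsub>A\<^esub> a) b \<triangleright>
     ((\<^bold>1 (dual C (lam1 b)) \<boxtimes> \<beta> (dual C (lam1 a)) (lam \<zeta> i (inv\<^bsub>A\<^esub> b))
         \<boxtimes> \<^bold>1 (lam \<zeta> (i \<otimes>\<^bsub>A\<^esub> inv\<^bsub>A\<^esub> b) (inv\<^bsub>A\<^esub> a))) \<cdot>
      (\<^bold>1 (dual C (lam1 b)) \<boxtimes> \<^bold>1 (dual C (lam1 a)) \<boxtimes> phi i (inv\<^bsub>A\<^esub> a) (inv\<^bsub>A\<^esub> b)) \<cdot>
      (\<beta> (dual C (lam1 a)) (dual C (lam1 b)) \<boxtimes> \<^bold>1 (lam \<zeta> i (inv\<^bsub>A\<^esub> a))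
         \<boxtimes> \<^bold>1 (lam \<zeta> (i \<otimes>\<^bsub>A\<^esub> inv\<^bsub>A\<^esub> a) (inv\<^bsub>A\<^esub> b))) \<cdot>
      (\<^bold>1 (dual C (lam1 a)) \<boxtimes> \<beta> (lam \<zeta> i (inv\<^bsub>A\<^esub> a)) (dual C (lam1 b))
         \<boxtimes> \<^bold>1 (lam \<zeta> (i \<otimes>\<^bsub>A\<^esub> inv\<^bsub>A\<^esub> a) (inv\<^bsub>A\<^esub> b))))"

primrec zest_cap :: "'a \<Rightarrow> 'a point \<Rightarrow> 'm" where
  "zest_cap i (Dn a) =
     inverse (qdim C (lam1 a)) \<triangleright>
     ((\<beta> (dual C (lam1 a)) (lam \<zeta> i a) \<boxtimes> \<^bold>1 (lam \<zeta> (i \<otimes>\<^bsub>A\<^esub> a) (inv\<^bsub>A\<^esub> a))) \<cdot>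
      (\<^bold>1 (dual C (lam1 a)) \<boxtimes> minv C (nu \<zeta> i a (inv\<^bsub>A\<^esub> a))) \<cdot>
      coevr C (lam1 a))"
| "zest_cap i (Up a) =
     (inverse (qdim C (lam1 a)) * inverse (eps \<zeta> a)) \<triangleright>
     ((\<^bold>1 (dual C (lam1 a)) \<boxtimes> minv C (nu \<zeta> i (inv\<^bsub>A\<^esub> a) a)) \<cdot>
      (\<^bold>1 (dual C (lam1 a)) \<boxtimes> nu1 a) \<cdot>
      coevr C (lam1 a))"

primrec zest_cup :: "'a \<Rightarrow> 'a point \<Rightarrow> 'm" where
  "zest_cup i (Dn a) =
     eps \<zeta> a \<triangleright>
     (ev C (lam1 a) \<cdot>
      (\<^bold>1 (dual C (lam1 a)) \<boxtimes> nu \<zeta> i a (inv\<^bsub>A\<^esub> a)) \<cdot>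
      (\<beta> (lam \<zeta> i a) (dual C (lam1 a)) \<boxtimes> \<^bold>1 (lam \<zeta> (i \<otimes>\<^bsub>A\<^esub> a) (inv\<^bsub>A\<^esub> a))))"
| "zest_cup i (Up a) =
     ev C (lam1 a) \<cdot>
     (\<^bold>1 (dual C (lam1 a)) \<boxtimes> minv C (nu1 a)) \<cdot>
     (\<^bold>1 (dual C (lam1 a)) \<boxtimes> nu \<zeta> i (inv\<^bsub>A\<^esub> a) a)"

text \<open>The crossing inverse to \<open>OverR p q\<close> is \<open>OverL q p\<close>.\<close>

primrec zest_functor :: "'a \<Rightarrow> 'a tangle \<Rightarrow> 'm" where
  "zest_functor i Empty = \<^bold>1 \<I>"
| "zest_functor i (Strand p) = \<^bold>1 (zest_point i p)"
| "zest_functor i (OverL p q) = zest_overL i p q"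
| "zest_functor i (OverR p q) = minv C (zest_overL i q p)"
| "zest_functor i (Cap p) = zest_cap i p"
| "zest_functor i (Cup p) = zest_cup i p"
| "zest_functor i (Stack S T) = zest_functor i S \<cdot> zest_functor i T"
| "zest_functor i (Juxt S T) = zest_functor i S \<boxtimes> zest_functor (rightmost A i S) T"

definition zest_invariant :: "'a \<Rightarrow> 'a tangle \<Rightarrow> 'k" where
  "zest_invariant i D = scalar C (zest_functor i D)"

end


section \<open>The shadow rack cocycle invariant\<close>

text \<open>
  \<open>face_down A i p q\<close> describes a crossing with top boundary \<open>p, q\<close> and left region \<open>i\<close> after rotating
  it until both strands point down: the color of the region then to its left and the colors of the
  incoming left and right strands. Two upward strands need a half turn, which moves the right region
  to the left and keeps the strand through \<open>p\<close> on the top left. If only \<open>q\<close> is up, both strands run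
  from left to right; a clockwise quarter turn moves the bottom region to the left and makes the
  strand through \<open>q\<close> the incoming left one. If only \<open>p\<close> is up, a counterclockwise quarter turn moves
  the top region to the left, and again the strand through \<open>q\<close> comes in on the left.
\<close>

fun face_down :: "('a, 'b) monoid_scheme \<Rightarrow> 'a \<Rightarrow> 'a point \<Rightarrow> 'a point \<Rightarrow> 'a \<times> 'a \<times> 'a" where
  "face_down A i (Dn a) (Dn b) = (i, a, b)"
| "face_down A i (Up a) (Up b) = (across A (across A i (Up a)) (Up b), a, b)"
| "face_down A i (Dn a) (Up b) = (across A i (Up b), b, a)"
| "face_down A i (Up a) (Dn b) = (across A i (Up a), b, a)"

fun parallel :: "'a point \<Rightarrow> 'a point \<Rightarrow> bool" where
  "parallel (Dn a) (Dn b) = True"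
| "parallel (Up a) (Up b) = True"
| "parallel (Dn a) (Up b) = False"
| "parallel (Up a) (Dn b) = False"

definition boltzmann :: "('a \<Rightarrow> 'a \<Rightarrow> 'a \<Rightarrow> 'k::field) \<Rightarrow> bool \<Rightarrow> 'a \<times> 'a \<times> 'a \<Rightarrow> 'k" where
  "boltzmann w positive = (\<lambda>(i, a, b). if positive then w i a b else inverse (w i b a))"

text \<open>
  A crossing is positive iff after the rotation the incoming left strand is over. This is the strand
  through \<open>p\<close> if \<open>p\<close> and \<open>q\<close> are parallel and the strand through \<open>q\<close> otherwise.
\<close>

primrec shadow_Z :: "('a, 'b) monoid_scheme \<Rightarrow> ('a \<Rightarrow> 'a \<Rightarrow> 'a \<Rightarrow> 'k::field) \<Rightarrow> 'a \<Rightarrow> 'a tangle \<Rightarrow> 'k"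
where
  "shadow_Z A w i Empty = 1"
| "shadow_Z A w i (Strand p) = 1"
| "shadow_Z A w i (OverL p q) = boltzmann w (parallel p q) (face_down A i p q)"
| "shadow_Z A w i (OverR p q) = boltzmann w (\<not> parallel p q) (face_down A i p q)"
| "shadow_Z A w i (Cap p) = 1"
| "shadow_Z A w i (Cup p) = 1"
| "shadow_Z A w i (Stack S T) = shadow_Z A w i S * shadow_Z A w i T"
| "shadow_Z A w i (Juxt S T) = shadow_Z A w i S * shadow_Z A w (rightmost A i S) T"

end

theory Submission
  imports Defs "HOL-Library.Multiset" "HOL-Library.Countable_Set"
begin

text \<open>
  A list of colors is read as a stack of downward strands with base color \<open>e\<close>. Its object
  \<open>strands xs\<close> does not depend on the order of the list, because \<open>\<lambda>\<close> is a strict symmetric cocycle.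
  A boundary word to the right of a stack can be absorbed into it: a downward point joins the stack,
  an upward point is cupped off against a strand of its color. If the stack contains enough strands
  of every color, then absorption turns every cap and cup into an identity and every crossing into
  its Boltzmann weight, independently of the orientations. As absorption is compatible with stacking
  and juxtaposition, the zest functor becomes the product of the Boltzmann weights.

  For crossings with upward strands this rests on scalar identities between \<open>\<nu>\<close>, \<open>t\<close>, \<open>\<omega>\<close> and the
  braiding, which follow from the zesting axioms, and on the triviality of double braidings in
  \<open>Inv(\<C>\<^sub>e)\<close>: the scalar by which an invertible object braids twice with a simple object is itself a
  grading, so it depends only on the degree by the universal property.
\<close>

subsection \<open>Calculus of morphisms\<close>

text \<open>The object of an upward point contains the dual of \<open>lam1 a\<close>, so a crossing
  with an upward strand is a braiding between different objects and has no scalar to compare with a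
  Boltzmann weight. Cupping \<open>Up a\<close> off against a strand of color \<open>a\<close>
  removes the dual. What remains are tensor products of values of \<lambda>, which the strict
  symmetric cocycle identifies on the nose and whose endomorphisms are scalars. Absorption never has
  to be inverted: a link has empty boundary words, where absorption is the identity of an invertible
  object, and the two numbers can be compared there. Every point uses up at most one strand, so a
  supply proportional to the size of the diagram suffices. The hypothesis on \<epsilon> gives each
  \<open>lam1 a\<close> dimension 1, so that a circle has value 1, and makes both ways of cupping
  off the middle point of \<open>Dn a\<close>, \<open>Up a\<close>, \<open>Dn a\<close> agree. The
  numbers \<omega> come from the definite description \<open>chi\<close>; what the crossings need of
  them, including \<open>om_inv\<close>, is derived from the axioms on \<nu> and t.\<close>

context linear_category
begin

lemma homs_iff: "f \<in> homs C X Y \<longleftrightarrow> f \<in> arr C \<and> src C f = X \<and> tgt C f = Y"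
  by (simp add: homs_def)

lemma src_obj' [simp]: "f \<in> arr C \<Longrightarrow> src C f \<in> obj C"
  and tgt_obj' [simp]: "f \<in> arr C \<Longrightarrow> tgt C f \<in> obj C"
  by (simp_all add: src_obj tgt_obj)

lemma id_arr [simp]:
  assumes "X \<in> obj C"
  shows "\<^bold>1 X \<in> arr C" "src C (\<^bold>1 X) = X" "tgt C (\<^bold>1 X) = X"
  using id_hom[OF assms] by (simp_all add: homs_iff)

lemma comp_arr [simp]:
  assumes "f \<in> arr C" "g \<in> arr C" "src C g = tgt C f"
  shows "g \<cdot> f \<in> arr C" "src C (g \<cdot> f) = src C f" "tgt C (g \<cdot> f) = tgt C g"
  using comp_hom[of f "src C f" "tgt C f" g "tgt C g"] assms by (simp_all add: homs_iff)

lemma comp_assoc' [simp]: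
  "\<lbrakk>f \<in> arr C; g \<in> arr C; h \<in> arr C; src C g = tgt C f; src C h = tgt C g\<rbrakk>
    \<Longrightarrow> (h \<cdot> g) \<cdot> f = h \<cdot> (g \<cdot> f)"
  using comp_assoc[of f "src C f" "tgt C f" g "tgt C g" h "tgt C h"] by (simp add: homs_iff)

lemma id_comp [simp]: "\<lbrakk>f \<in> arr C; tgt C f = X\<rbrakk> \<Longrightarrow> \<^bold>1 X \<cdot> f = f"
  and comp_id [simp]: "\<lbrakk>f \<in> arr C; src C f = X\<rbrakk> \<Longrightarrow> f \<cdot> \<^bold>1 X = f"
  using id_left[of f] id_right[of f] by (auto simp: homs_iff)

lemma smul_arr [simp]:
  assumes "f \<in> arr C"
  shows "c \<triangleright> f \<in> arr C" "src C (c \<triangleright> f) = src C f" "tgt C (c \<triangleright> f) = tgt C f"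
  using smul_hom[of f "src C f" "tgt C f" c] assms by (simp_all add: homs_iff)

lemma smul_one' [simp]: "f \<in> arr C \<Longrightarrow> 1 \<triangleright> f = f"
  using smul_one[of f "src C f" "tgt C f"] by (simp add: homs_iff)

lemma smul_smul' [simp]: "f \<in> arr C \<Longrightarrow> c \<triangleright> (d \<triangleright> f) = (c * d) \<triangleright> f"
  using smul_smul[of f "src C f" "tgt C f"] by (simp add: homs_iff)

lemma comp_smul [simp]:
  assumes "f \<in> arr C" "g \<in> arr C" "src C g = tgt C f"
  shows "(c \<triangleright> g) \<cdot> f = c \<triangleright> (g \<cdot> f)" "g \<cdot> (c \<triangleright> f) = c \<triangleright> (g \<cdot> f)"
  using comp_smul_left[of f "src C f" "tgt C f" g "tgt C g"]
    comp_smul_right[of f "src C f" "tgt C f" g "tgt C g"] assms by (simp_all add: homs_iff)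

lemma add_arr [simp]:
  assumes "f \<in> arr C" "g \<in> arr C" "src C f = src C g" "tgt C f = tgt C g"
  shows "f \<boxplus> g \<in> arr C" "src C (f \<boxplus> g) = src C g" "tgt C (f \<boxplus> g) = tgt C g"
  using add_hom[of f "src C f" "tgt C f" g] assms by (simp_all add: homs_iff)

lemma zero_arr [simp]:
  assumes "X \<in> obj C" "Y \<in> obj C"
  shows "\<^bold>0 X Y \<in> arr C" "src C (\<^bold>0 X Y) = X" "tgt C (\<^bold>0 X Y) = Y"
  using zero_hom[OF assms] by (simp_all add: homs_iff)

lemma smul_0: "\<lbrakk>f \<in> arr C; src C f = X; tgt C f = Y\<rbrakk> \<Longrightarrow> 0 \<triangleright> f = \<^bold>0 X Y"
  using add_smul[of f X Y 1 "-1"] add_neg[of f X Y] by (simp add: homs_iff)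

lemma smul_zero: "\<lbrakk>X \<in> obj C; Y \<in> obj C\<rbrakk> \<Longrightarrow> c \<triangleright> \<^bold>0 X Y = \<^bold>0 X Y"
  using smul_0[of "\<^bold>0 X Y" X Y] smul_smul'[of "\<^bold>0 X Y" c 0] by simp

text \<open>The axioms do not state that composites with zero vanish. Bilinearity gives it: the zero
  morphism is its own multiple by the scalar 0, which can be pulled out of the composite.\<close>

lemma comp_zero: "\<lbrakk>f \<in> arr C; src C f = Y; X \<in> obj C\<rbrakk> \<Longrightarrow> f \<cdot> \<^bold>0 X Y = \<^bold>0 X (tgt C f)"
  using smul_0[of "\<^bold>0 X Y" X Y] smul_0[of "f \<cdot> \<^bold>0 X Y" X "tgt C f"] comp_smul(2)[of "\<^bold>0 X Y" f 0]
  by (auto simp del: comp_smul)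

lemma zero_comp: "\<lbrakk>f \<in> arr C; tgt C f = Y; Z \<in> obj C\<rbrakk> \<Longrightarrow> \<^bold>0 Y Z \<cdot> f = \<^bold>0 (src C f) Z"
  using smul_0[of "\<^bold>0 Y Z" Y Z] smul_0[of "\<^bold>0 Y Z \<cdot> f" "src C f" Z] comp_smul(1)[of f "\<^bold>0 Y Z" 0]
  by (auto simp del: comp_smul)

lemma smul_left_cancel: "\<lbrakk>c \<triangleright> f = c \<triangleright> g; c \<noteq> 0; f \<in> arr C; g \<in> arr C\<rbrakk> \<Longrightarrow> f = g"
  by (metis smul_smul' smul_one' left_inverse)

lemma smul_right_cancel:
  assumes "c \<triangleright> f = d \<triangleright> f" "f \<in> arr C" "f \<noteq> \<^bold>0 (src C f) (tgt C f)"
  shows "c = d"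
proof (rule ccontr)
  assume "c \<noteq> d"
  have h: "f \<in> homs C (src C f) (tgt C f)" using assms by (simp add: homs_iff)
  have "(c - d) \<triangleright> f = c \<triangleright> f \<boxplus> (-1) \<triangleright> (d \<triangleright> f)"
    using add_smul[OF h, of c "- d"] assms(2) by simp
  also have "\<dots> = \<^bold>0 (src C f) (tgt C f)"
    using add_neg[of "c \<triangleright> f" "src C f" "tgt C f"] assms(1,2) by (simp add: homs_iff)
  finally have "(c - d) \<triangleright> f = (c - d) \<triangleright> \<^bold>0 (src C f) (tgt C f)"
    using assms(2) by (simp add: smul_zero)
  then show False
    using smul_left_cancel[of "c - d" f] \<open>c \<noteq> d\<close> assms by (simp add: smul_zero)
qed

lemma is_inverse_unique:
  assumes "is_inverse C f g" "is_inverse C f g'"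
  shows "g = g'"
proof -
  have "g = g \<cdot> (f \<cdot> g')" using assms by (auto simp: is_inverse_def homs_iff)
  also have "\<dots> = (g \<cdot> f) \<cdot> g'" by (rule comp_assoc'[symmetric]) (use assms in \<open>auto simp: is_inverse_def homs_iff\<close>)
  also have "\<dots> = g'" using assms by (auto simp: is_inverse_def homs_iff simp del: comp_assoc')
  finally show ?thesis .
qed

lemma minv_eq:
  assumes "f \<in> arr C" "g \<in> arr C" "src C g = tgt C f" "tgt C g = src C f"
    "g \<cdot> f = \<^bold>1 (src C f)" "f \<cdot> g = \<^bold>1 (tgt C f)"
  shows "is_iso C f" "minv C f = g"
proof -
  have *: "is_inverse C f g" using assms by (simp add: is_inverse_def homs_iff)
  then show "is_iso C f" by (auto simp: is_iso_def)
  show "minv C f = g"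
    unfolding minv_def using * is_inverse_unique[OF *] by (metis the_equality)
qed

lemma minv_arr [simp]:
  assumes "is_iso C f"
  shows "minv C f \<in> arr C" "src C (minv C f) = tgt C f" "tgt C (minv C f) = src C f"
    "minv C f \<cdot> f = \<^bold>1 (src C f)" "f \<cdot> minv C f = \<^bold>1 (tgt C f)"
proof -
  obtain g where g: "is_inverse C f g" using assms by (auto simp: is_iso_def)
  then have "minv C f = g"
    using minv_eq(2)[of f g] by (simp add: is_inverse_def homs_iff)
  then show "minv C f \<in> arr C" "src C (minv C f) = tgt C f" "tgt C (minv C f) = src C f"
    "minv C f \<cdot> f = \<^bold>1 (src C f)" "f \<cdot> minv C f = \<^bold>1 (tgt C f)"
    using g by (simp_all add: is_inverse_def homs_iff)
qed

lemma iso_arr: "is_iso C f \<Longrightarrow> f \<in> arr C"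
  by (auto simp: is_iso_def is_inverse_def)

lemma minv_comp_cancel [simp]:
  "\<lbrakk>is_iso C f; g \<in> arr C; tgt C g = src C f\<rbrakk> \<Longrightarrow> minv C f \<cdot> (f \<cdot> g) = g"
  "\<lbrakk>is_iso C f; g \<in> arr C; tgt C g = tgt C f\<rbrakk> \<Longrightarrow> f \<cdot> (minv C f \<cdot> g) = g"
  by (simp_all add: iso_arr flip: comp_assoc')

lemma iso_cancel_left:
  "\<lbrakk>f \<cdot> g = f \<cdot> h; is_iso C f; g \<in> arr C; h \<in> arr C; tgt C g = src C f; tgt C h = src C f\<rbrakk> \<Longrightarrow> g = h"
  by (metis minv_comp_cancel(1))

lemma iso_cancel_right:
  assumes "g \<cdot> f = h \<cdot> f" "is_iso C f" "g \<in> arr C" "h \<in> arr C" "src C g = tgt C f" "src C h = tgt C f"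
  shows "g = h"
proof -
  have f: "f \<in> arr C" using assms(2) by (rule iso_arr)
  have "k = (k \<cdot> f) \<cdot> minv C f" if "k \<in> arr C" "src C k = tgt C f" for k
    using that assms(2) f by simp
  from this[OF assms(3,5)] this[OF assms(4,6)] show ?thesis using assms(1) by metis
qed

lemma is_iso_id [simp]: "X \<in> obj C \<Longrightarrow> is_iso C (\<^bold>1 X)" "X \<in> obj C \<Longrightarrow> minv C (\<^bold>1 X) = \<^bold>1 X"
  using minv_eq[of "\<^bold>1 X" "\<^bold>1 X"] by simp_all

lemma is_iso_comp [simp]:
  assumes "is_iso C f" "is_iso C g" "src C g = tgt C f"
  shows "is_iso C (g \<cdot> f)"
  using minv_eq(1)[of "g \<cdot> f" "minv C f \<cdot> minv C g"] assms iso_arr[of f] iso_arr[of g] by simp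

lemma is_iso_smul [simp]:
  assumes "is_iso C f" "c \<noteq> 0"
  shows "is_iso C (c \<triangleright> f)" "minv C (c \<triangleright> f) = inverse c \<triangleright> minv C f"
  using minv_eq[of "c \<triangleright> f" "inverse c \<triangleright> minv C f"] assms iso_arr[of f] by simp_all

lemma is_iso_minv [simp]:
  assumes "is_iso C f"
  shows "is_iso C (minv C f)" "minv C (minv C f) = f"
  using minv_eq[of "minv C f" f] assms iso_arr[of f] by simp_all

end

section \<open>Tensor products and invertible objects\<close>

context strict_monoidal_category
begin

lemma tens_arr [simp]:
  assumes "f \<in> arr C" "g \<in> arr C"
  shows "f \<boxtimes> g \<in> arr C" "src C (f \<boxtimes> g) = src C f \<star> src C g" "tgt C (f \<boxtimes> g) = tgt C f \<star> tgt C g"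
  using tens_hom[of f "src C f" "tgt C f" g "src C g" "tgt C g"] assms by (simp_all add: homs_iff)

lemmas [simp] = unit_obj tens_obj tens_assoc_obj tens_unit_left_obj tens_unit_right_obj
  tens_assoc tens_unit_left tens_unit_right tens_smul_left tens_smul_right

lemma interchange':
  "\<lbrakk>f \<in> arr C; f' \<in> arr C; g \<in> arr C; g' \<in> arr C; src C f' = tgt C f; src C g' = tgt C g\<rbrakk>
    \<Longrightarrow> (f' \<boxtimes> g') \<cdot> (f \<boxtimes> g) = (f' \<cdot> f) \<boxtimes> (g' \<cdot> g)"
  using interchange[of f "src C f" "tgt C f" f' "tgt C f'" g "src C g" "tgt C g" g' "tgt C g'"]
  by (simp add: homs_iff)

lemma whisker_left:
  "\<lbrakk>f \<in> arr C; g \<in> arr C; src C g = tgt C f; X \<in> obj C\<rbrakk>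
    \<Longrightarrow> \<^bold>1 X \<boxtimes> (g \<cdot> f) = (\<^bold>1 X \<boxtimes> g) \<cdot> (\<^bold>1 X \<boxtimes> f)"
  by (simp add: interchange')

lemma whisker_right:
  "\<lbrakk>f \<in> arr C; g \<in> arr C; src C g = tgt C f; X \<in> obj C\<rbrakk>
    \<Longrightarrow> (g \<cdot> f) \<boxtimes> \<^bold>1 X = (g \<boxtimes> \<^bold>1 X) \<cdot> (f \<boxtimes> \<^bold>1 X)"
  by (simp add: interchange')

lemma slide:
  assumes "f \<in> arr C" "g \<in> arr C" "src C f = X" "tgt C f = X'" "src C g = Y" "tgt C g = Y'"
  shows "(f \<boxtimes> \<^bold>1 Y') \<cdot> (\<^bold>1 X \<boxtimes> g) = f \<boxtimes> g" "(\<^bold>1 X' \<boxtimes> g) \<cdot> (f \<boxtimes> \<^bold>1 Y) = f \<boxtimes> g"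
  using assms by (auto simp: interchange')

lemma is_iso_tens [simp]:
  assumes "is_iso C f" "is_iso C g"
  shows "is_iso C (f \<boxtimes> g)" "minv C (f \<boxtimes> g) = minv C f \<boxtimes> minv C g"
  using minv_eq[of "f \<boxtimes> g" "minv C f \<boxtimes> minv C g"] assms iso_arr[of f] iso_arr[of g]
  by (simp_all add: interchange' tens_id)

lemma tens_zero:
  assumes "X \<in> obj C" "Y \<in> obj C" "g \<in> arr C"
  shows "\<^bold>0 X Y \<boxtimes> g = \<^bold>0 (X \<star> src C g) (Y \<star> tgt C g)"
    "g \<boxtimes> \<^bold>0 X Y = \<^bold>0 (src C g \<star> X) (tgt C g \<star> Y)"
  using assms smul_0[of "\<^bold>0 X Y" X Y] tens_smul_left[of "\<^bold>0 X Y" g 0] tens_smul_right[of g "\<^bold>0 X Y" 0]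
    smul_0[of "\<^bold>0 X Y \<boxtimes> g" "X \<star> src C g" "Y \<star> tgt C g"]
    smul_0[of "g \<boxtimes> \<^bold>0 X Y" "src C g \<star> X" "tgt C g \<star> Y"]
  by auto

lemma invertible_obtain:
  assumes "invertible C X"
  obtains Y u v where "X \<in> obj C" "Y \<in> obj C" "invertible C Y"
    "is_iso C u" "u \<in> arr C" "src C u = X \<star> Y" "tgt C u = \<I>"
    "is_iso C v" "v \<in> arr C" "src C v = Y \<star> X" "tgt C v = \<I>"
proof -
  obtain Y where Y: "X \<in> obj C" "Y \<in> obj C" "isomorphic C (X \<star> Y) \<I>" "isomorphic C (Y \<star> X) \<I>"
    using assms by (auto simp: invertible_def)
  moreover from this have "invertible C Y" by (auto simp: invertible_def)
  ultimately show thesis using that by (auto simp: isomorphic_def homs_iff)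
qed

lemma invertible_obj: "invertible C X \<Longrightarrow> X \<in> obj C"
  by (simp add: invertible_def)

text \<open>Tensoring once more with an inverse \<open>Y\<close> of \<open>X\<close> and conjugating
  with \<open>u\<close>, an isomorphism from \<open>X \<star> Y\<close> to the unit, recovers
  \<open>f\<close> by interchange.\<close>

lemma tens_right_faithful:
  assumes X: "invertible C X" and fg: "f \<in> arr C" "g \<in> arr C" "src C f = src C g" "tgt C f = tgt C g"
    and eq: "f \<boxtimes> \<^bold>1 X = g \<boxtimes> \<^bold>1 X"
  shows "f = g"
proof -
  obtain Y u where u: "X \<in> obj C" "Y \<in> obj C" "is_iso C u" "u \<in> arr C" "src C u = X \<star> Y" "tgt C u = \<I>"
    using X by (rule invertible_obtain)
  have "h \<cdot> (\<^bold>1 (src C h) \<boxtimes> u) = (\<^bold>1 (tgt C h) \<boxtimes> u) \<cdot> ((h \<boxtimes> \<^bold>1 X) \<boxtimes> \<^bold>1 Y)" if "h \<in> arr C" for h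
    using that u slide[of h u "src C h" "tgt C h" "X \<star> Y" \<I>] by (simp add: tens_id)
  from this[of f] this[of g] have "f \<cdot> (\<^bold>1 (src C f) \<boxtimes> u) = g \<cdot> (\<^bold>1 (src C f) \<boxtimes> u)"
    using fg eq by simp
  then show ?thesis by (rule iso_cancel_right) (use u fg in simp_all)
qed

lemma tens_left_faithful:
  assumes X: "invertible C X" and fg: "f \<in> arr C" "g \<in> arr C" "src C f = src C g" "tgt C f = tgt C g"
    and eq: "\<^bold>1 X \<boxtimes> f = \<^bold>1 X \<boxtimes> g"
  shows "f = g"
proof -
  obtain Y v where v: "X \<in> obj C" "Y \<in> obj C" "is_iso C v" "v \<in> arr C" "src C v = Y \<star> X" "tgt C v = \<I>"
    using X by (rule invertible_obtain)
  have "h \<cdot> (v \<boxtimes> \<^bold>1 (src C h)) = (v \<boxtimes> \<^bold>1 (tgt C h)) \<cdot> (\<^bold>1 Y \<boxtimes> (\<^bold>1 X \<boxtimes> h))" if "h \<in> arr C" for h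
    using that v slide[of v h "Y \<star> X" \<I> "src C h" "tgt C h"] tens_assoc[of "\<^bold>1 Y" "\<^bold>1 X" h] 
    by (simp add: tens_id del: tens_assoc)
  from this[of f] this[of g] have "f \<cdot> (v \<boxtimes> \<^bold>1 (src C f)) = g \<cdot> (v \<boxtimes> \<^bold>1 (src C f))"
    using fg eq by simp
  then show ?thesis by (rule iso_cancel_right) (use v fg in simp_all)
qed

lemma invertible_tens:
  assumes "invertible C X" "invertible C X'"
  shows "invertible C (X \<star> X')"
proof -
  obtain Y u v where 1: "X \<in> obj C" "Y \<in> obj C"
    "is_iso C u" "u \<in> arr C" "src C u = X \<star> Y" "tgt C u = \<I>"
    "is_iso C v" "v \<in> arr C" "src C v = Y \<star> X" "tgt C v = \<I>"
    using assms(1) by (rule invertible_obtain)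
  obtain Y' u' v' where 2: "X' \<in> obj C" "Y' \<in> obj C"
    "is_iso C u'" "u' \<in> arr C" "src C u' = X' \<star> Y'" "tgt C u' = \<I>"
    "is_iso C v'" "v' \<in> arr C" "src C v' = Y' \<star> X'" "tgt C v' = \<I>"
    using assms(2) by (rule invertible_obtain)
  have "u \<cdot> (\<^bold>1 X \<boxtimes> u' \<boxtimes> \<^bold>1 Y) \<in> homs C ((X \<star> X') \<star> (Y' \<star> Y)) \<I>" "is_iso C (u \<cdot> (\<^bold>1 X \<boxtimes> u' \<boxtimes> \<^bold>1 Y))"
    "v' \<cdot> (\<^bold>1 Y' \<boxtimes> v \<boxtimes> \<^bold>1 X') \<in> homs C ((Y' \<star> Y) \<star> (X \<star> X')) \<I>" "is_iso C (v' \<cdot> (\<^bold>1 Y' \<boxtimes> v \<boxtimes> \<^bold>1 X'))"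
    using 1 2 by (auto simp: homs_iff)
  then have "isomorphic C ((X \<star> X') \<star> (Y' \<star> Y)) \<I>" "isomorphic C ((Y' \<star> Y) \<star> (X \<star> X')) \<I>"
    unfolding isomorphic_def by blast+
  then show ?thesis
    unfolding invertible_def using 1(1,2) 2(1,2) by (intro conjI bexI[of _ "Y' \<star> Y"]) auto
qed

lemma invertible_unit: "invertible C \<I>"
  unfolding invertible_def isomorphic_def
  by (auto intro!: bexI[of _ \<I>] bexI[of _ "\<^bold>1 \<I>"] simp: homs_iff)

end

section \<open>Braiding with the unit and with duals\<close>

context strict_ribbon_category
begin

lemma braid_arr [simp]:
  assumes "X \<in> obj C" "Y \<in> obj C"
  shows "\<beta> X Y \<in> arr C" "src C (\<beta> X Y) = X \<star> Y" "tgt C (\<beta> X Y) = Y \<star> X" "is_iso C (\<beta> X Y)"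
  using braid_hom[OF assms] braid_iso[OF assms] by (simp_all add: homs_iff)

lemma ev_arr [simp]:
  assumes "X \<in> obj C"
  shows "dual C X \<in> obj C" "ev C X \<in> arr C" "src C (ev C X) = dual C X \<star> X" "tgt C (ev C X) = \<I>"
  using ev_hom[OF assms] dual_obj[OF assms] by (simp_all add: homs_iff)

lemma coev_arr [simp]:
  assumes "X \<in> obj C"
  shows "coev C X \<in> arr C" "src C (coev C X) = \<I>" "tgt C (coev C X) = X \<star> dual C X"
  using coev_hom[OF assms] by (simp_all add: homs_iff)

lemma twist_arr [simp]:
  assumes "X \<in> obj C"
  shows "\<theta> X \<in> arr C" "src C (\<theta> X) = X" "tgt C (\<theta> X) = X"
  using twist_hom[OF assms] by (simp_all add: homs_iff)

lemma coevr_arr [simp]: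
  assumes "X \<in> obj C"
  shows "coevr C X \<in> arr C" "src C (coevr C X) = \<I>" "tgt C (coevr C X) = dual C X \<star> X"
  using assms by (simp_all add: coevr_def)

lemma braid_natural':
  "\<lbrakk>f \<in> arr C; g \<in> arr C; src C f = X; tgt C f = X'; src C g = Y; tgt C g = Y'\<rbrakk>
    \<Longrightarrow> \<beta> X' Y' \<cdot> (f \<boxtimes> g) = (g \<boxtimes> f) \<cdot> \<beta> X Y"
  using braid_natural[of f X X' g Y Y'] by (simp add: homs_iff)

text \<open>The hexagon with both right-hand objects equal to the unit makes the braiding
  idempotent, and an invertible idempotent is an identity.\<close>

lemma braid_unit_right [simp]: "X \<in> obj C \<Longrightarrow> \<beta> X \<I> = \<^bold>1 X"
proof -
  assume X: "X \<in> obj C"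
  have "\<beta> X \<I> \<cdot> \<beta> X \<I> = \<beta> X \<I> \<cdot> \<^bold>1 X" using X hexagon_right[of X \<I> \<I>] by simp
  then show ?thesis by (rule iso_cancel_left) (use X in simp_all)
qed

lemma braid_unit_left [simp]: "X \<in> obj C \<Longrightarrow> \<beta> \<I> X = \<^bold>1 X"
proof -
  assume X: "X \<in> obj C"
  have "\<beta> \<I> X \<cdot> \<beta> \<I> X = \<beta> \<I> X \<cdot> \<^bold>1 X" using X hexagon_left[of \<I> \<I> X] by simp
  then show ?thesis by (rule iso_cancel_left) (use X in simp_all)
qed

text \<open>Bending a strand of \<open>Y\<close> back turns the double braiding with \<open>Y*\<close> into one with \<open>Y* \<otimes> Y\<close>, which
  is trivial by naturality along \<open>ev\<close>.\<close>

lemma braid_dual_symmetric: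
  assumes X: "X \<in> obj C" and Y: "Y \<in> obj C" and sym: "\<beta> Y X \<cdot> \<beta> X Y = \<^bold>1 (X \<star> Y)"
  shows "\<beta> (dual C Y) X \<cdot> \<beta> X (dual C Y) = \<^bold>1 (X \<star> dual C Y)"
proof -
  let ?Y = "dual C Y"
  have Y': "?Y \<in> obj C" using Y by simp
  define D where "D = \<beta> ?Y X \<cdot> \<beta> X ?Y"
  have D_arr: "D \<in> arr C" "src C D = X \<star> ?Y" "tgt C D = X \<star> ?Y"
    using X Y' by (simp_all add: D_def)
  have "\<beta> (?Y \<star> Y) X \<cdot> \<beta> X (?Y \<star> Y)
     = (\<beta> ?Y X \<boxtimes> \<^bold>1 Y) \<cdot> (\<^bold>1 ?Y \<boxtimes> (\<beta> Y X \<cdot> \<beta> X Y)) \<cdot> (\<beta> X ?Y \<boxtimes> \<^bold>1 Y)"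
    using X Y Y' D_arr hexagon_left[of ?Y Y X] hexagon_right[of X ?Y Y] by (simp add: whisker_left)
  also have "\<dots> = D \<boxtimes> \<^bold>1 Y"
    using X Y Y' D_arr by (simp add: sym tens_id interchange' D_def)
  finally have D: "\<beta> (?Y \<star> Y) X \<cdot> \<beta> X (?Y \<star> Y) = D \<boxtimes> \<^bold>1 Y" .
  have "(\<^bold>1 X \<boxtimes> ev C Y) \<cdot> (\<beta> (?Y \<star> Y) X \<cdot> \<beta> X (?Y \<star> Y)) = ((\<^bold>1 X \<boxtimes> ev C Y) \<cdot> \<beta> (?Y \<star> Y) X) \<cdot> \<beta> X (?Y \<star> Y)"
    using X Y Y' D_arr by simp
  also have "(\<^bold>1 X \<boxtimes> ev C Y) \<cdot> \<beta> (?Y \<star> Y) X = ev C Y \<boxtimes> \<^bold>1 X"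
    using X Y Y' D_arr braid_natural'[of "ev C Y" "\<^bold>1 X" "?Y \<star> Y" \<I> X X] by simp
  also have "(ev C Y \<boxtimes> \<^bold>1 X) \<cdot> \<beta> X (?Y \<star> Y) = \<^bold>1 X \<boxtimes> ev C Y"
    using X Y Y' D_arr braid_natural'[of "\<^bold>1 X" "ev C Y" X X "?Y \<star> Y" \<I>] by simp
  finally have evD: "(\<^bold>1 X \<boxtimes> ev C Y) \<cdot> (D \<boxtimes> \<^bold>1 Y) = \<^bold>1 X \<boxtimes> ev C Y"
    using D by simp
  have zz: "\<^bold>1 X \<boxtimes> ((ev C Y \<boxtimes> \<^bold>1 ?Y) \<cdot> (\<^bold>1 ?Y \<boxtimes> coev C Y)) = \<^bold>1 (X \<star> ?Y)"
    using X Y Y' D_arr zigzag_dual[OF Y] by (simp add: tens_id)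
  \<comment> \<open>Insert the zigzag of the dual behind \<open>D\<close>. By interchange
    \<open>D\<close> moves in front of the coevaluation, to the place where \<open>evD\<close>
    deletes it, and the same zigzag is left over.\<close>
  have "D = (\<^bold>1 X \<boxtimes> ((ev C Y \<boxtimes> \<^bold>1 ?Y) \<cdot> (\<^bold>1 ?Y \<boxtimes> coev C Y))) \<cdot> D"
    using X Y' D_arr zz by simp
  also have "\<dots> = (\<^bold>1 X \<boxtimes> ev C Y \<boxtimes> \<^bold>1 ?Y) \<cdot> ((\<^bold>1 X \<boxtimes> \<^bold>1 ?Y) \<boxtimes> coev C Y) \<cdot> (D \<boxtimes> \<^bold>1 \<I>)"
    using X Y Y' D_arr by (simp add: whisker_left)
  also have "((\<^bold>1 X \<boxtimes> \<^bold>1 ?Y) \<boxtimes> coev C Y) \<cdot> (D \<boxtimes> \<^bold>1 \<I>) = (D \<boxtimes> \<^bold>1 (Y \<star> ?Y)) \<cdot> (\<^bold>1 (X \<star> ?Y) \<boxtimes> coev C Y)"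
    using X Y Y' D_arr by (simp only: tens_id) (subst (1 2) interchange'; simp)
  also have "(\<^bold>1 X \<boxtimes> ev C Y \<boxtimes> \<^bold>1 ?Y) \<cdot> \<dots>
     = (((\<^bold>1 X \<boxtimes> ev C Y) \<cdot> (D \<boxtimes> \<^bold>1 Y)) \<boxtimes> \<^bold>1 ?Y) \<cdot> (\<^bold>1 (X \<star> ?Y) \<boxtimes> coev C Y)"
    using X Y Y' D_arr by (simp add: whisker_right tens_id[symmetric])
  also have "\<dots> = \<^bold>1 X \<boxtimes> ((ev C Y \<boxtimes> \<^bold>1 ?Y) \<cdot> (\<^bold>1 ?Y \<boxtimes> coev C Y))"
    using X Y Y' D_arr by (simp only: evD) (simp add: whisker_left tens_id[symmetric])
  also have "\<dots> = \<^bold>1 (X \<star> ?Y)" using zz .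
  finally show ?thesis by (simp only: D_def)
qed

end

section \<open>Scalars of endomorphisms of invertible objects\<close>

context strict_ribbon_fusion_category
begin

text \<open>Tensoring with an inverse \<open>Y\<close> and conjugating with \<open>v\<close> turns
  \<open>f\<close> into an endomorphism of the unit, a scalar by \<open>end_unit\<close>.
  Faithfulness of the tensor product brings the scalar back to \<open>X\<close>.\<close>

lemma end_invertible:
  assumes X: "invertible C X" and f: "f \<in> arr C" "src C f = X" "tgt C f = X"
  shows "\<exists>c. f = c \<triangleright> \<^bold>1 X"
proof -
  obtain Y v where v: "X \<in> obj C" "Y \<in> obj C" "invertible C Y"
      "is_iso C v" "v \<in> arr C" "src C v = Y \<star> X" "tgt C v = \<I>"
    using X by (rule invertible_obtain)
  have "v \<cdot> (\<^bold>1 Y \<boxtimes> f) \<cdot> minv C v \<in> homs C \<I> \<I>" using v f by (simp add: homs_iff)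
  then obtain c where c: "v \<cdot> (\<^bold>1 Y \<boxtimes> f) \<cdot> minv C v = c \<triangleright> \<^bold>1 \<I>" using end_unit by blast
  have "(v \<cdot> (\<^bold>1 Y \<boxtimes> f) \<cdot> minv C v) \<cdot> v = v \<cdot> (\<^bold>1 Y \<boxtimes> f)" using v f by simp
  moreover have "(c \<triangleright> \<^bold>1 \<I>) \<cdot> v = v \<cdot> (c \<triangleright> (\<^bold>1 Y \<boxtimes> \<^bold>1 X))" using v by (simp add: tens_id)
  ultimately have "v \<cdot> (\<^bold>1 Y \<boxtimes> f) = v \<cdot> (\<^bold>1 Y \<boxtimes> (c \<triangleright> \<^bold>1 X))" using c v by simp
  then have "\<^bold>1 Y \<boxtimes> f = \<^bold>1 Y \<boxtimes> (c \<triangleright> \<^bold>1 X)" by (rule iso_cancel_left) (use v f in simp_all)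
  then have "f = c \<triangleright> \<^bold>1 X" using tens_left_faithful[OF v(3)] f v by simp
  then show ?thesis by blast
qed

text \<open>The uniqueness part of \<open>end_unit\<close>, transported along \<open>u\<close>. All
  identities between the scalars of the zesting data are read off from morphisms through this
  lemma.\<close>

lemma smul_id_cancel:
  assumes X: "invertible C X" and eq: "c \<triangleright> \<^bold>1 X = d \<triangleright> \<^bold>1 X"
  shows "c = d"
proof -
  obtain Y u where u: "X \<in> obj C" "Y \<in> obj C" "is_iso C u" "u \<in> arr C" "src C u = X \<star> Y" "tgt C u = \<I>"
    using X by (rule invertible_obtain)
  have "e \<triangleright> \<^bold>1 \<I> = u \<cdot> ((e \<triangleright> \<^bold>1 X) \<boxtimes> \<^bold>1 Y) \<cdot> minv C u" for e
    using u by (simp add: tens_id)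
  then have "c \<triangleright> \<^bold>1 \<I> = d \<triangleright> \<^bold>1 \<I>" using eq by metis
  then show ?thesis using end_unit[of "c \<triangleright> \<^bold>1 \<I>"] by (auto simp: homs_iff)
qed

lemma scalar_eq: "\<lbrakk>invertible C X; f = c \<triangleright> \<^bold>1 X\<rbrakk> \<Longrightarrow> scalar C f = c"
  unfolding scalar_def by (rule the_equality) (auto simp: invertible_obj dest: smul_id_cancel)

lemma scalar_smul_id:
  "\<lbrakk>invertible C X; f \<in> arr C; src C f = X; tgt C f = X\<rbrakk> \<Longrightarrow> f = scalar C f \<triangleright> \<^bold>1 X"
  using end_invertible scalar_eq by metis

lemma invertible_id_nonzero: "invertible C X \<Longrightarrow> \<^bold>1 X \<noteq> \<^bold>0 X X"
  using smul_id_cancel[of X 1 0] smul_0[of "\<^bold>1 X" X X] invertible_obj[of X] by auto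

lemma iso_scalar_nonzero:
  assumes "invertible C X" "is_iso C f" "f = c \<triangleright> \<^bold>1 X"
  shows "c \<noteq> 0"
proof
  assume "c = 0"
  then have "f = \<^bold>0 X X" using assms(3) smul_0[of "\<^bold>1 X" X X] invertible_obj[OF assms(1)] by simp
  then have "\<^bold>1 X = \<^bold>0 X X"
    using minv_arr(4)[OF assms(2)] comp_zero[of "minv C f" X X] minv_arr(1-3)[OF assms(2)]
      invertible_obj[OF assms(1)] by simp
  then show False using invertible_id_nonzero[OF assms(1)] by simp
qed

end

subsection \<open>Schur's lemma\<close>

context linear_category
begin

lemma add_comm':
  "\<lbrakk>f \<in> arr C; g \<in> arr C; src C f = src C g; tgt C f = tgt C g\<rbrakk> \<Longrightarrow> f \<boxplus> g = g \<boxplus> f"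
  using add_comm[of f "src C g" "tgt C g"] by (simp add: homs_iff)

lemma add_assoc':
  "\<lbrakk>f \<in> arr C; g \<in> arr C; h \<in> arr C; src C f = src C g; tgt C f = tgt C g; src C g = src C h; tgt C g = tgt C h\<rbrakk>
    \<Longrightarrow> (f \<boxplus> g) \<boxplus> h = f \<boxplus> (g \<boxplus> h)"
  using add_assoc[of f "src C h" "tgt C h"] by (simp add: homs_iff)

lemma add_four:
  assumes "f \<in> homs C X Y" "g \<in> homs C X Y" "h \<in> homs C X Y" "k \<in> homs C X Y"
  shows "(f \<boxplus> g) \<boxplus> (h \<boxplus> k) = (f \<boxplus> h) \<boxplus> (g \<boxplus> k)"
proof -
  have "(f \<boxplus> g) \<boxplus> (h \<boxplus> k) = f \<boxplus> ((g \<boxplus> h) \<boxplus> k)"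
    using assms by (simp add: homs_iff add_assoc')
  also have "g \<boxplus> h = h \<boxplus> g" using assms by (auto simp: homs_iff intro: add_comm')
  also have "f \<boxplus> ((h \<boxplus> g) \<boxplus> k) = (f \<boxplus> h) \<boxplus> (g \<boxplus> k)"
    using assms by (simp add: homs_iff add_assoc')
  finally show ?thesis .
qed

lemma add_zero' [simp]:
  assumes "f \<in> arr C" "src C f = X" "tgt C f = Y"
  shows "\<^bold>0 X Y \<boxplus> f = f" "f \<boxplus> \<^bold>0 X Y = f"
  using add_zero[of f X Y] add_comm'[of f "\<^bold>0 X Y"] assms by (auto simp: homs_iff)

lemma smul_add':
  "\<lbrakk>f \<in> arr C; g \<in> arr C; src C f = src C g; tgt C f = tgt C g\<rbrakk> \<Longrightarrow> c \<triangleright> (f \<boxplus> g) = c \<triangleright> f \<boxplus> c \<triangleright> g"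
  using smul_add[of f "src C g" "tgt C g" g c] by (simp add: homs_iff)

lemma add_smul': "f \<in> arr C \<Longrightarrow> (c + d) \<triangleright> f = c \<triangleright> f \<boxplus> d \<triangleright> f"
  using add_smul[of f "src C f" "tgt C f"] by (simp add: homs_iff)

lemma comp_add:
  assumes "g \<in> arr C" "h \<in> arr C" "src C g = src C h" "tgt C g = tgt C h"
  shows "\<lbrakk>f \<in> arr C; tgt C f = src C h\<rbrakk> \<Longrightarrow> (g \<boxplus> h) \<cdot> f = g \<cdot> f \<boxplus> h \<cdot> f"
    "\<lbrakk>f \<in> arr C; src C f = tgt C h\<rbrakk> \<Longrightarrow> f \<cdot> (g \<boxplus> h) = f \<cdot> g \<boxplus> f \<cdot> h"
  using comp_add_left[of f "src C f" "tgt C f" g "tgt C g" h]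
    comp_add_right[of g "src C g" "tgt C g" h f "tgt C f"] assms by (simp_all add: homs_iff)

lemma diff_eq_zero:
  assumes "f \<in> homs C X Y" "g \<in> homs C X Y" "f \<boxplus> (-1) \<triangleright> g = \<^bold>0 X Y"
  shows "f = g"
proof -
  have "g = (f \<boxplus> (-1) \<triangleright> g) \<boxplus> g" using assms by (simp add: homs_iff)
  also have "\<dots> = f \<boxplus> (g \<boxplus> (-1) \<triangleright> g)"
    using assms(1,2) add_comm'[of g "(-1) \<triangleright> g"] by (simp add: homs_iff add_assoc')
  also have "\<dots> = f" using assms add_neg[OF assms(2)] by (simp add: homs_iff)
  finally show ?thesis by simp
qed

lemma kernel_mono:
  assumes "is_kernel C f k"
  shows "is_mono C k"
  unfolding is_mono_def
proof (intro conjI ballI impI)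
  show "k \<in> arr C" using assms by (simp add: is_kernel_def)
next
  fix W g h
  assume W: "W \<in> obj C" and g: "g \<in> homs C W (src C k)" and h: "h \<in> homs C W (src C k)"
    and eq: "k \<cdot> g = k \<cdot> h"
  have k: "k \<in> arr C" "f \<in> arr C" "tgt C k = src C f" "f \<cdot> k = \<^bold>0 (src C k) (tgt C f)"
    using assms by (simp_all add: is_kernel_def)
  have "k \<cdot> g \<in> homs C W (src C f)" using k g by (simp add: homs_iff)
  moreover have "f \<cdot> (k \<cdot> g) = \<^bold>0 W (tgt C f)"
    using k g zero_comp[of g "src C k" "tgt C f"] comp_assoc'[of g k f] by (simp add: homs_iff)
  ultimately have "\<exists>!u. u \<in> homs C W (src C k) \<and> k \<cdot> u = k \<cdot> g"
    using assms W unfolding is_kernel_def by blast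
  then show "g = h" using g h eq by auto
qed

text \<open>If \<open>f\<close> identifies \<open>g\<close> and \<open>h\<close>, their difference
  factors through the kernel, hence through a zero object.\<close>

lemma zero_source_kernel_mono:
  assumes k: "is_kernel C f k" and z: "is_zero C (src C k)"
  shows "is_mono C f"
  unfolding is_mono_def
proof (intro conjI ballI impI)
  show f: "f \<in> arr C" using k by (simp add: is_kernel_def)
  fix W g h
  assume W: "W \<in> obj C" and g: "g \<in> homs C W (src C f)" and h: "h \<in> homs C W (src C f)"
    and eq: "f \<cdot> g = f \<cdot> h"
  let ?d = "g \<boxplus> (-1) \<triangleright> h"
  have k': "k \<in> arr C" "tgt C k = src C f" using k by (simp_all add: is_kernel_def)
  have d: "?d \<in> homs C W (src C f)" using g h by (simp add: homs_iff)
  have "f \<cdot> ?d = f \<cdot> h \<boxplus> (-1) \<triangleright> (f \<cdot> h)"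
    using f g h eq by (simp add: homs_iff comp_add)
  also have "\<dots> = \<^bold>0 W (tgt C f)" using f h by (intro add_neg) (simp add: homs_iff)
  finally have "\<exists>u. u \<in> homs C W (src C k) \<and> k \<cdot> u = ?d"
    using k W d unfolding is_kernel_def by blast
  then obtain u where u: "u \<in> homs C W (src C k)" "k \<cdot> u = ?d" by blast
  have "u = \<^bold>1 (src C k) \<cdot> u" using u(1) by (simp add: homs_iff)
  also have "\<dots> = \<^bold>0 W (src C k)"
    using z u(1) zero_comp[of u "src C k" "src C k"] by (simp add: is_zero_def homs_iff)
  finally have "?d = \<^bold>0 W (src C f)" using u k' W comp_zero[of k "src C k" W] by simp
  then show "g = h" using g h by (rule diff_eq_zero[rotated 2])
qed

text \<open>The span of a list, in recursive form so that generators can be eliminated one at a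
  time. Finite dimension is given only as a spanning list, so no independence is asked for.\<close>

fun in_span :: "'o \<Rightarrow> 'm list \<Rightarrow> 'm \<Rightarrow> bool" where
  "in_span X [] f \<longleftrightarrow> f = \<^bold>0 X X"
| "in_span X (b # bs) f \<longleftrightarrow> (\<exists>c h. in_span X bs h \<and> f = c \<triangleright> b \<boxplus> h)"

lemma in_span_hom: "\<lbrakk>X \<in> obj C; set bs \<subseteq> homs C X X; in_span X bs f\<rbrakk> \<Longrightarrow> f \<in> homs C X X"
  by (induction bs arbitrary: f) (auto simp: homs_iff)

lemma in_span_add:
  "\<lbrakk>X \<in> obj C; set bs \<subseteq> homs C X X; in_span X bs f; in_span X bs g\<rbrakk> \<Longrightarrow> in_span X bs (f \<boxplus> g)"
proof (induction bs arbitrary: f g)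
  case (Cons b bs)
  then obtain c h d k where *: "in_span X bs h" "f = c \<triangleright> b \<boxplus> h" "in_span X bs k" "g = d \<triangleright> b \<boxplus> k"
    by auto
  have hk: "h \<in> homs C X X" "k \<in> homs C X X" "b \<in> homs C X X"
    using Cons.prems * in_span_hom by auto
  have "f \<boxplus> g = (c \<triangleright> b \<boxplus> d \<triangleright> b) \<boxplus> (h \<boxplus> k)"
    unfolding * using hk by (intro add_four) (auto simp: homs_iff)
  also have "\<dots> = (c + d) \<triangleright> b \<boxplus> (h \<boxplus> k)" using hk by (simp add: add_smul' homs_iff)
  finally show ?case using Cons * by auto
qed simp

lemma in_span_smul:
  "\<lbrakk>X \<in> obj C; set bs \<subseteq> homs C X X; in_span X bs f\<rbrakk> \<Longrightarrow> in_span X bs (c \<triangleright> f)"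
proof (induction bs arbitrary: f)
  case (Cons b bs)
  then obtain d h where *: "in_span X bs h" "f = d \<triangleright> b \<boxplus> h" by auto
  have "h \<in> homs C X X" "b \<in> homs C X X" using Cons.prems * in_span_hom by auto
  then have "c \<triangleright> f = (c * d) \<triangleright> b \<boxplus> c \<triangleright> h" using * by (simp add: smul_add' homs_iff)
  then show ?case using Cons * by auto
qed (simp add: smul_zero)

lemma in_span_msum:
  "length cs = length bs \<Longrightarrow> in_span X bs (msum C X X (map2 (smul C) cs bs))"
  by (induction cs bs rule: list_induct2) (auto simp: msum_def)

text \<open>Evaluation of the polynomial \<open>p\<close> at the endomorphism \<open>g\<close>, by
  Horner's scheme.\<close>

definition poly_map :: "'m \<Rightarrow> 'k poly \<Rightarrow> 'm" where
  "poly_map g p = fold_coeffs (\<lambda>a m. a \<triangleright> \<^bold>1 (src C g) \<boxplus> g \<cdot> m) p (\<^bold>0 (src C g) (src C g))"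

context
  fixes g X
  assumes g: "g \<in> arr C" "src C g = X" "tgt C g = X"
begin

lemma endo_obj: "X \<in> obj C" using g by auto

lemma poly_map_0: "poly_map g 0 = \<^bold>0 X X"
  using g by (simp add: poly_map_def)

lemma poly_map_pCons: "poly_map g (pCons a p) = a \<triangleright> \<^bold>1 X \<boxplus> g \<cdot> poly_map g p"
proof (cases "a = 0 \<and> p = 0")
  case True
  then show ?thesis using g endo_obj smul_0[of "\<^bold>1 X" X X] comp_zero[of g X X] by (simp add: poly_map_0)
next
  case False
  then show ?thesis using g by (auto simp: poly_map_def)
qed

lemma poly_map_arr [simp]:
  "poly_map g p \<in> arr C" "src C (poly_map g p) = X" "tgt C (poly_map g p) = X"
  using g endo_obj by (induction p) (simp_all add: poly_map_0 poly_map_pCons)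

lemma poly_map_add: "poly_map g (p + q) = poly_map g p \<boxplus> poly_map g q"
proof (induction p q rule: poly_induct2)
  case (pCons a p b q)
  have "poly_map g (pCons a p + pCons b q)
      = (a \<triangleright> \<^bold>1 X \<boxplus> b \<triangleright> \<^bold>1 X) \<boxplus> (g \<cdot> poly_map g p \<boxplus> g \<cdot> poly_map g q)"
    using g endo_obj by (simp add: poly_map_pCons pCons add_smul' comp_add)
  also have "\<dots> = poly_map g (pCons a p) \<boxplus> poly_map g (pCons b q)"
    unfolding poly_map_pCons using g endo_obj by (intro add_four) (simp_all add: homs_iff)
  finally show ?case .
qed (use g endo_obj in \<open>simp add: poly_map_0\<close>)

lemma poly_map_smult: "poly_map g (smult c p) = c \<triangleright> poly_map g p"
  using g endo_obj by (induction p) (simp_all add: poly_map_0 poly_map_pCons smul_zero smul_add')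

lemma poly_map_root:
  "poly_map g ([:- r, 1:] * q) = (g \<boxplus> (- r) \<triangleright> \<^bold>1 X) \<cdot> poly_map g q"
proof -
  have "[:- r, 1:] * q = pCons 0 q + smult (- r) q" by simp
  also have "poly_map g \<dots> = g \<cdot> poly_map g q \<boxplus> (- r) \<triangleright> poly_map g q"
    unfolding poly_map_add poly_map_smult poly_map_pCons
    using g endo_obj by (simp add: smul_0[of "\<^bold>1 X" X X])
  finally show ?thesis using g endo_obj by (simp add: comp_add)
qed

text \<open>Eliminates the spanning list one element at a time; the order of vanishing at \<open>0\<close> keeps the
  combinations of two polynomials nonzero.\<close>

lemma poly_map_annihilator:
  assumes "set bs \<subseteq> homs C X X"
    and "\<And>k. \<exists>p. p \<noteq> 0 \<and> (\<forall>j<k. coeff p j = 0) \<and> in_span X bs (poly_map g p)"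
  shows "\<exists>p. p \<noteq> 0 \<and> poly_map g p = \<^bold>0 X X"
  using assms
proof (induction bs)
  case Nil
  then show ?case by auto
next
  case (Cons b bs)
  have bs: "set bs \<subseteq> homs C X X" "b \<in> homs C X X" using Cons.prems by auto
  show ?case
  proof (rule Cons.IH[OF bs(1)])
    fix k
    obtain p c h where p: "p \<noteq> 0" "\<forall>j<k. coeff p j = 0" "in_span X bs h" "poly_map g p = c \<triangleright> b \<boxplus> h"
      using Cons.prems(2)[of k] by auto
    \<comment> \<open>\<open>q\<close> vanishes to an order above \<open>degree p\<close>, so no
      coefficient of \<open>p\<close> can interfere with the leading coefficient of
      \<open>q\<close>.\<close>
    obtain q d h' where q: "q \<noteq> 0" "\<forall>j<max k (Suc (degree p)). coeff q j = 0" "in_span X bs h'"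
        "poly_map g q = d \<triangleright> b \<boxplus> h'"
      using Cons.prems(2)[of "max k (Suc (degree p))"] by auto
    have h: "h \<in> homs C X X" "h' \<in> homs C X X" using p q bs endo_obj in_span_hom by auto
    show "\<exists>p. p \<noteq> 0 \<and> (\<forall>j<k. coeff p j = 0) \<and> in_span X bs (poly_map g p)"
    proof (cases "c = 0")
      case True
      then have "poly_map g p = h"
        using p(4) h bs smul_0[of b X X] by (simp add: homs_iff)
      then show ?thesis using p by auto
    next
      case False
      \<comment> \<open>The combination in which the two multiples of \<open>b\<close> cancel. It is
        nonzero because its coefficient at \<open>degree q\<close> is \<open>- c\<close> times the
        leading coefficient of \<open>q\<close>.\<close>
      let ?r = "smult d p + smult (- c) q"
      have "degree p < degree q"
        using q(1,2) leading_coeff_neq_0 by (metis Suc_leI less_max_iff_disj linorder_not_less lessI le_imp_less_Suc)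
      then have "coeff ?r (degree q) \<noteq> 0" using False q(1) by (simp add: coeff_eq_0)
      then have "?r \<noteq> 0" by (metis coeff_0)
      moreover have "\<forall>j<k. coeff ?r j = 0" using p(2) q(2) by simp
      moreover have "poly_map g ?r = d \<triangleright> h \<boxplus> (- c) \<triangleright> h'"
      proof -
        have "poly_map g ?r = ((d * c) \<triangleright> b \<boxplus> d \<triangleright> h) \<boxplus> ((- c * d) \<triangleright> b \<boxplus> (- c) \<triangleright> h')"
          unfolding poly_map_add poly_map_smult p(4) q(4) using h bs by (simp add: smul_add' homs_iff)
        also have "\<dots> = ((d * c) \<triangleright> b \<boxplus> (- c * d) \<triangleright> b) \<boxplus> (d \<triangleright> h \<boxplus> (- c) \<triangleright> h')"
          using h bs by (intro add_four) (auto simp: homs_iff)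
        also have "(d * c) \<triangleright> b \<boxplus> (- c * d) \<triangleright> b = \<^bold>0 X X"
          using bs add_smul'[of b "d * c" "- c * d"] smul_0[of b X X] by (simp add: homs_iff)
        finally show ?thesis using h by (simp add: homs_iff)
      qed
      moreover have "in_span X bs (d \<triangleright> h \<boxplus> (- c) \<triangleright> h')"
        using p q bs endo_obj by (intro in_span_add in_span_smul) auto
      ultimately show ?thesis by metis
    qed
  qed
qed

end

end

context strict_ribbon_fusion_category
begin

lemma simple_obj: "simple C X \<Longrightarrow> X \<in> obj C"
  by (simp add: simple_def)

lemma simple_id_nonzero: "simple C X \<Longrightarrow> \<^bold>1 X \<noteq> \<^bold>0 X X"
  by (auto simp: simple_def is_zero_def)

text \<open>Simplicity is used twice. The kernel of \<open>f\<close> is a subobject of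
  \<open>X\<close>, so it is an isomorphism, which would force \<open>f\<close> to vanish, or has
  zero source. In the second case \<open>f\<close> is itself a monomorphism into \<open>X\<close>
  with nonzero source, hence invertible.\<close>

lemma simple_endo:
  assumes X: "simple C X" and f: "f \<in> arr C" "src C f = X" "tgt C f = X" "f \<noteq> \<^bold>0 X X"
  shows "is_iso C f"
proof -
  obtain k where k: "is_kernel C f k" using kernels[OF f(1)] by blast
  have k': "k \<in> arr C" "tgt C k = X" "f \<cdot> k = \<^bold>0 (src C k) X"
    using k f by (simp_all add: is_kernel_def)
  have "\<not> is_iso C k"
  proof
    assume i: "is_iso C k"
    have "f = (f \<cdot> k) \<cdot> minv C k" using f k'(1,2) i by simp
    also have "\<dots> = \<^bold>0 X X"
      unfolding k'(3) using k'(1,2) i simple_obj[OF X] by (simp add: zero_comp)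
    finally show False using f(4) by simp
  qed
  then have "is_zero C (src C k)" using X kernel_mono[OF k] k' by (auto simp: simple_def)
  then have "is_mono C f" by (rule zero_source_kernel_mono[OF k])
  then show ?thesis using X f by (auto simp: simple_def)
qed

text \<open>An eigenvalue argument: a nonzero annihilating polynomial of least degree has a root
  \<open>r\<close>, since the field is algebraically closed. If \<open>g\<close> minus
  \<open>r\<close> were nonzero it would be invertible by \<open>simple_endo\<close>, and cancelling
  it would leave an annihilating polynomial of smaller degree.\<close>

lemma schur:
  assumes X: "simple C X" and g: "g \<in> arr C" "src C g = X" "tgt C g = X"
  shows "\<exists>c. g = c \<triangleright> \<^bold>1 X"
proof -
  have X': "X \<in> obj C" using X by (rule simple_obj)
  obtain bs where bs: "set bs \<subseteq> homs C X X"
      "\<forall>f \<in> homs C X X. \<exists>cs. length cs = length bs \<and> f = msum C X X (map2 (smul C) cs bs)"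
    using finite_dim_homs[OF X' X'] by blast
  have span: "in_span X bs f" if "f \<in> homs C X X" for f
    using bs(2) that by (metis in_span_msum)
  \<comment> \<open>The monomial of degree \<open>k\<close> has the required order of vanishing, and
    every endomorphism lies in the span.\<close>
  have "\<exists>p. p \<noteq> 0 \<and> (\<forall>j<k. coeff p j = 0) \<and> in_span X bs (poly_map g p)" for k
    using span[of "poly_map g (monom 1 k)"] poly_map_arr[OF g]
    by (intro exI[of _ "monom 1 k"]) (simp add: homs_iff monom_eq_0_iff)
  then have "\<exists>p. p \<noteq> 0 \<and> poly_map g p = \<^bold>0 X X"
    using poly_map_annihilator[OF g bs(1)] by blast
  then obtain p where p: "p \<noteq> 0" "poly_map g p = \<^bold>0 X X"
      and min: "\<And>q. q \<noteq> 0 \<Longrightarrow> poly_map g q = \<^bold>0 X X \<Longrightarrow> degree p \<le> degree q"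
    using ex_has_least_nat[of "\<lambda>p. p \<noteq> 0 \<and> poly_map g p = \<^bold>0 X X" _ degree] by blast
  have "degree p > 0"
  proof (rule ccontr)
    assume "\<not> degree p > 0"
    then obtain a where a: "p = [:a:]" using degree_eq_zeroE by blast
    have "poly_map g p = a \<triangleright> \<^bold>1 X"
      unfolding a using g X' comp_zero[of g X X] by (simp add: poly_map_pCons[OF g] poly_map_0[OF g])
    then have "a \<triangleright> \<^bold>1 X = 0 \<triangleright> \<^bold>1 X" using p(2) X' smul_0[of "\<^bold>1 X" X X] by simp
    then have "a = 0" by (rule smul_right_cancel) (use X X' simple_id_nonzero in auto)
    then show False using a p(1) by simp
  qed
  then obtain r where "poly p r = 0" using alg_closed_imp_poly_has_root by blast
  then obtain q where q: "p = [:- r, 1:] * q" by (auto simp: poly_eq_0_iff_dvd)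
  have "q \<noteq> 0" using p q by auto
  have "degree p = Suc (degree q)" unfolding q using \<open>q \<noteq> 0\<close> by (subst degree_mult_eq) auto
  then have qne: "poly_map g q \<noteq> \<^bold>0 X X" using min[OF \<open>q \<noteq> 0\<close>] by auto
  let ?h = "g \<boxplus> (- r) \<triangleright> \<^bold>1 X"
  have h: "?h \<in> arr C" "src C ?h = X" "tgt C ?h = X" using g X' by simp_all
  have "?h = \<^bold>0 X X"
  proof (rule ccontr)
    assume "?h \<noteq> \<^bold>0 X X"
    then have i: "is_iso C ?h" using simple_endo[OF X h] by simp
    have "?h \<cdot> poly_map g q = ?h \<cdot> \<^bold>0 X X"
      using p(2) q poly_map_root[OF g] comp_zero[OF h(1,2) X'] h by simp
    then have "poly_map g q = \<^bold>0 X X" by (rule iso_cancel_left) (use i g X' h in simp_all)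
    then show False using qne by simp
  qed
  then have "g \<boxplus> (-1) \<triangleright> (r \<triangleright> \<^bold>1 X) = \<^bold>0 X X" using X' by simp
  then have "g = r \<triangleright> \<^bold>1 X" by (rule diff_eq_zero[rotated 2]) (use g X' in \<open>simp_all add: homs_iff\<close>)
  then show ?thesis by blast
qed

subsection \<open>The double braiding with an invertible object\<close>

text \<open>Based at \<open>X \<star> \<eta>\<close>, as in the definition of \<open>chi\<close>;
  naturality in \<open>X\<close> is then whiskering by \<eta> on the right.\<close>

definition monodromy where
  "monodromy \<eta> X = \<beta> \<eta> X \<cdot> \<beta> X \<eta>"

lemma monodromy_arr [simp]:
  assumes "X \<in> obj C" "\<eta> \<in> obj C"
  shows "monodromy \<eta> X \<in> arr C" "src C (monodromy \<eta> X) = X \<star> \<eta>" "tgt C (monodromy \<eta> X) = X \<star> \<eta>"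
    "is_iso C (monodromy \<eta> X)"
  using assms by (simp_all add: monodromy_def)

lemma monodromy_natural:
  assumes "f \<in> arr C" "src C f = X" "tgt C f = Y" "\<eta> \<in> obj C"
  shows "monodromy \<eta> Y \<cdot> (f \<boxtimes> \<^bold>1 \<eta>) = (f \<boxtimes> \<^bold>1 \<eta>) \<cdot> monodromy \<eta> X"
proof -
  have XY: "X \<in> obj C" "Y \<in> obj C" using assms by auto
  have "monodromy \<eta> Y \<cdot> (f \<boxtimes> \<^bold>1 \<eta>) = \<beta> \<eta> Y \<cdot> (\<^bold>1 \<eta> \<boxtimes> f) \<cdot> \<beta> X \<eta>"
    using assms XY braid_natural'[of f "\<^bold>1 \<eta>" X Y \<eta> \<eta>] by (simp add: monodromy_def)
  also have "\<dots> = (\<beta> \<eta> Y \<cdot> (\<^bold>1 \<eta> \<boxtimes> f)) \<cdot> \<beta> X \<eta>" using assms XY by simp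
  also have "\<dots> = (f \<boxtimes> \<^bold>1 \<eta>) \<cdot> monodromy \<eta> X"
    using assms XY by (subst braid_natural'[of "\<^bold>1 \<eta>" f \<eta> \<eta> X Y]) (simp_all add: monodromy_def)
  finally show ?thesis .
qed

text \<open>The hexagons nest the double braiding with \<open>X\<close> between the two braidings
  with \<open>Y\<close>. Being a scalar it can be pulled out, and the double braiding with
  \<open>Y\<close> remains.\<close>

lemma monodromy_tens:
  assumes "X \<in> obj C" "Y \<in> obj C" "\<eta> \<in> obj C"
    and "monodromy \<eta> X = c \<triangleright> \<^bold>1 (X \<star> \<eta>)" "monodromy \<eta> Y = d \<triangleright> \<^bold>1 (Y \<star> \<eta>)"
  shows "monodromy \<eta> (X \<star> Y) = (c * d) \<triangleright> \<^bold>1 (X \<star> Y \<star> \<eta>)"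
proof -
  have "monodromy \<eta> (X \<star> Y)
      = (\<^bold>1 X \<boxtimes> \<beta> \<eta> Y) \<cdot> (monodromy \<eta> X \<boxtimes> \<^bold>1 Y) \<cdot> (\<^bold>1 X \<boxtimes> \<beta> Y \<eta>)"
    using assms(1-3) by (simp add: monodromy_def hexagon_left hexagon_right whisker_right)
  also have "\<dots> = c \<triangleright> (\<^bold>1 X \<boxtimes> monodromy \<eta> Y)"
    using assms(1-4) by (simp add: tens_id) (simp add: monodromy_def whisker_left)
  finally show ?thesis using assms by (simp add: tens_id)
qed

context
  fixes \<eta>
  assumes \<eta>: "invertible C \<eta>"
begin

lemma eta_obj: "\<eta> \<in> obj C" using \<eta> by (rule invertible_obj)

lemma simple_tens_cancel:
  assumes X: "simple C X" and eq: "c \<triangleright> \<^bold>1 (X \<star> \<eta>) = d \<triangleright> \<^bold>1 (X \<star> \<eta>)"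
  shows "c = d"
proof -
  have X': "X \<in> obj C" using X by (rule simple_obj)
  have "(c \<triangleright> \<^bold>1 X) \<boxtimes> \<^bold>1 \<eta> = (d \<triangleright> \<^bold>1 X) \<boxtimes> \<^bold>1 \<eta>" using eq X' eta_obj by (simp add: tens_id)
  then have "c \<triangleright> \<^bold>1 X = d \<triangleright> \<^bold>1 X" using tens_right_faithful[OF \<eta>] X' by simp
  then show ?thesis by (rule smul_right_cancel) (use X X' simple_id_nonzero in auto)
qed

text \<open>\<open>schur\<close> speaks about \<open>X\<close>, but the double braiding lives on
  \<open>X \<star> \<eta>\<close>. Tensoring with an inverse of \<eta> and conjugating turns it into
  an endomorphism of \<open>X\<close>.\<close>

lemma monodromy_simple:
  assumes X: "simple C X"
  shows "\<exists>c. monodromy \<eta> X = c \<triangleright> \<^bold>1 (X \<star> \<eta>)"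
proof -
  have X': "X \<in> obj C" using X by (rule simple_obj)
  obtain Y u where u: "\<eta> \<in> obj C" "Y \<in> obj C" "invertible C Y" "is_iso C u" "u \<in> arr C"
      "src C u = \<eta> \<star> Y" "tgt C u = \<I>"
    using \<eta> by (rule invertible_obtain)
  let ?w = "\<^bold>1 X \<boxtimes> u" and ?m = "monodromy \<eta> X \<boxtimes> \<^bold>1 Y"
  have w: "is_iso C ?w" "?w \<in> arr C" "src C ?w = X \<star> \<eta> \<star> Y" "tgt C ?w = X" using u X' by simp_all
  have m: "?m \<in> arr C" "src C ?m = X \<star> \<eta> \<star> Y" "tgt C ?m = X \<star> \<eta> \<star> Y" using u X' by simp_all
  obtain c where c: "?w \<cdot> ?m \<cdot> minv C ?w = c \<triangleright> \<^bold>1 X"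
    using schur[OF X, of "?w \<cdot> ?m \<cdot> minv C ?w"] w m
    by (auto simp del: tens_arr is_iso_tens tens_assoc)
  have "?w \<cdot> ?m = (?w \<cdot> ?m \<cdot> minv C ?w) \<cdot> ?w"
    using w m by (simp del: tens_arr is_iso_tens tens_assoc)
  also have "\<dots> = ?w \<cdot> (c \<triangleright> \<^bold>1 (X \<star> \<eta> \<star> Y))"
    unfolding c using w X' u by (simp del: tens_arr is_iso_tens tens_assoc)
  finally have "?m = c \<triangleright> \<^bold>1 (X \<star> \<eta> \<star> Y)" by (rule iso_cancel_left) (use w m X' u in simp_all)
  also have "\<dots> = (c \<triangleright> \<^bold>1 (X \<star> \<eta>)) \<boxtimes> \<^bold>1 Y" using X' u by (simp add: tens_id)
  finally have "monodromy \<eta> X = c \<triangleright> \<^bold>1 (X \<star> \<eta>)"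
    using tens_right_faithful[OF u(3)] X' u by simp
  then show ?thesis by blast
qed

definition mon_val where
  "mon_val X = (SOME c. monodromy \<eta> X = c \<triangleright> \<^bold>1 (X \<star> \<eta>))"

lemma mon_val: "simple C X \<Longrightarrow> monodromy \<eta> X = mon_val X \<triangleright> \<^bold>1 (X \<star> \<eta>)"
  using monodromy_simple unfolding mon_val_def by (metis (mono_tags) someI_ex)

lemma mon_val_nonzero:
  assumes X: "simple C X"
  shows "mon_val X \<noteq> 0"
proof
  have X': "X \<in> obj C" using X by (rule simple_obj)
  assume "mon_val X = 0"
  then have "minv C (monodromy \<eta> X) \<cdot> monodromy \<eta> X = 0 \<triangleright> (minv C (monodromy \<eta> X) \<cdot> \<^bold>1 (X \<star> \<eta>))"
    using mon_val[OF X] X' eta_obj comp_smul(2)[of "\<^bold>1 (X \<star> \<eta>)" "minv C (monodromy \<eta> X)" 0]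
    by (metis monodromy_arr comp_arr id_arr minv_arr tens_obj)
  then have "1 \<triangleright> \<^bold>1 (X \<star> \<eta>) = 0 \<triangleright> \<^bold>1 (X \<star> \<eta>)"
    using X' eta_obj smul_0[of _ "X \<star> \<eta>" "X \<star> \<eta>"] by simp
  then show False using simple_tens_cancel[OF X] by fastforce
qed

text \<open>Naturality along \<open>f\<close> makes both scalars act on \<open>f\<close> in the same
  way after tensoring with \<eta>. Cancelling \<eta> and then the nonzero \<open>f\<close> compares
  them.\<close>

lemma mon_val_natural:
  assumes "simple C X" "f \<in> arr C" "src C f = X" "tgt C f = Y" "f \<noteq> \<^bold>0 X Y"
    and d: "monodromy \<eta> Y = d \<triangleright> \<^bold>1 (Y \<star> \<eta>)"
  shows "mon_val X = d"
proof -
  have XY: "X \<in> obj C" "Y \<in> obj C" using assms by auto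
  have "(d \<triangleright> f) \<boxtimes> \<^bold>1 \<eta> = (mon_val X \<triangleright> f) \<boxtimes> \<^bold>1 \<eta>"
    using monodromy_natural[OF assms(2-4) eta_obj] d mon_val[OF assms(1)] assms XY eta_obj by simp
  then have "d \<triangleright> f = mon_val X \<triangleright> f" using tens_right_faithful[OF \<eta>] assms by simp
  then have "d = mon_val X" by (rule smul_right_cancel) (use assms in auto)
  then show ?thesis by simp
qed

lemma mon_val_isomorphic:
  assumes "simple C X" "simple C Y" "isomorphic C X Y"
  shows "mon_val X = mon_val Y"
proof -
  obtain f where f: "f \<in> arr C" "src C f = X" "tgt C f = Y" "is_iso C f"
    using assms by (auto simp: isomorphic_def homs_iff)
  have "f \<noteq> \<^bold>0 X Y"
  proof
    assume "f = \<^bold>0 X Y"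
    then have "\<^bold>1 X = \<^bold>0 X X"
      using f minv_arr[OF f(4)] comp_zero[of "minv C f" Y X] simple_obj[OF assms(1)] by simp
    then show False using simple_id_nonzero[OF assms(1)] by simp
  qed
  then show ?thesis using mon_val_natural[OF assms(1) f(1-3)] mon_val[OF assms(2)] by simp
qed

text \<open>A monomorphism out of a simple object is nonzero, so \<open>mon_val_natural\<close>
  applies with the product scalar of \<open>monodromy_tens\<close>. This is the multiplicativity
  required of a grading.\<close>

lemma mon_val_tens:
  assumes "simple C X" "simple C Y" "simple C Z" "f \<in> homs C Z (X \<star> Y)" "is_mono C f"
  shows "mon_val Z = mon_val X * mon_val Y"
proof -
  have XY: "X \<in> obj C" "Y \<in> obj C" "Z \<in> obj C" using assms simple_obj by auto
  have "f \<noteq> \<^bold>0 Z (X \<star> Y)"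
  proof
    assume "f = \<^bold>0 Z (X \<star> Y)"
    then have "f \<cdot> \<^bold>1 Z = f \<cdot> \<^bold>0 Z Z" using XY comp_zero[of f Z Z] by simp
    moreover have "src C f = Z" "\<And>g h. \<lbrakk>g \<in> homs C Z Z; h \<in> homs C Z Z; f \<cdot> g = f \<cdot> h\<rbrakk> \<Longrightarrow> g = h"
      using assms(4,5) XY unfolding is_mono_def by (auto simp: homs_iff)
    moreover have "\<^bold>1 Z \<in> homs C Z Z" "\<^bold>0 Z Z \<in> homs C Z Z" using XY by (simp_all add: homs_iff)
    ultimately have "\<^bold>1 Z = \<^bold>0 Z Z" by blast
    then show False using simple_id_nonzero[OF assms(3)] by simp
  qed
  then show ?thesis
    using mon_val_natural[OF assms(3), of f "X \<star> Y"] assms(4) XY eta_obj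
      monodromy_tens[OF XY(1,2) eta_obj mon_val[OF assms(1)] mon_val[OF assms(2)]]
    by (simp add: homs_iff)
qed

text \<open>The values of \<open>mon_val\<close> lie in a countable subgroup of \<open>k\<close>, which is carried over to \<open>nat\<close>
  to match the universal property of the grading.\<close>

lemma mon_val_grading:
  obtains G :: "nat monoid" and e :: "_ \<Rightarrow> nat"
  where "group G" "grading C G (\<lambda>X. e (mon_val X))" "e 1 = \<one>\<^bsub>G\<^esub>"
    "\<And>X. simple C X \<Longrightarrow> e (mon_val X) = e 1 \<Longrightarrow> mon_val X = 1"
proof -
  obtain S where S: "finite S" "\<forall>X\<in>S. simple C X" "\<And>X. simple C X \<Longrightarrow> \<exists>Y\<in>S. isomorphic C X Y"
    using finitely_many_simples by blast
  \<comment> \<open>One representative per isomorphism class keeps \<open>V\<close> finite. Since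
    \<open>V\<close> is closed under inverses, the products of lists over \<open>V\<close> form a
    group, and a countable one.\<close>
  define V where "V = mon_val ` S \<union> (\<lambda>X. inverse (mon_val X)) ` S"
  define H where "H = prod_list ` lists V"
  have inV: "mon_val X \<in> V" if "simple C X" for X
    using S(2) S(3)[OF that] mon_val_isomorphic[OF that] unfolding V_def by blast
  have V0: "0 \<notin> V" using S(2) mon_val_nonzero unfolding V_def by force
  have invV: "inverse v \<in> V" if "v \<in> V" for v using that unfolding V_def by auto
  have H: "countable H" unfolding H_def V_def using S(1) by (intro countable_image countable_lists) (simp add: countable_finite)
  have H0: "x \<noteq> 0" if "x \<in> H" for x
    using that V0 unfolding H_def by (auto simp: prod_list_zero_iff)
  have H1: "1 \<in> H" unfolding H_def by (intro image_eqI[of _ _ "[]"]) auto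
  have Hm: "x * y \<in> H" if xy: "x \<in> H" "y \<in> H" for x y
  proof -
    obtain xs ys where "x = prod_list xs" "xs \<in> lists V" "y = prod_list ys" "ys \<in> lists V"
      using xy unfolding H_def by blast
    then show ?thesis unfolding H_def by (intro image_eqI[of _ _ "xs @ ys"]) auto
  qed
  have Hi: "inverse x \<in> H" if x: "x \<in> H" for x
  proof -
    obtain xs where xs: "x = prod_list xs" "xs \<in> lists V" using x unfolding H_def by blast
    have "inverse (prod_list xs) = prod_list (map inverse xs)" by (induction xs) simp_all
    then show ?thesis
      unfolding H_def xs(1) using xs(2) invV by (intro image_eqI[of _ _ "map inverse xs"]) auto
  qed
  have VH: "v \<in> H" if "v \<in> V" for v
    unfolding H_def using that by (intro image_eqI[of _ _ "[v]"]) auto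
  \<comment> \<open>\<open>e\<close> encodes the countable set \<open>H\<close> by natural numbers
    and \<open>d\<close> decodes; \<open>de\<close> gives the injectivity of \<open>e\<close> on
    \<open>H\<close> that transports the group structure and lets \<open>e\<close> detect the value
    1.\<close>
  define e where "e = to_nat_on H"
  define d where "d = from_nat_into H"
  have de: "d (e x) = x" if "x \<in> H" for x using that H unfolding d_def e_def by simp
  define G :: "nat monoid" where "G = \<lparr>carrier = e ` H, monoid.mult = (\<lambda>x y. e (d x * d y)), one = e 1\<rparr>"
  have "group G"
  proof (rule groupI)
    fix x assume "x \<in> carrier G"
    then obtain y where y: "x = e y" "y \<in> H" by (auto simp: G_def)
    have "e (inverse y) \<otimes>\<^bsub>G\<^esub> x = \<one>\<^bsub>G\<^esub>" using y de Hi H0 by (simp add: G_def)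
    then show "\<exists>z\<in>carrier G. z \<otimes>\<^bsub>G\<^esub> x = \<one>\<^bsub>G\<^esub>" using Hi[OF y(2)] by (auto simp: G_def)
  qed (auto simp: G_def de Hm H1 mult.assoc)
  moreover have "grading C G (\<lambda>X. e (mon_val X))"
    unfolding grading_def
  proof (intro conjI allI impI)
    fix X assume "simple C X"
    then show "e (mon_val X) \<in> carrier G" using VH inV by (simp add: G_def)
  next
    fix X Y assume "simple C X \<and> simple C Y \<and> isomorphic C X Y"
    then show "e (mon_val X) = e (mon_val Y)" using mon_val_isomorphic by metis
  next
    fix X Y Z
    assume *: "simple C X \<and> simple C Y \<and> simple C Z \<and> (\<exists>f\<in>homs C Z (X \<star> Y). is_mono C f)"
    then have "mon_val Z = mon_val X * mon_val Y" using mon_val_tens by blast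
    then show "e (mon_val Z) = e (mon_val X) \<otimes>\<^bsub>G\<^esub> e (mon_val Y)"
      using * VH inV de by (simp add: G_def)
  qed
  moreover have "e 1 = \<one>\<^bsub>G\<^esub>" by (simp add: G_def)
  moreover have "mon_val X = 1" if "simple C X" "e (mon_val X) = e 1" for X
    using that de VH inV H1 by metis
  ultimately show thesis using that by blast
qed

end

end

context graded_ribbon_fusion_category
begin

text \<open>By the universal property the grading by \<open>mon_val\<close> factors through
  \<open>deg\<close> by a homomorphism \<open>h\<close>. It sends the identity to the code of 1, so
  simple objects of trivial degree braid trivially with \<eta>; naturality along a direct sum
  decomposition extends this to the whole component.\<close>

lemma braid_symmetric:
  assumes \<eta>: "invertible C \<eta>" and X: "X \<in> component C deg \<one>\<^bsub>A\<^esub>"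
  shows "\<beta> \<eta> X \<cdot> \<beta> X \<eta> = \<^bold>1 (X \<star> \<eta>)"
proof -
  obtain G :: "nat monoid" and e where G: "group G" "grading C G (\<lambda>X. e (mon_val \<eta> X))" "e 1 = \<one>\<^bsub>G\<^esub>"
      "\<And>X. simple C X \<Longrightarrow> e (mon_val \<eta> X) = e 1 \<Longrightarrow> mon_val \<eta> X = 1"
    using mon_val_grading[OF \<eta>] by blast
  obtain h where h: "h \<in> hom A G" "\<And>X. simple C X \<Longrightarrow> e (mon_val \<eta> X) = h (deg X)"
    using universal G unfolding universal_grading_def by blast
  have "h \<one>\<^bsub>A\<^esub> = e 1" using hom_one[OF h(1) is_group G(1)] G(3) by simp
  then have triv: "monodromy \<eta> Y = \<^bold>1 (Y \<star> \<eta>)" if "simple C Y" "deg Y = \<one>\<^bsub>A\<^esub>" for Y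
    using mon_val[OF \<eta> that(1)] G(4)[OF that(1)] h(2)[OF that(1)] that simple_obj invertible_obj[OF \<eta>] by simp
  obtain Xs where Xs: "is_direct_sum C X Xs" "\<And>Y. Y \<in> set Xs \<Longrightarrow> simple C Y \<and> deg Y = \<one>\<^bsub>A\<^esub>"
    using X unfolding component_def by blast
  then have X': "X \<in> obj C" by (simp add: is_direct_sum_def)
  have \<eta>': "\<eta> \<in> obj C" using \<eta> by (rule invertible_obj)
  obtain \<iota> \<pi> where *: "\<And>j. j < length Xs \<Longrightarrow> \<iota> j \<in> homs C (Xs ! j) X \<and> \<pi> j \<in> homs C X (Xs ! j)"
      "msum C X X (map (\<lambda>j. \<iota> j \<cdot> \<pi> j) [0..<length Xs]) = \<^bold>1 X"
    using Xs(1) unfolding is_direct_sum_def by blast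
  \<comment> \<open>Naturality along the inclusion replaces the double braiding with
    \<open>X\<close> by the one with the simple summand, which is trivial.\<close>
  have summand: "monodromy \<eta> X \<cdot> ((\<iota> j \<cdot> \<pi> j) \<boxtimes> \<^bold>1 \<eta>) = (\<iota> j \<cdot> \<pi> j) \<boxtimes> \<^bold>1 \<eta>" if "j < length Xs" for j
  proof -
    have t: "\<iota> j \<in> arr C" "\<pi> j \<in> arr C" "src C (\<iota> j) = Xs ! j" "tgt C (\<iota> j) = X"
      "src C (\<pi> j) = X" "tgt C (\<pi> j) = Xs ! j"
      using *(1)[OF that] by (auto simp: homs_iff)
    have Xj: "Xs ! j \<in> obj C" using src_obj[OF t(1)] t(3) by simp
    have "monodromy \<eta> X \<cdot> ((\<iota> j \<cdot> \<pi> j) \<boxtimes> \<^bold>1 \<eta>) = (monodromy \<eta> X \<cdot> (\<iota> j \<boxtimes> \<^bold>1 \<eta>)) \<cdot> (\<pi> j \<boxtimes> \<^bold>1 \<eta>)"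
      using t X' \<eta>' by (simp add: whisker_right)
    also have "monodromy \<eta> X \<cdot> (\<iota> j \<boxtimes> \<^bold>1 \<eta>) = \<iota> j \<boxtimes> \<^bold>1 \<eta>"
      using monodromy_natural[OF t(1,3,4) \<eta>'] triv[of "Xs ! j"] Xs(2)[of "Xs ! j"] that t Xj \<eta>' by simp
    also have "(\<iota> j \<boxtimes> \<^bold>1 \<eta>) \<cdot> (\<pi> j \<boxtimes> \<^bold>1 \<eta>) = (\<iota> j \<cdot> \<pi> j) \<boxtimes> \<^bold>1 \<eta>"
      using t \<eta>' by (simp add: whisker_right)
    finally show ?thesis .
  qed
  have sum: "msum C X X fs \<in> homs C X X \<and> monodromy \<eta> X \<cdot> (msum C X X fs \<boxtimes> \<^bold>1 \<eta>) = msum C X X fs \<boxtimes> \<^bold>1 \<eta>"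
    if "\<And>f. f \<in> set fs \<Longrightarrow> f \<in> homs C X X \<and> monodromy \<eta> X \<cdot> (f \<boxtimes> \<^bold>1 \<eta>) = f \<boxtimes> \<^bold>1 \<eta>" for fs
    using that
  proof (induction fs)
    case Nil
    then show ?case
      using X' \<eta>' comp_zero[of "monodromy \<eta> X" "X \<star> \<eta>" "X \<star> \<eta>"] by (simp add: msum_def tens_zero homs_iff)
  next
    case (Cons f fs)
    then have IH: "msum C X X fs \<in> homs C X X"
      "monodromy \<eta> X \<cdot> (msum C X X fs \<boxtimes> \<^bold>1 \<eta>) = msum C X X fs \<boxtimes> \<^bold>1 \<eta>" by auto
    have f: "f \<in> homs C X X" "monodromy \<eta> X \<cdot> (f \<boxtimes> \<^bold>1 \<eta>) = f \<boxtimes> \<^bold>1 \<eta>" using Cons.prems by auto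
    have "(f \<boxplus> msum C X X fs) \<boxtimes> \<^bold>1 \<eta> = f \<boxtimes> \<^bold>1 \<eta> \<boxplus> msum C X X fs \<boxtimes> \<^bold>1 \<eta>"
      using tens_add_left[OF f(1) IH(1), of "\<^bold>1 \<eta>"] \<eta>' by simp
    then show ?case using f IH X' \<eta>' by (simp add: msum_def homs_iff comp_add)
  qed
  have "monodromy \<eta> X \<cdot> (\<^bold>1 X \<boxtimes> \<^bold>1 \<eta>) = \<^bold>1 X \<boxtimes> \<^bold>1 \<eta>"
    using sum[of "map (\<lambda>j. \<iota> j \<cdot> \<pi> j) [0..<length Xs]"] summand *  by (fastforce simp: homs_iff)
  then show ?thesis using X' \<eta>' by (simp add: tens_id monodromy_def)
qed

end

subsection \<open>Scalars of the zesting data\<close>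

locale strict_zesting = ribbon_zesting +
  assumes strict: "strict_symmetric_cocycle C A (lam \<zeta>)"
begin

abbreviation mulA (infixl "\<diamondop>" 80) where "a \<diamondop> b \<equiv> a \<otimes>\<^bsub>A\<^esub> b"
abbreviation iv where "iv a \<equiv> inv\<^bsub>A\<^esub> a"
abbreviation eA where "eA \<equiv> \<one>\<^bsub>A\<^esub>"
abbreviation L where "L \<equiv> lam \<zeta>"
abbreviation N where "N \<equiv> nu \<zeta>"

lemma inv_mult_cancel [simp]:
  assumes "a \<in> carrier A" "b \<in> carrier A"
  shows "a \<diamondop> b \<diamondop> iv b = a" "a \<diamondop> iv b \<diamondop> b = a"
  using assms by (simp_all add: m_assoc)

lemma L_invertible [simp]: "\<lbrakk>a \<in> carrier A; b \<in> carrier A\<rbrakk> \<Longrightarrow> invertible C (L a b)"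
  and L_component: "\<lbrakk>a \<in> carrier A; b \<in> carrier A\<rbrakk> \<Longrightarrow> L a b \<in> component C deg eA"
  using lam_inv by auto

lemma L_obj [simp]: "\<lbrakk>a \<in> carrier A; b \<in> carrier A\<rbrakk> \<Longrightarrow> L a b \<in> obj C"
  using invertible_obj by simp

lemma L_unit [simp]: "a \<in> carrier A \<Longrightarrow> L eA a = \<I>" "a \<in> carrier A \<Longrightarrow> L a eA = \<I>"
  using lam_unit by auto

lemma L_sym: "\<lbrakk>a \<in> carrier A; b \<in> carrier A\<rbrakk> \<Longrightarrow> L a b = L b a"
  using strict by (simp add: strict_symmetric_cocycle_def)

lemma L_cocycle: "\<lbrakk>a \<in> carrier A; b \<in> carrier A; c \<in> carrier A\<rbrakk>
    \<Longrightarrow> L b c \<star> L a (b \<diamondop> c) = L a b \<star> L (a \<diamondop> b) c"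
  using strict by (auto simp: strict_symmetric_cocycle_def)

text \<open>Both sides equal \<open>L b c \<star> L a (b \<diamondop> c)\<close>. So exchanging two
  adjacent downward strands does not change the object, and their crossing is an
  endomorphism.\<close>

lemma L_swap:
  assumes "a \<in> carrier A" "b \<in> carrier A" "c \<in> carrier A"
  shows "L a c \<star> L (a \<diamondop> c) b = L a b \<star> L (a \<diamondop> b) c"
  using L_cocycle[of a b c] L_cocycle[of a c b] L_sym[of b c] m_comm[of b c] assms by simp

lemma L_inv_right:
  "\<lbrakk>a \<in> carrier A; b \<in> carrier A\<rbrakk> \<Longrightarrow> L a b \<star> L (a \<diamondop> b) (iv b) = L b (iv b)"
  using L_cocycle[of a b "iv b"] by simp

lemma L_inv_left: "a \<in> carrier A \<Longrightarrow> L (iv a) a = L a (iv a)"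
  by (rule L_sym) auto

lemma tens_eq: "\<lbrakk>X \<star> Y = X' \<star> Y'; X \<in> obj C; Y \<in> obj C; X' \<in> obj C; Y' \<in> obj C; Z \<in> obj C\<rbrakk>
    \<Longrightarrow> X \<star> Y \<star> Z = X' \<star> Y' \<star> Z"
  by (metis tens_assoc_obj)

lemma N_arr [simp]:
  assumes "a \<in> carrier A" "b \<in> carrier A" "c \<in> carrier A"
  shows "N a b c \<in> arr C" "src C (N a b c) = L a b \<star> L (a \<diamondop> b) c"
    "tgt C (N a b c) = L a b \<star> L (a \<diamondop> b) c" "is_iso C (N a b c)"
  using nu_hom[OF assms] nu_iso[OF assms] L_cocycle[OF assms] by (simp_all add: homs_iff)

lemma tz_arr [simp]:
  assumes "a \<in> carrier A" "b \<in> carrier A"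
  shows "tz \<zeta> a b \<in> arr C" "src C (tz \<zeta> a b) = L a b"
    "tgt C (tz \<zeta> a b) = L a b" "is_iso C (tz \<zeta> a b)"
  using tz_hom[OF assms] tz_iso[OF assms] L_sym[OF assms] by (simp_all add: homs_iff)

text \<open>By strictness all morphisms below are endomorphisms of invertible objects, so their scalars make
  sense. In particular this holds for the braiding tensored with \<open>\<lambda>(ab, cd)\<close>, but not for
  \<open>\<beta>\<close> on \<open>\<lambda>(a, b) \<otimes> \<lambda>(c, d)\<close> itself.\<close>

definition n where "n a b c = scalar C (N a b c)"
definition \<tau> where "\<tau> a b = scalar C (tz \<zeta> a b)"
definition p where "p i a b = scalar C (phi C A \<zeta> i a b)"
definition B where "B a b c d = scalar C (\<beta> (L a b) (L c d) \<boxtimes> \<^bold>1 (L (a \<diamondop> b) (c \<diamondop> d)))"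
abbreviation om where "om \<equiv> omega C deg \<zeta>"

lemma N_scalar:
  assumes "a \<in> carrier A" "b \<in> carrier A" "c \<in> carrier A"
  shows "N a b c = n a b c \<triangleright> \<^bold>1 (L a b \<star> L (a \<diamondop> b) c)" "n a b c \<noteq> 0"
proof -
  have O: "invertible C (L a b \<star> L (a \<diamondop> b) c)" using assms by (simp add: invertible_tens)
  show *: "N a b c = n a b c \<triangleright> \<^bold>1 (L a b \<star> L (a \<diamondop> b) c)"
    unfolding n_def using O assms by (intro scalar_smul_id) simp_all
  show "n a b c \<noteq> 0" using iso_scalar_nonzero[OF O _ *] assms by simp
qed

lemma minv_N_scalar:
  assumes "a \<in> carrier A" "b \<in> carrier A" "c \<in> carrier A"
  shows "minv C (N a b c) = inverse (n a b c) \<triangleright> \<^bold>1 (L a b \<star> L (a \<diamondop> b) c)"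
  using N_scalar[OF assms] assms by simp

lemma n_unit [simp]:
  assumes "a \<in> carrier A" "b \<in> carrier A"
  shows "n eA a b = 1" "n a eA b = 1" "n a b eA = 1"
proof -
  have "scalar C (\<^bold>1 (L c d)) = 1" if "c \<in> carrier A" "d \<in> carrier A" for c d
    using that by (intro scalar_eq[of "L c d"]) simp_all
  then show "n eA a b = 1" "n a eA b = 1" "n a b eA = 1"
    using assms by (simp_all add: n_def nu_unit)
qed

lemma tz_scalar:
  assumes "a \<in> carrier A" "b \<in> carrier A"
  shows "tz \<zeta> a b = \<tau> a b \<triangleright> \<^bold>1 (L a b)" "\<tau> a b \<noteq> 0"
proof -
  show *: "tz \<zeta> a b = \<tau> a b \<triangleright> \<^bold>1 (L a b)"
    unfolding \<tau>_def using assms by (intro scalar_smul_id) simp_all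
  show "\<tau> a b \<noteq> 0" using iso_scalar_nonzero[OF _ _ *] assms by simp
qed

lemma \<tau>_unit [simp]:
  assumes "a \<in> carrier A"
  shows "\<tau> eA a = 1" "\<tau> a eA = 1"
  unfolding \<tau>_def using assms by (auto intro!: scalar_eq[of \<I>] simp: tz_unit invertible_unit)

lemma phi_scalar:
  assumes "i \<in> carrier A" "a \<in> carrier A" "b \<in> carrier A"
  shows "phi C A \<zeta> i a b = p i a b \<triangleright> \<^bold>1 (L i a \<star> L (i \<diamondop> a) b)"
    "p i a b = \<tau> a b * n i a b / n i b a" "p i a b \<noteq> 0"
proof -
  let ?O = "L i a \<star> L (i \<diamondop> a) b"
  have O: "invertible C ?O" using assms by (simp add: invertible_tens)
  have 1: "N i a b = n i a b \<triangleright> \<^bold>1 ?O" using N_scalar assms by simp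
  have 2: "tz \<zeta> a b \<boxtimes> \<^bold>1 (L i (a \<diamondop> b)) = \<tau> a b \<triangleright> \<^bold>1 ?O"
    using assms tz_scalar[of a b] L_cocycle[of i a b] by (simp add: tens_id)
  have 3: "minv C (N i b a) = inverse (n i b a) \<triangleright> \<^bold>1 ?O"
    using minv_N_scalar[of i b a] L_swap[of i a b] assms by simp
  have *: "phi C A \<zeta> i a b = (\<tau> a b * n i a b / n i b a) \<triangleright> \<^bold>1 ?O"
    unfolding phi_def 1 2 3 using assms by (simp add: field_simps)
  then show **: "p i a b = \<tau> a b * n i a b / n i b a" unfolding p_def by (rule scalar_eq[OF O])
  show "phi C A \<zeta> i a b = p i a b \<triangleright> \<^bold>1 ?O" using * ** by simp
  show "p i a b \<noteq> 0" using ** assms N_scalar tz_scalar by simp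
qed

text \<open>Strictness makes all objects in the cocycle axiom for \<nu> equal, so the axiom becomes
  an equation of numbers. The other two claims come along because the same identifications are what
  makes the padded braiding an endomorphism.\<close>

lemma nu_cocycle_scalar:
  assumes c: "a \<in> carrier A" "b \<in> carrier A" "c \<in> carrier A" "d \<in> carrier A"
  shows "n b c d * n a (b \<diamondop> c) d * n a b c = n a b (c \<diamondop> d) * B a b c d * n (a \<diamondop> b) c d" (is ?eq)
    and "\<beta> (L a b) (L c d) \<boxtimes> \<^bold>1 (L (a \<diamondop> b) (c \<diamondop> d)) = B a b c d \<triangleright> \<^bold>1 (L a b \<star> L c d \<star> L (a \<diamondop> b) (c \<diamondop> d))" (is ?br)
    and "L c d \<star> L a b \<star> L (a \<diamondop> b) (c \<diamondop> d) = L a b \<star> L c d \<star> L (a \<diamondop> b) (c \<diamondop> d)"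
proof -
  let ?O = "L a b \<star> L (a \<diamondop> b) c \<star> L (a \<diamondop> b \<diamondop> c) d"
  have O: "invertible C ?O" "?O \<in> obj C" using c by (simp_all add: invertible_tens)
  \<comment> \<open>\<open>e1\<close> to \<open>e4\<close> move every object that occurs in the
    axiom to \<open>?O\<close>.\<close>
  have e1: "L b c \<star> L a (b \<diamondop> c) \<star> L (a \<diamondop> b \<diamondop> c) d = ?O"
    using c by (intro tens_eq L_cocycle) simp_all
  have e2: "L b c \<star> L (b \<diamondop> c) d \<star> L a (b \<diamondop> c \<diamondop> d) = ?O"
    using c e1 L_cocycle[of a "b \<diamondop> c" d] by (simp add: m_assoc)
  have e3: "L a b \<star> L c d \<star> L (a \<diamondop> b) (c \<diamondop> d) = ?O"
    using c L_cocycle[of "a \<diamondop> b" c d] by simp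
  have "L c d \<star> L b (c \<diamondop> d) \<star> L a (b \<diamondop> c \<diamondop> d) = L b c \<star> L (b \<diamondop> c) d \<star> L a (b \<diamondop> c \<diamondop> d)"
    using c by (intro tens_eq L_cocycle) simp_all
  then have e4: "L c d \<star> L a b \<star> L (a \<diamondop> b) (c \<diamondop> d) = ?O"
    using c e2 L_cocycle[of a b "c \<diamondop> d"] by (simp add: m_assoc)
  show "L c d \<star> L a b \<star> L (a \<diamondop> b) (c \<diamondop> d) = L a b \<star> L c d \<star> L (a \<diamondop> b) (c \<diamondop> d)" using e3 e4 by simp
  have b: "\<beta> (L a b) (L c d) \<boxtimes> \<^bold>1 (L (a \<diamondop> b) (c \<diamondop> d)) = B a b c d \<triangleright> \<^bold>1 ?O"
    unfolding B_def using c O e3 e4 by (intro scalar_smul_id) simp_all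
  then show ?br using e3 by simp
  have f1: "N a b c \<boxtimes> \<^bold>1 (L (a \<diamondop> b \<diamondop> c) d) = n a b c \<triangleright> \<^bold>1 ?O"
    using N_scalar[of a b c] c by (simp add: tens_id)
  have f2: "\<^bold>1 (L b c) \<boxtimes> N a (b \<diamondop> c) d = n a (b \<diamondop> c) d \<triangleright> \<^bold>1 ?O"
    using N_scalar[of a "b \<diamondop> c" d] c e1 by (simp add: tens_id m_assoc)
  have f3: "N b c d \<boxtimes> \<^bold>1 (L a (b \<diamondop> c \<diamondop> d)) = n b c d \<triangleright> \<^bold>1 ?O"
    using N_scalar[of b c d] c e2 by (simp add: tens_id)
  have f4: "\<^bold>1 (L a b) \<boxtimes> N (a \<diamondop> b) c d = n (a \<diamondop> b) c d \<triangleright> \<^bold>1 ?O"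
    using N_scalar[of "a \<diamondop> b" c d] c by (simp add: tens_id)
  have f5: "\<^bold>1 (L c d) \<boxtimes> N a b (c \<diamondop> d) = n a b (c \<diamondop> d) \<triangleright> \<^bold>1 ?O"
    using N_scalar[of a b "c \<diamondop> d"] c e4 by (simp add: tens_id)
  have "(n b c d * n a (b \<diamondop> c) d * n a b c) \<triangleright> \<^bold>1 ?O
      = (n a b (c \<diamondop> d) * B a b c d * n (a \<diamondop> b) c d) \<triangleright> \<^bold>1 ?O"
    using nu_cocycle[OF c] O unfolding f1 f2 f3 f4 f5 b by (simp add: mult_ac)
  then show ?eq by (rule smul_id_cancel[OF O(1)])
qed

lemma tz_nu_scalar:
  assumes c: "a \<in> carrier A" "b \<in> carrier A" "c \<in> carrier A"
  shows "n b c a * \<tau> a (b \<diamondop> c) * n a b c = \<tau> a c * n b a c * \<tau> a b"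
proof -
  let ?O = "L a b \<star> L (a \<diamondop> b) c"
  have O: "invertible C ?O" "?O \<in> obj C" using c by (simp_all add: invertible_tens)
  have f1: "N a b c = n a b c \<triangleright> \<^bold>1 ?O" using N_scalar c by simp
  have f2: "\<^bold>1 (L b c) \<boxtimes> tz \<zeta> a (b \<diamondop> c) = \<tau> a (b \<diamondop> c) \<triangleright> \<^bold>1 ?O"
    using tz_scalar[of a "b \<diamondop> c"] c L_cocycle[of a b c] by (simp add: tens_id)
  have f3: "N b c a = n b c a \<triangleright> \<^bold>1 ?O"
    using N_scalar[of b c a] c L_cocycle[of a b c] L_sym[of a "b \<diamondop> c"] by simp
  have f4: "tz \<zeta> a b \<boxtimes> \<^bold>1 (L (a \<diamondop> b) c) = \<tau> a b \<triangleright> \<^bold>1 ?O"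
    using tz_scalar[of a b] c by (simp add: tens_id)
  have f5: "N b a c = n b a c \<triangleright> \<^bold>1 ?O"
    using N_scalar[of b a c] c L_sym[of a b] m_comm[of a b] by simp
  have f6: "tz \<zeta> a c \<boxtimes> \<^bold>1 (L b (a \<diamondop> c)) = \<tau> a c \<triangleright> \<^bold>1 ?O"
    using tz_scalar[of a c] c L_cocycle[of b a c] L_sym[of a b] m_comm[of a b] by (simp add: tens_id)
  have "(n b c a * \<tau> a (b \<diamondop> c) * n a b c) \<triangleright> \<^bold>1 ?O = (\<tau> a c * n b a c * \<tau> a b) \<triangleright> \<^bold>1 ?O"
    using tz_nu[OF c] O unfolding f1 f2 f3 f4 f5 f6 by (simp add: mult_ac)
  then show ?thesis by (rule smul_id_cancel[OF O(1)])
qed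

lemma tz_nu_inv_scalar:
  assumes c: "a \<in> carrier A" "b \<in> carrier A" "c \<in> carrier A"
  shows "om a b c * (\<tau> (a \<diamondop> b) c / (n c a b * n a b c)) = \<tau> a c * \<tau> b c / n a c b"
proof -
  let ?O = "L a b \<star> L (a \<diamondop> b) c"
  have O: "invertible C ?O" "?O \<in> obj C" using c by (simp_all add: invertible_tens)
  have f1: "minv C (N a b c) = inverse (n a b c) \<triangleright> \<^bold>1 ?O" using minv_N_scalar c by simp
  have f2: "\<^bold>1 (L a b) \<boxtimes> tz \<zeta> (a \<diamondop> b) c = \<tau> (a \<diamondop> b) c \<triangleright> \<^bold>1 ?O"
    using tz_scalar[of "a \<diamondop> b" c] c by (simp add: tens_id)
  have f3: "minv C (N c a b) = inverse (n c a b) \<triangleright> \<^bold>1 ?O"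
    using minv_N_scalar[of c a b] c L_cocycle[of c a b] L_sym[of c "a \<diamondop> b"] by simp
  have f4: "tz \<zeta> b c \<boxtimes> \<^bold>1 (L a (b \<diamondop> c)) = \<tau> b c \<triangleright> \<^bold>1 ?O"
    using tz_scalar[of b c] c L_cocycle[of a b c] by (simp add: tens_id)
  have f5: "minv C (N a c b) = inverse (n a c b) \<triangleright> \<^bold>1 ?O"
    using minv_N_scalar[of a c b] c L_swap[of a b c] by simp
  have f6: "tz \<zeta> a c \<boxtimes> \<^bold>1 (L (a \<diamondop> c) b) = \<tau> a c \<triangleright> \<^bold>1 ?O"
    using tz_scalar[of a c] c L_swap[of a b c] by (simp add: tens_id)
  have "(om a b c * (\<tau> (a \<diamondop> b) c / (n c a b * n a b c))) \<triangleright> \<^bold>1 ?O = (\<tau> a c * \<tau> b c / n a c b) \<triangleright> \<^bold>1 ?O"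
    using tz_nu_inv[OF c] O unfolding f1 f2 f3 f4 f5 f6 by (simp add: field_simps)
  then show ?thesis by (rule smul_id_cancel[OF O(1)])
qed

text \<open>For the second pair \<open>c\<close>, \<open>iv c\<close> the padding object in the
  definition of \<open>B\<close> is the unit, so \<open>B\<close> is the scalar of the braiding
  itself.\<close>

lemma braid_scalar:
  assumes c: "a \<in> carrier A" "b \<in> carrier A" "c \<in> carrier A"
  shows "\<beta> (L a b) (L c (iv c)) = B a b c (iv c) \<triangleright> \<^bold>1 (L a b \<star> L c (iv c))"
    "\<beta> (L c (iv c)) (L a b) = B c (iv c) a b \<triangleright> \<^bold>1 (L a b \<star> L c (iv c))"
    "L c (iv c) \<star> L a b = L a b \<star> L c (iv c)"
    "B a b (iv c) c = B a b c (iv c)"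
  using nu_cocycle_scalar(2,3)[of a b c "iv c"] nu_cocycle_scalar(2,3)[of c "iv c" a b] c L_inv_left[of c]
  by (simp_all add: B_def)

text \<open>The point where \<open>braid_symmetric\<close>, and with it the universality of the
  grading, enters the scalar calculus.\<close>

lemma B_symmetric:
  assumes c: "a \<in> carrier A" "b \<in> carrier A" "c \<in> carrier A"
  shows "B a b c (iv c) * B c (iv c) a b = 1"
proof -
  let ?O = "L a b \<star> L c (iv c)"
  have "\<beta> (L a b) (L c (iv c)) \<cdot> \<beta> (L c (iv c)) (L a b) = \<^bold>1 (L c (iv c) \<star> L a b)"
    using c by (intro braid_symmetric L_component) simp_all
  then have "(B a b c (iv c) * B c (iv c) a b) \<triangleright> \<^bold>1 ?O = 1 \<triangleright> \<^bold>1 ?O"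
    using c unfolding braid_scalar[OF c] by (simp add: mult_ac)
  then show ?thesis by (rule smul_id_cancel[rotated]) (use c in \<open>simp add: invertible_tens\<close>)
qed

text \<open>The hexagon, because \<open>L b (iv b)\<close> splits as
  \<open>L j b \<star> L (j \<diamondop> b) (iv b)\<close>.\<close>

lemma B_multiplicative:
  assumes c: "j \<in> carrier A" "a \<in> carrier A" "b \<in> carrier A"
  shows "B j b a (iv a) * B (j \<diamondop> b) (iv b) a (iv a) = B b (iv b) a (iv a)"
proof -
  let ?X = "L j b" and ?Y = "L (j \<diamondop> b) (iv b)" and ?Z = "L a (iv a)"
  have XY: "?X \<star> ?Y = L b (iv b)" using c L_inv_right by simp
  have "\<beta> (?X \<star> ?Y) ?Z = (\<beta> ?X ?Z \<boxtimes> \<^bold>1 ?Y) \<cdot> (\<^bold>1 ?X \<boxtimes> \<beta> ?Y ?Z)"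
    using c by (intro hexagon_left) simp_all
  also have "\<dots> = (B j b a (iv a) \<triangleright> \<^bold>1 (?X \<star> ?Z \<star> ?Y)) \<cdot> (B (j \<diamondop> b) (iv b) a (iv a) \<triangleright> \<^bold>1 (?X \<star> ?Y \<star> ?Z))"
    using c braid_scalar(1)[of j b a] braid_scalar(1)[of "j \<diamondop> b" "iv b" a] by (simp add: tens_id)
  also have "?Z \<star> ?Y = ?Y \<star> ?Z" using c braid_scalar(3) by simp
  finally have "B b (iv b) a (iv a) \<triangleright> \<^bold>1 (?X \<star> ?Y \<star> ?Z)
      = (B j b a (iv a) * B (j \<diamondop> b) (iv b) a (iv a)) \<triangleright> \<^bold>1 (?X \<star> ?Y \<star> ?Z)"
    using braid_scalar(1)[of b "iv b" a] c XY tens_assoc_obj[of ?X ?Y ?Z] by (simp add: mult_ac)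
  then show ?thesis
    by (intro smul_id_cancel[of "?X \<star> ?Y \<star> ?Z", symmetric]) (use c in \<open>simp_all add: invertible_tens\<close>)
qed

text \<open>The \<nu>-cocycle at \<open>j\<close>, \<open>a\<close>, \<open>iv a\<close>,
  \<open>a\<close>, where two factors are normalized to 1. It compares the scalars of a downward and
  an upward cup and is used in \<open>cup_down_cup_up\<close>.\<close>

lemma cup_scalar:
  assumes "j \<in> carrier A" "a \<in> carrier A"
  shows "n a (iv a) a * n j a (iv a) = B j a a (iv a) * n (j \<diamondop> a) (iv a) a"
  using nu_cocycle_scalar(1)[of j a "iv a" a] braid_scalar(4)[of j a a] assms by simp

text \<open>Scalar form of a strand of color \<open>a\<close> passing over both legs of a cup of
  color \<open>b\<close>: the base color of the cup changes from \<open>j\<close> to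
  \<open>j \<diamondop> a\<close>. It combines three \<nu>-cocycles with the first axiom on t at
  \<open>a\<close>, \<open>b\<close>, \<open>iv b\<close>, where the t with the trivial color drops
  out.\<close>

lemma phi_over_up:
  assumes c: "j \<in> carrier A" "a \<in> carrier A" "b \<in> carrier A"
  shows "p j a b * n j b (iv b) * p (j \<diamondop> b) a (iv b) = B j a b (iv b) * n (j \<diamondop> a) b (iv b)"
proof -
  have c1: "n b (iv b) a * n j b (iv b)
      = n j b (iv b \<diamondop> a) * B j b (iv b) a * n (j \<diamondop> b) (iv b) a"
    using nu_cocycle_scalar(1)[of j b "iv b" a] c by simp
  have c2: "n b a (iv b) * n j (a \<diamondop> b) (iv b) * n j b a
      = n j b (iv b \<diamondop> a) * B j b (iv b) a * n (j \<diamondop> b) a (iv b)"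
    using nu_cocycle_scalar(1)[of j b a "iv b"] c m_comm[of a b] m_comm[of a "iv b"] L_sym[of a "iv b"]
    by (simp add: B_def)
  have c3: "n a b (iv b) * n j (a \<diamondop> b) (iv b) * n j a b = B j a b (iv b) * n (j \<diamondop> a) b (iv b)"
    using nu_cocycle_scalar(1)[of j a b "iv b"] c by simp
  have c4: "n b (iv b) a * n a b (iv b) = \<tau> a (iv b) * n b a (iv b) * \<tau> a b"
    using tz_nu_scalar[of a b "iv b"] c by simp
  \<comment> \<open>Pure field algebra. The letter \<open>m\<close> stands for the factor that the
    first two cocycles share, so it cancels.\<close>
  have *: "t1 * r1 / r2 * q * (t2 * w2 / w1) = k * s * r1"
    if "u * q = m * w1" "v * s * r2 = m * w2" "u * k = t2 * v * t1"
      "r2 \<noteq> 0" "w1 \<noteq> 0" "u \<noteq> 0" "v \<noteq> 0" "m \<noteq> 0"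
    for t1 r1 r2 q t2 w1 w2 k s u v m :: 'c
  proof -
    have e: "w2 = v * s * r2 / m" "q = m * w1 / u" "k = t2 * v * t1 / u"
      using that by (simp_all add: field_simps)
    show ?thesis unfolding e using that(4-) by (simp add: field_simps)
  qed
  have "n j b (iv b \<diamondop> a) * B j b (iv b) a \<noteq> 0"
    using c1 N_scalar(2) c by (metis inv_closed m_closed mult_eq_0_iff)
  moreover have "p (j \<diamondop> b) a (iv b) = \<tau> a (iv b) * n (j \<diamondop> b) a (iv b) / n (j \<diamondop> b) (iv b) a"
    using phi_scalar(2)[of "j \<diamondop> b" a "iv b"] c by simp
  ultimately show ?thesis
    unfolding c3[symmetric] phi_scalar(2)[OF c]
    by (simp only:, intro *[OF c1 c2 c4]) (use c in \<open>simp_all add: N_scalar(2)\<close>)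
qed

text \<open>The counterpart for a strand of color \<open>b\<close> passing under both legs of a cup
  of color \<open>a\<close>. Here the second axiom on t is used, at \<open>a\<close>,
  \<open>iv a\<close>, \<open>b\<close>, and brings in \<omega>.\<close>

lemma phi_under_up:
  assumes c: "j \<in> carrier A" "a \<in> carrier A" "b \<in> carrier A"
  shows "p j a b * B j b a (iv a) * n (j \<diamondop> b) a (iv a) * p (j \<diamondop> a) (iv a) b
      = om a (iv a) b * n j a (iv a)"
proof -
  have c1: "n a (iv a) b * n j a (iv a)
      = n j a (iv a \<diamondop> b) * B j a (iv a) b * n (j \<diamondop> a) (iv a) b"
    using nu_cocycle_scalar(1)[of j a "iv a" b] c by simp
  have c2: "n a b (iv a) * n j (a \<diamondop> b) (iv a) * n j a b
      = n j a (iv a \<diamondop> b) * B j a (iv a) b * n (j \<diamondop> a) b (iv a)"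
    using nu_cocycle_scalar(1)[of j a b "iv a"] c m_comm[of b "iv a"] L_sym[of b "iv a"]
    by (simp add: B_def)
  have c3: "n b a (iv a) * n j (a \<diamondop> b) (iv a) * n j b a = B j b a (iv a) * n (j \<diamondop> b) a (iv a)"
    using nu_cocycle_scalar(1)[of j b a "iv a"] c m_comm[of a b] by simp
  have c4: "om a (iv a) b * (1 / (n b a (iv a) * n a (iv a) b)) = \<tau> a b * \<tau> (iv a) b / n a b (iv a)"
    using tz_nu_inv_scalar[of a "iv a" b] c by simp
  have *: "t1 * r1 / r2 * (k * s * r2) * (t2 * w1 / w2) = x * q"
    if "u * q = m * w1" "v * s * r1 = m * w2" "x * (1 / (k * u)) = t1 * t2 / v"
      "r2 \<noteq> 0" "w2 \<noteq> 0" "u \<noteq> 0" "v \<noteq> 0" "m \<noteq> 0" "k \<noteq> 0"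
    for t1 r1 r2 q t2 w1 w2 k s u v m x :: 'c
  proof -
    have e: "w2 = v * s * r1 / m" "w1 = u * q / m" "x = t1 * t2 / v * (k * u)"
      using that by (simp_all add: field_simps)
    have "s \<noteq> 0" "r1 \<noteq> 0" using that by auto
    then show ?thesis unfolding e using that(4,6-) by (simp add: field_simps)
  qed
  have "n j a (iv a \<diamondop> b) * B j a (iv a) b \<noteq> 0"
    using c1 N_scalar(2) c by (metis inv_closed m_closed mult_eq_0_iff)
  then show ?thesis
    using c3[symmetric] phi_scalar(2)[OF c] phi_scalar(2)[of "j \<diamondop> a" "iv a" b] c *[OF c1 c2 c4]
    by (simp add: N_scalar(2) mult.assoc)
qed

text \<open>Consider the four crossings of the pair \<open>a\<close>, \<open>iv a\<close> over the
  pair \<open>b\<close>, \<open>iv b\<close>. Grouped by \<open>phi_under_up\<close> their product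
  yields the two values of \<omega>; grouped by \<open>phi_over_up\<close> it yields only braidings,
  which cancel by symmetry. Multiplicativity of \<open>chi\<close> is not appealed to.\<close>

lemma om_inv:
  assumes c: "a \<in> carrier A" "b \<in> carrier A"
  shows "om a (iv a) b * om a (iv a) (iv b) = 1"
proof -
  have 1: "om a (iv a) b = p eA a b * B eA b a (iv a) * n b a (iv a) * p a (iv a) b"
    using phi_under_up[of eA a b] c by simp
  have 2: "om a (iv a) (iv b) * n b a (iv a) = p b a (iv b) * B b (iv b) a (iv a) * p (b \<diamondop> a) (iv a) (iv b)"
    using phi_under_up[of b a "iv b"] c by simp
  have 3: "p eA a b * p b a (iv b) = B eA a b (iv b) * n a b (iv b)"
    using phi_over_up[of eA a b] c by simp
  have 4: "p a (iv a) b * n a b (iv b) * p (b \<diamondop> a) (iv a) (iv b) = B a (iv a) b (iv b)"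
    using phi_over_up[of a "iv a" b] c m_comm[of a b] by simp
  \<comment> \<open>With base color \<open>eA\<close> the braided object is the unit. The values
    follow from \<open>B_multiplicative\<close> by cancelling a factor that
    \<open>B_symmetric\<close> shows to be nonzero.\<close>
  have 5: "B eA b a (iv a) = 1" "B eA a b (iv b) = 1"
    using B_multiplicative[of eA a b] B_multiplicative[of eA b a] B_symmetric[of b "iv b" a] B_symmetric[of a "iv a" b] c
    by auto
  \<comment> \<open>The same four values of \<open>p\<close>, regrouped from the columns of
    \<open>1\<close> and \<open>2\<close> into the rows of \<open>3\<close> and
    \<open>4\<close>.\<close>
  have "om a (iv a) b * om a (iv a) (iv b) * (n b a (iv a) * n a b (iv b))
      = (p eA a b * p b a (iv b)) * B b (iv b) a (iv a) * n b a (iv a) * (p a (iv a) b * n a b (iv b) * p (b \<diamondop> a) (iv a) (iv b))"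
    unfolding 1 using 2 5 by (simp add: algebra_simps)
  also have "\<dots> = (B a (iv a) b (iv b) * B b (iv b) a (iv a)) * (n b a (iv a) * n a b (iv b))"
    unfolding 3 4 5 by (simp add: algebra_simps)
  also have "B a (iv a) b (iv b) * B b (iv b) a (iv a) = 1" using B_symmetric[of a "iv a" b] c by simp
  finally show ?thesis using N_scalar(2) c by simp
qed

end

subsection \<open>Contracting a dual against a strand\<close>

context strict_ribbon_category
begin

text \<open>\<open>contract P L Q Y\<close> is a morphism \<open>P \<otimes> L* \<otimes> Q \<rightarrow> Y\<close>, provided that \<open>P \<otimes> Q = L \<otimes> Y\<close>.\<close>

definition contract where
  "contract P L Q Y = (ev C L \<boxtimes> \<^bold>1 Y) \<cdot> (\<beta> P (dual C L) \<boxtimes> \<^bold>1 Q)"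

lemma contract_arr [simp]:
  assumes "P \<in> obj C" "L \<in> obj C" "Q \<in> obj C" "Y \<in> obj C" "P \<star> Q = L \<star> Y"
  shows "contract P L Q Y \<in> arr C" "src C (contract P L Q Y) = P \<star> dual C L \<star> Q"
    "tgt C (contract P L Q Y) = Y"
  using assms by (simp_all add: contract_def)

lemma contract_braid:
  assumes "P \<in> obj C" "L \<in> obj C" "Q \<in> obj C" "R \<in> obj C" "Y \<in> obj C" "P \<star> R \<star> Q = L \<star> Y"
  shows "contract P L (R \<star> Q) Y \<cdot> (\<^bold>1 P \<boxtimes> \<beta> R (dual C L) \<boxtimes> \<^bold>1 Q) = contract (P \<star> R) L Q Y"
proof -
  have "\<beta> (P \<star> R) (dual C L) \<boxtimes> \<^bold>1 Q
      = (\<beta> P (dual C L) \<boxtimes> \<^bold>1 (R \<star> Q)) \<cdot> (\<^bold>1 P \<boxtimes> \<beta> R (dual C L) \<boxtimes> \<^bold>1 Q)"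
    using assms(1-5) by (simp add: hexagon_left whisker_right tens_id[symmetric])
  then show ?thesis using assms by (simp add: contract_def)
qed

text \<open>The braiding here runs opposite to the one in \<open>contract_braid\<close>; by
  \<open>sym\<close> the two are inverse to each other.\<close>

lemma contract_unbraid:
  assumes "P \<in> obj C" "L \<in> obj C" "Q \<in> obj C" "R \<in> obj C" "Y \<in> obj C" "P \<star> R \<star> Q = L \<star> Y"
    and sym: "\<beta> R (dual C L) \<cdot> \<beta> (dual C L) R = \<^bold>1 (dual C L \<star> R)"
  shows "contract (P \<star> R) L Q Y \<cdot> (\<^bold>1 P \<boxtimes> \<beta> (dual C L) R \<boxtimes> \<^bold>1 Q) = contract P L (R \<star> Q) Y"
proof -
  have "(\<^bold>1 P \<boxtimes> \<beta> R (dual C L) \<boxtimes> \<^bold>1 Q) \<cdot> (\<^bold>1 P \<boxtimes> \<beta> (dual C L) R \<boxtimes> \<^bold>1 Q) = \<^bold>1 (P \<star> dual C L \<star> R \<star> Q)"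
    using assms(1-5) by (simp add: interchange' sym tens_id)
  then show ?thesis using assms by (simp add: contract_braid[symmetric])
qed

lemma contract_right:
  assumes "P \<in> obj C" "L \<in> obj C" "Q \<in> obj C" "Y \<in> obj C" "W \<in> obj C" "P \<star> Q = L \<star> Y"
  shows "contract P L Q Y \<boxtimes> \<^bold>1 W = contract P L (Q \<star> W) (Y \<star> W)"
  using assms by (simp add: contract_def whisker_right tens_id)

text \<open>By naturality along the evaluation, \<open>W\<close> moves to the other side of
  \<open>dual C L \<star> L\<close>. Passing \<open>L\<close> costs the scalar \<open>s\<close>, and
  the braiding past the dual merges with that of \<open>P\<close> by the hexagon.\<close>

lemma contract_left:
  assumes "P \<in> obj C" "L \<in> obj C" "Q \<in> obj C" "Y \<in> obj C" "W \<in> obj C" "P \<star> Q = L \<star> Y"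
    and s: "W \<star> L = L \<star> W" "\<beta> W L = s \<triangleright> \<^bold>1 (W \<star> L)"
  shows "\<^bold>1 W \<boxtimes> contract P L Q Y = s \<triangleright> contract (W \<star> P) L Q (W \<star> Y)"
proof -
  let ?L = "dual C L"
  have L': "?L \<in> obj C" using assms(2) by simp
  have "\<^bold>1 W \<boxtimes> ev C L = (ev C L \<boxtimes> \<^bold>1 W) \<cdot> \<beta> W (?L \<star> L)"
    using assms(1-5) L' braid_natural'[of "\<^bold>1 W" "ev C L" W W "?L \<star> L" \<I>] by simp
  also have "\<dots> = s \<triangleright> ((ev C L \<boxtimes> \<^bold>1 W) \<cdot> (\<beta> W ?L \<boxtimes> \<^bold>1 L))"
    using assms(1-5) L' s by (simp add: hexagon_right tens_id)
  finally have "\<^bold>1 W \<boxtimes> ev C L \<boxtimes> \<^bold>1 Y = s \<triangleright> (((ev C L \<boxtimes> \<^bold>1 W) \<cdot> (\<beta> W ?L \<boxtimes> \<^bold>1 L)) \<boxtimes> \<^bold>1 Y)"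
    using assms(1-5) L' s(1) tens_assoc[of "\<^bold>1 W" "ev C L" "\<^bold>1 Y"] by (simp del: tens_assoc)
  also have "\<dots> = s \<triangleright> ((ev C L \<boxtimes> \<^bold>1 (W \<star> Y)) \<cdot> (\<beta> W ?L \<boxtimes> \<^bold>1 (P \<star> Q)))"
    using assms L' by (simp add: whisker_right tens_id)
  finally have 1: "\<^bold>1 W \<boxtimes> ev C L \<boxtimes> \<^bold>1 Y = s \<triangleright> ((ev C L \<boxtimes> \<^bold>1 (W \<star> Y)) \<cdot> (\<beta> W ?L \<boxtimes> \<^bold>1 (P \<star> Q)))" .
  have 2: "\<beta> (W \<star> P) ?L \<boxtimes> \<^bold>1 Q = (\<beta> W ?L \<boxtimes> \<^bold>1 (P \<star> Q)) \<cdot> (\<^bold>1 W \<boxtimes> \<beta> P ?L \<boxtimes> \<^bold>1 Q)"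
    using assms(1-5) L' by (simp add: hexagon_left whisker_right tens_id[symmetric])
  have t: "W \<star> P \<star> Q = L \<star> W \<star> Y" using assms(1-5) tens_assoc_obj[of W L Y] s(1) assms(6) by simp
  have "\<^bold>1 W \<boxtimes> contract P L Q Y = (\<^bold>1 W \<boxtimes> ev C L \<boxtimes> \<^bold>1 Y) \<cdot> (\<^bold>1 W \<boxtimes> \<beta> P ?L \<boxtimes> \<^bold>1 Q)"
    using assms(1-6) L' by (simp add: contract_def whisker_left)
  also have "\<dots> = s \<triangleright> ((ev C L \<boxtimes> \<^bold>1 (W \<star> Y)) \<cdot> ((\<beta> W ?L \<boxtimes> \<^bold>1 (P \<star> Q)) \<cdot> (\<^bold>1 W \<boxtimes> \<beta> P ?L \<boxtimes> \<^bold>1 Q)))"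
    unfolding 1 using assms(1-5) L' t by (simp del: tens_assoc)
  also have "\<dots> = s \<triangleright> contract (W \<star> P) L Q (W \<star> Y)"
    unfolding 2[symmetric] by (simp only: contract_def)
  finally show ?thesis .
qed

text \<open>The hypothesis \<open>eq\<close> is a relation without \<open>D\<close>; the conclusion
  is the same relation with \<open>D\<close> braided through it. Naturality slides \<open>D\<close>
  past \<open>Y\<close> and then past \<open>c\<close>, whose target is the unit. It reduces a
  crossing of two upward strands to one with a single upward strand.\<close>

lemma braid_past_dual:
  assumes o: "D \<in> obj C" "P \<in> obj C" "S \<in> obj C" "R \<in> obj C" "T \<in> obj C" "M \<in> obj C"
    and Y: "Y \<in> arr C" "src C Y = S \<star> M" "tgt C Y = R \<star> T"
    and c: "c \<in> arr C" "src C c = P \<star> S" "tgt C c = \<I>"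
    and Z: "Z \<in> arr C" "src C Z = P \<star> R \<star> T" "tgt C Z = M"
    and eq: "Z \<cdot> (\<^bold>1 P \<boxtimes> Y) = s \<triangleright> (c \<boxtimes> \<^bold>1 M)"
  shows "(\<^bold>1 D \<boxtimes> Z) \<cdot> (\<beta> P D \<boxtimes> \<^bold>1 (R \<star> T)) \<cdot> (\<^bold>1 P \<boxtimes> ((\<^bold>1 D \<boxtimes> Y) \<cdot> (\<beta> S D \<boxtimes> \<^bold>1 M)))
      = s \<triangleright> (c \<boxtimes> \<^bold>1 (D \<star> M))"
proof -
  have 1: "(\<beta> P D \<boxtimes> \<^bold>1 (R \<star> T)) \<cdot> (\<^bold>1 (P \<star> D) \<boxtimes> Y) = (\<^bold>1 (D \<star> P) \<boxtimes> Y) \<cdot> (\<beta> P D \<boxtimes> \<^bold>1 (S \<star> M))"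
    using slide[of "\<beta> P D" Y "P \<star> D" "D \<star> P" "S \<star> M" "R \<star> T"] o Y by simp
  have 2: "(\<beta> P D \<boxtimes> \<^bold>1 (S \<star> M)) \<cdot> (\<^bold>1 P \<boxtimes> \<beta> S D \<boxtimes> \<^bold>1 M) = \<beta> (P \<star> S) D \<boxtimes> \<^bold>1 M"
    using o by (simp add: hexagon_left whisker_right tens_id[symmetric])
  have 3: "(\<^bold>1 D \<boxtimes> c) \<cdot> \<beta> (P \<star> S) D = c \<boxtimes> \<^bold>1 D"
    using braid_natural'[of c "\<^bold>1 D" "P \<star> S" \<I> D D] o c by simp
  have "(\<^bold>1 D \<boxtimes> Z) \<cdot> (\<beta> P D \<boxtimes> \<^bold>1 (R \<star> T)) \<cdot> (\<^bold>1 P \<boxtimes> ((\<^bold>1 D \<boxtimes> Y) \<cdot> (\<beta> S D \<boxtimes> \<^bold>1 M)))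
      = (\<^bold>1 D \<boxtimes> Z) \<cdot> ((\<beta> P D \<boxtimes> \<^bold>1 (R \<star> T)) \<cdot> (\<^bold>1 (P \<star> D) \<boxtimes> Y)) \<cdot> (\<^bold>1 P \<boxtimes> \<beta> S D \<boxtimes> \<^bold>1 M)"
    using o Y Z by (simp add: whisker_left tens_id[symmetric])
  also have "\<dots> = (\<^bold>1 D \<boxtimes> (Z \<cdot> (\<^bold>1 P \<boxtimes> Y))) \<cdot> ((\<beta> P D \<boxtimes> \<^bold>1 (S \<star> M)) \<cdot> (\<^bold>1 P \<boxtimes> \<beta> S D \<boxtimes> \<^bold>1 M))"
    unfolding 1 using o Y Z by (simp add: whisker_left tens_id[symmetric])
  also have "\<dots> = s \<triangleright> (((\<^bold>1 D \<boxtimes> c) \<cdot> \<beta> (P \<star> S) D) \<boxtimes> \<^bold>1 M)"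
    unfolding eq 2 using o c by (simp add: whisker_right)
  finally show ?thesis unfolding 3 using o c by (simp add: tens_id)
qed

end

subsection \<open>Elementary tangles\<close>

locale unit_dim_zesting = strict_zesting +
  assumes eps1: "a \<in> carrier A \<Longrightarrow> eps \<zeta> a = 1"
begin

abbreviation "l \<equiv> lam1 A \<zeta>"
abbreviation ld where "ld a \<equiv> dual C (l a)"
abbreviation "Pt \<equiv> zest_point C A \<zeta>"
abbreviation "cup \<equiv> zest_cup C A \<zeta>"
abbreviation "cap \<equiv> zest_cap C A \<zeta>"
abbreviation "X \<equiv> zest_overL C A deg \<zeta>"

lemma l_obj [simp]: "a \<in> carrier A \<Longrightarrow> l a \<in> obj C" by (simp add: lam1_def)

lemma Pt_obj [simp]: "\<lbrakk>i \<in> carrier A; color q \<in> carrier A\<rbrakk> \<Longrightarrow> Pt i q \<in> obj C"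
  by (cases q) simp_all

lemma dual_symmetric:
  assumes "a \<in> carrier A" "b \<in> carrier A" "c \<in> carrier A"
  shows "\<beta> (ld c) (L a b) \<cdot> \<beta> (L a b) (ld c) = \<^bold>1 (L a b \<star> ld c)"
    "\<beta> (L a b) (ld c) \<cdot> \<beta> (ld c) (L a b) = \<^bold>1 (ld c \<star> L a b)"
    "minv C (\<beta> (ld c) (L a b)) = \<beta> (L a b) (ld c)"
proof -
  have o: "L a b \<in> obj C" "ld c \<in> obj C" using assms by simp_all
  show 1: "\<beta> (ld c) (L a b) \<cdot> \<beta> (L a b) (ld c) = \<^bold>1 (L a b \<star> ld c)"
    using assms by (intro braid_dual_symmetric braid_symmetric L_component) (simp_all add: lam1_def)
  have "\<beta> (ld c) (L a b) \<cdot> (\<beta> (L a b) (ld c) \<cdot> \<beta> (ld c) (L a b)) = \<beta> (ld c) (L a b) \<cdot> \<^bold>1 (ld c \<star> L a b)"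
    using 1 o comp_assoc'[of "\<beta> (ld c) (L a b)" "\<beta> (L a b) (ld c)" "\<beta> (ld c) (L a b)"] by simp
  then show 2: "\<beta> (L a b) (ld c) \<cdot> \<beta> (ld c) (L a b) = \<^bold>1 (ld c \<star> L a b)"
    by (rule iso_cancel_left) (use o in simp_all)
  show "minv C (\<beta> (ld c) (L a b)) = \<beta> (L a b) (ld c)"
    by (rule minv_eq(2)) (use o 1 2 in simp_all)
qed

lemma cup_down:
  assumes "j \<in> carrier A" "a \<in> carrier A"
  shows "cup j (Dn a) = n j a (iv a) \<triangleright> contract (L j a) (l a) (L (j \<diamondop> a) (iv a)) \<I>"
    "L j a \<star> L (j \<diamondop> a) (iv a) = l a"
  using assms N_scalar(1)[of j a "iv a"] L_inv_right[of j a]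
  by (simp_all add: contract_def eps1 lam1_def tens_id)

text \<open>The left base color is written \<open>j \<diamondop> a\<close>, so that \<open>j\<close>
  is the color of the region inside the cup.\<close>

lemma cup_up:
  assumes "j \<in> carrier A" "a \<in> carrier A"
  shows "cup (j \<diamondop> a) (Up a) = (n (j \<diamondop> a) (iv a) a / n a (iv a) a) \<triangleright> ev C (l a)"
    "L (j \<diamondop> a) (iv a) \<star> L j a = l a"
proof -
  show e: "L (j \<diamondop> a) (iv a) \<star> L j a = l a"
    using assms L_inv_right[of "j \<diamondop> a" "iv a"] by (simp add: lam1_def L_inv_left)
  have 1: "N (j \<diamondop> a) (iv a) a = n (j \<diamondop> a) (iv a) a \<triangleright> \<^bold>1 (l a)"
    using N_scalar(1)[of "j \<diamondop> a" "iv a" a] assms e by simp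
  have 2: "minv C (nu1 A \<zeta> a) = inverse (n a (iv a) a) \<triangleright> \<^bold>1 (l a)"
    using minv_N_scalar[of a "iv a" a] assms by (simp add: nu1_def lam1_def)
  show "cup (j \<diamondop> a) (Up a) = (n (j \<diamondop> a) (iv a) a / n a (iv a) a) \<triangleright> ev C (l a)"
    using assms 1 2 by (simp add: tens_id field_simps)
qed

text \<open>The axiom \<open>eps_dim\<close> at \<open>a\<close> and \<open>iv a\<close> gives
  dimension 1, because \<epsilon> is identically 1.\<close>

lemma ev_coevr:
  assumes "a \<in> carrier A"
  shows "qdim C (l a) = 1" "ev C (l a) \<cdot> coevr C (l a) = \<^bold>1 \<I>"
proof -
  show q: "qdim C (l a) = 1"
    using eps_dim[of a "iv a"] eps1 assms by (simp add: lam1_def)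
  have "ev C (l a) \<cdot> coevr C (l a) = scalar C (ev C (l a) \<cdot> coevr C (l a)) \<triangleright> \<^bold>1 \<I>"
    using assms by (intro scalar_smul_id invertible_unit) simp_all
  then show "ev C (l a) \<cdot> coevr C (l a) = \<^bold>1 \<I>" using q by (simp add: qdim_def)
qed

lemma cup_arr [simp]:
  assumes "j \<in> carrier A" "color q \<in> carrier A"
  shows "cup j q \<in> arr C" "src C (cup j q) = Pt j q \<star> Pt (across A j q) (flip q)" "tgt C (cup j q) = \<I>"
proof -
  have "cup j q \<in> arr C \<and> src C (cup j q) = Pt j q \<star> Pt (across A j q) (flip q) \<and> tgt C (cup j q) = \<I>"
  proof (cases q)
    case (Dn a)
    then show ?thesis using assms cup_down[of j a] by (simp del: zest_cup.simps)
  next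
    case (Up a)
    then show ?thesis using assms cup_up[of "j \<diamondop> iv a" a] by (simp del: zest_cup.simps)
  qed
  then show "cup j q \<in> arr C" "src C (cup j q) = Pt j q \<star> Pt (across A j q) (flip q)" "tgt C (cup j q) = \<I>"
    by auto
qed

lemma nu1_arr [simp]:
  assumes "a \<in> carrier A"
  shows "nu1 A \<zeta> a \<in> arr C" "src C (nu1 A \<zeta> a) = l a" "tgt C (nu1 A \<zeta> a) = l a" "is_iso C (nu1 A \<zeta> a)"
  using assms by (simp_all add: nu1_def lam1_def)

lemma cap_arr [simp]:
  assumes "j \<in> carrier A" "color q \<in> carrier A"
  shows "cap j q \<in> arr C" "src C (cap j q) = \<I>" "tgt C (cap j q) = Pt j q \<star> Pt (across A j q) (flip q)"
proof -
  have "cap j q \<in> arr C \<and> src C (cap j q) = \<I> \<and> tgt C (cap j q) = Pt j q \<star> Pt (across A j q) (flip q)"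
  proof (cases q)
    case (Dn a)
    then show ?thesis using assms cup_down(2)[of j a] by simp
  next
    case (Up a)
    then show ?thesis using assms cup_up(2)[of "j \<diamondop> iv a" a] by simp
  qed
  then show "cap j q \<in> arr C" "src C (cap j q) = \<I>" "tgt C (cap j q) = Pt j q \<star> Pt (across A j q) (flip q)"
    by auto
qed

text \<open>A circle has value 1: the scalars of \<nu> in cap and cup are inverse to each other, the
  two braidings cancel by \<open>dual_symmetric\<close>, and the dimension that remains is
  1.\<close>

lemma cup_cap:
  assumes "j \<in> carrier A" "color q \<in> carrier A"
  shows "cup j q \<cdot> cap j q = \<^bold>1 \<I>"
proof (cases q)
  case (Dn a)
  then have a: "a \<in> carrier A" using assms by simp
  let ?Q = "L (j \<diamondop> a) (iv a)"
  have o: "L j a \<in> obj C" "ld a \<in> obj C" "?Q \<in> obj C" using assms a by simp_all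
  have e: "L j a \<star> ?Q = l a" using cup_down(2) assms a by simp
  have f: "cap j q = inverse (n j a (iv a)) \<triangleright> ((\<beta> (ld a) (L j a) \<boxtimes> \<^bold>1 ?Q) \<cdot> coevr C (l a))"
    using Dn assms a minv_N_scalar[of j a "iv a"] ev_coevr e by (simp add: tens_id)
  have g: "cup j q = n j a (iv a) \<triangleright> (ev C (l a) \<cdot> (\<beta> (L j a) (ld a) \<boxtimes> \<^bold>1 ?Q))"
    using Dn assms a cup_down(1)[of j a] by (simp add: contract_def del: zest_cup.simps)
  have "(\<beta> (L j a) (ld a) \<boxtimes> \<^bold>1 ?Q) \<cdot> (\<beta> (ld a) (L j a) \<boxtimes> \<^bold>1 ?Q) = \<^bold>1 (ld a \<star> l a)"
    using o e dual_symmetric(2)[of j a a] assms a by (simp add: interchange' tens_id)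
  then have "(\<beta> (L j a) (ld a) \<boxtimes> \<^bold>1 ?Q) \<cdot> (\<beta> (ld a) (L j a) \<boxtimes> \<^bold>1 ?Q) \<cdot> coevr C (l a) = coevr C (l a)"
    using o e a comp_assoc'[of "coevr C (l a)" "\<beta> (ld a) (L j a) \<boxtimes> \<^bold>1 ?Q" "\<beta> (L j a) (ld a) \<boxtimes> \<^bold>1 ?Q"]
    by simp
  then show ?thesis
    unfolding f g using o e a assms ev_coevr(2)[OF a] N_scalar(2)[of j a "iv a"] by simp
next
  case (Up a)
  then have a: "a \<in> carrier A" using assms by simp
  have e: "L j (iv a) \<star> L (j \<diamondop> iv a) a = l a"
    using a assms cup_up(2)[of "j \<diamondop> iv a" a] by simp
  have f: "N j (iv a) a = n j (iv a) a \<triangleright> \<^bold>1 (l a)" "nu1 A \<zeta> a = n a (iv a) a \<triangleright> \<^bold>1 (l a)"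
    using N_scalar(1)[of j "iv a" a] N_scalar(1)[of a "iv a" a] e a assms by (simp_all add: nu1_def lam1_def)
  have "cap j q = (n a (iv a) a / n j (iv a) a) \<triangleright> coevr C (l a)"
    using Up f a assms ev_coevr(1) eps1 N_scalar(2)[of j "iv a" a] by (simp add: tens_id field_simps)
  moreover have "cup j q = (n j (iv a) a / n a (iv a) a) \<triangleright> ev C (l a)"
    using Up cup_up(1)[of "j \<diamondop> iv a" a] a assms by (simp del: zest_cup.simps)
  ultimately show ?thesis
    using a assms ev_coevr(2)[OF a] N_scalar(2)[of j "iv a" a] N_scalar(2)[of a "iv a" a] by simp
qed

text \<open>In the word \<open>Dn a\<close>, \<open>Up a\<close>, \<open>Dn a\<close> the upward
  point may be cupped off to either side. Both sides are multiples of one \<open>contract\<close>,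
  and \<open>cup_scalar\<close> matches the factors. This makes an upward cup compatible with
  absorption.\<close>

lemma cup_down_cup_up:
  assumes j: "j \<in> carrier A" and a: "a \<in> carrier A"
  shows "cup j (Dn a) \<boxtimes> \<^bold>1 (L j a) = \<^bold>1 (L j a) \<boxtimes> cup (j \<diamondop> a) (Up a)"
proof -
  let ?X = "L j a" and ?Q = "L (j \<diamondop> a) (iv a)"
  have o: "?X \<in> obj C" "?Q \<in> obj C" using j a by simp_all
  have e: "?Q \<star> ?X = l a" using cup_up(2) j a by simp
  have b: "\<beta> ?X (l a) = B j a a (iv a) \<triangleright> \<^bold>1 (?X \<star> l a)" "?X \<star> l a = l a \<star> ?X"
    using braid_scalar(1,3)[of j a a] j a by (simp_all add: lam1_def)
  \<comment> \<open>An evaluation is a \<open>contract\<close> whose first object is the unit, so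
    \<open>contract_left\<close> can carry \<open>?X\<close> across it.\<close>
  have "\<^bold>1 ?X \<boxtimes> contract \<I> (l a) (l a) \<I> = B j a a (iv a) \<triangleright> contract ?X (l a) (l a) ?X"
    using contract_left[of \<I> "l a" "l a" \<I> ?X] b o a by simp
  then have "\<^bold>1 ?X \<boxtimes> ev C (l a) = B j a a (iv a) \<triangleright> contract ?X (l a) (l a) ?X"
    using a by (simp add: contract_def tens_id)
  then have "\<^bold>1 ?X \<boxtimes> cup (j \<diamondop> a) (Up a)
      = (n (j \<diamondop> a) (iv a) a / n a (iv a) a * B j a a (iv a)) \<triangleright> contract ?X (l a) (l a) ?X"
    using cup_up(1)[OF j a] o a b by (simp del: zest_cup.simps)
  moreover have "cup j (Dn a) \<boxtimes> \<^bold>1 ?X = n j a (iv a) \<triangleright> contract ?X (l a) (l a) ?X"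
    using cup_down[OF j a] o a e contract_right[of ?X "l a" ?Q \<I> ?X] by (simp del: zest_cup.simps)
  moreover have "n (j \<diamondop> a) (iv a) a / n a (iv a) a * B j a a (iv a) = n j a (iv a)"
    using cup_scalar[OF j a] N_scalar(2)[of a "iv a" a] j a by (simp add: field_simps)
  ultimately show ?thesis by simp
qed

section \<open>Values of the crossings\<close>

lemma over_down_down:
  assumes "i \<in> carrier A" "a \<in> carrier A" "b \<in> carrier A"
  shows "X i (Dn a) (Dn b) = p i a b \<triangleright> \<^bold>1 (L i a \<star> L (i \<diamondop> a) b)"
  using phi_scalar(1)[OF assms] by simp

lemma over_down_up:
  assumes "i \<in> carrier A" "a \<in> carrier A" "b \<in> carrier A"
  shows "X i (Dn a) (Up b) = p i a (iv b) \<triangleright> (\<beta> (L i a) (ld b) \<boxtimes> \<^bold>1 (L (i \<diamondop> a) (iv b)))"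
  using assms phi_scalar(1)[of i a "iv b"] dual_symmetric(3)[of i a b] by (simp add: tens_id)

lemma over_up_down:
  assumes "i \<in> carrier A" "a \<in> carrier A" "b \<in> carrier A"
  shows "X i (Up a) (Dn b)
      = (inverse (om a (iv a) b) * p i (iv a) b) \<triangleright> (\<beta> (ld a) (L i b) \<boxtimes> \<^bold>1 (L (i \<diamondop> b) (iv a)))"
  using assms phi_scalar(1)[of i "iv a" b] L_swap[of i "iv a" b] by (simp add: tens_id)

lemma om_nonzero: "\<lbrakk>a \<in> carrier A; b \<in> carrier A\<rbrakk> \<Longrightarrow> om a (iv a) b \<noteq> 0"
  using om_inv[of a b] by auto

text \<open>Braiding everything that belongs to \<open>Up a\<close> past the dual of
  \<open>l b\<close> leaves the crossing of \<open>Up a\<close> with a downward strand of color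
  \<open>iv b\<close>. The prefactors of the two crossings match by \<open>om_inv\<close>.\<close>

lemma over_up_up:
  assumes i: "i \<in> carrier A" "a \<in> carrier A" "b \<in> carrier A"
  shows "X i (Up a) (Up b) = (\<^bold>1 (ld b) \<boxtimes> X i (Up a) (Dn (iv b)))
      \<cdot> (\<beta> (ld a \<star> L i (iv a)) (ld b) \<boxtimes> \<^bold>1 (L (i \<diamondop> iv a) (iv b)))"
proof -
  let ?P = "L i (iv a)" and ?Q = "L (i \<diamondop> iv a) (iv b)" and ?P' = "L i (iv b)" and ?Q' = "L (i \<diamondop> iv b) (iv a)"
  let ?f = "phi C A \<zeta> i (iv a) (iv b)"
  have o: "ld a \<in> obj C" "ld b \<in> obj C" "?P \<in> obj C" "?Q \<in> obj C" "?P' \<in> obj C" "?Q' \<in> obj C"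
    using i by simp_all
  have e: "?P \<star> ?Q = ?P' \<star> ?Q'" using L_swap[of i "iv b" "iv a"] i by simp
  have f: "?f \<in> arr C" "src C ?f = ?P' \<star> ?Q'" "tgt C ?f = ?P' \<star> ?Q'"
    using phi_scalar(1)[of i "iv a" "iv b"] i e by simp_all
  have 1: "\<beta> (ld a \<star> ?P) (ld b) \<boxtimes> \<^bold>1 ?Q
      = (\<beta> (ld a) (ld b) \<boxtimes> \<^bold>1 ?P \<boxtimes> \<^bold>1 ?Q) \<cdot> (\<^bold>1 (ld a) \<boxtimes> \<beta> ?P (ld b) \<boxtimes> \<^bold>1 ?Q)"
    using o by (simp add: hexagon_left whisker_right)
  have 2: "\<^bold>1 (ld b) \<boxtimes> ((\<beta> (ld a) ?P' \<boxtimes> \<^bold>1 ?Q') \<cdot> (\<^bold>1 (ld a) \<boxtimes> ?f))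
      = (\<^bold>1 (ld b) \<boxtimes> \<beta> (ld a) ?P' \<boxtimes> \<^bold>1 ?Q') \<cdot> (\<^bold>1 (ld b) \<boxtimes> \<^bold>1 (ld a) \<boxtimes> ?f)"
    using o f by (subst whisker_left) simp_all
  have 3: "inverse (om a (iv a) (iv b)) = om a (iv a) b"
    using om_inv[of a b] i by (metis inverse_unique mult.commute)
  show ?thesis unfolding zest_overL.simps 3 1 using o f e 2 by simp
qed

lemma over_arr [simp]:
  assumes i: "i \<in> carrier A" and c: "color q \<in> carrier A" "color r \<in> carrier A"
  shows "is_iso C (X i q r)" "X i q r \<in> arr C"
    "src C (X i q r) = Pt i q \<star> Pt (across A i q) r" "tgt C (X i q r) = Pt i r \<star> Pt (across A i r) q"
proof -
  have ud: "is_iso C (X i (Up a) (Dn b)) \<and> X i (Up a) (Dn b) \<in> arr C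
      \<and> src C (X i (Up a) (Dn b)) = Pt i (Up a) \<star> Pt (across A i (Up a)) (Dn b)
      \<and> tgt C (X i (Up a) (Dn b)) = Pt i (Dn b) \<star> Pt (across A i (Dn b)) (Up a)"
    if "a \<in> carrier A" "b \<in> carrier A" for a b
    using that i over_up_down[of i a b] om_nonzero[of a b] phi_scalar(3)[of i "iv a" b] L_swap[of i b "iv a"]
    by (simp del: zest_overL.simps)
  have "is_iso C (X i q r) \<and> X i q r \<in> arr C
      \<and> src C (X i q r) = Pt i q \<star> Pt (across A i q) r \<and> tgt C (X i q r) = Pt i r \<star> Pt (across A i r) q"
  proof (cases q; cases r)
    fix a b assume "q = Dn a" "r = Dn b"
    then show ?thesis
      using c i over_down_down[of i a b] phi_scalar(3)[of i a b] L_swap[of i a b]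
      by (simp del: zest_overL.simps)
  next
    fix a b assume "q = Dn a" "r = Up b"
    then show ?thesis
      using c i over_down_up[of i a b] phi_scalar(3)[of i a "iv b"] L_swap[of i a "iv b"]
      by (simp del: zest_overL.simps)
  next
    fix a b assume "q = Up a" "r = Dn b"
    then show ?thesis using c ud by simp
  next
    fix a b assume *: "q = Up a" "r = Up b"
    have o: "ld a \<in> obj C" "ld b \<in> obj C" "L i (iv a) \<in> obj C" "L (i \<diamondop> iv a) (iv b) \<in> obj C"
      using c i * by simp_all
    show ?thesis
      using * c i o over_up_up[of i a b] ud[of a "iv b"] by (simp del: zest_overL.simps)
  qed
  then show "is_iso C (X i q r)" "X i q r \<in> arr C"
    "src C (X i q r) = Pt i q \<star> Pt (across A i q) r" "tgt C (X i q r) = Pt i r \<star> Pt (across A i r) q"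
    by auto
qed

section \<open>Sliding crossings across cups\<close>

declare zest_cup.simps [simp del] zest_cap.simps [simp del] zest_overL.simps [simp del]

text \<open>Crossing and then cupping \<open>Up b\<close> off to the left equals cupping it off at
  once against a strand of color \<open>b\<close> taken right of \<open>a\<close>.
  \<open>contract_braid\<close> and \<open>contract_left\<close> turn both sides into multiples of
  \<open>?G\<close>, and \<open>phi_over_up\<close> compares the factors.\<close>

lemma slide_over_up:
  assumes j: "j \<in> carrier A" and a: "a \<in> carrier A" and b: "b \<in> carrier A"
  shows "(cup j (Dn b) \<boxtimes> \<^bold>1 (L j a)) \<cdot> (\<^bold>1 (L j b) \<boxtimes> X (j \<diamondop> b) (Dn a) (Up b))
      = inverse (p j a b) \<triangleright> (\<^bold>1 (L j a) \<boxtimes> cup (j \<diamondop> a) (Dn b))"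
proof -
  let ?a = "L j a" and ?b = "L j b" and ?ba = "L (j \<diamondop> b) a" and ?ab = "L (j \<diamondop> a) b"
  let ?Q = "L (j \<diamondop> b) (iv b)" and ?R = "L (j \<diamondop> a \<diamondop> b) (iv b)"
  have o: "?a \<in> obj C" "?b \<in> obj C" "?ba \<in> obj C" "?ab \<in> obj C" "?Q \<in> obj C" "?R \<in> obj C" "l b \<in> obj C"
    using j a b by simp_all
  have e1: "?a \<star> ?ab = ?b \<star> ?ba" using L_swap[of j b a] j a b by simp
  have jab: "j \<diamondop> b \<diamondop> a = j \<diamondop> a \<diamondop> b" using j a b by (simp add: m_ac)
  have e2: "?ba \<star> ?R = ?Q \<star> ?a"
    using L_swap[of "j \<diamondop> b" "iv b" a] j a b jab by simp
  have e3: "?b \<star> ?Q = l b" "?ab \<star> ?R = l b" using cup_down(2) j a b by simp_all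
  have e4: "?b \<star> ?ba \<star> ?R = l b \<star> ?a" using e2 e3 o tens_assoc_obj[of ?b ?Q ?a] by simp
  have b: "\<beta> ?a (l b) = B j a b (iv b) \<triangleright> \<^bold>1 (?a \<star> l b)" "?a \<star> l b = l b \<star> ?a"
    using braid_scalar(1,3)[of j a b] j a b by (simp_all add: lam1_def)
  let ?G = "contract (?b \<star> ?ba) (l b) ?R ?a"
  have G: "?G \<in> arr C" using o e4 by simp
  have "cup j (Dn b) \<boxtimes> \<^bold>1 ?a = n j b (iv b) \<triangleright> contract ?b (l b) (?ba \<star> ?R) ?a"
    using cup_down(1)[OF j \<open>b \<in> carrier A\<close>] o e2 e3 contract_right[of ?b "l b" ?Q \<I> ?a] by simp
  moreover have "\<^bold>1 ?b \<boxtimes> X (j \<diamondop> b) (Dn a) (Up b) = p (j \<diamondop> b) a (iv b) \<triangleright> (\<^bold>1 ?b \<boxtimes> \<beta> ?ba (ld b) \<boxtimes> \<^bold>1 ?R)"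
    using over_down_up[of "j \<diamondop> b" a b] j a \<open>b \<in> carrier A\<close> o jab by simp
  ultimately have 1: "(cup j (Dn b) \<boxtimes> \<^bold>1 ?a) \<cdot> (\<^bold>1 ?b \<boxtimes> X (j \<diamondop> b) (Dn a) (Up b))
      = (n j b (iv b) * p (j \<diamondop> b) a (iv b)) \<triangleright> ?G"
    using o e4 contract_braid[of ?b "l b" ?R ?ba ?a] by (simp add: mult.commute)
  have "\<^bold>1 ?a \<boxtimes> contract ?ab (l b) ?R \<I> = B j a b (iv b) \<triangleright> ?G"
    using contract_left[of ?ab "l b" ?R \<I> ?a "B j a b (iv b)"] o e1 e3 b by simp
  then have 2: "\<^bold>1 ?a \<boxtimes> cup (j \<diamondop> a) (Dn b) = (n (j \<diamondop> a) b (iv b) * B j a b (iv b)) \<triangleright> ?G"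
    using cup_down(1)[of "j \<diamondop> a" b] j a \<open>b \<in> carrier A\<close> o e3 smul_smul'[OF G] by simp
  have "n j b (iv b) * p (j \<diamondop> b) a (iv b) = inverse (p j a b) * (n (j \<diamondop> a) b (iv b) * B j a b (iv b))"
    using phi_over_up[OF j a \<open>b \<in> carrier A\<close>] phi_scalar(3)[OF j a \<open>b \<in> carrier A\<close>]
    by (simp add: field_simps)
  then show ?thesis unfolding 1 2 smul_smul'[OF G] by simp
qed

text \<open>Same scheme as \<open>slide_over_up\<close>, with the cup now on the over-strand. The
  crossing braids in the opposite direction, so \<open>contract_unbraid\<close> is used;
  \<open>phi_under_up\<close> supplies the scalar and absorbs the \<omega> of the crossing.\<close>

lemma slide_under_down:
  assumes j: "j \<in> carrier A" and a: "a \<in> carrier A" and b: "b \<in> carrier A"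
  shows "(\<^bold>1 (L j b) \<boxtimes> cup (j \<diamondop> b) (Dn a)) \<cdot> (\<^bold>1 (L j a) \<boxtimes> X (j \<diamondop> a) (Up a) (Dn b))
      = inverse (p j a b) \<triangleright> (cup j (Dn a) \<boxtimes> \<^bold>1 (L j b))"
proof -
  let ?a = "L j a" and ?b = "L j b" and ?ba = "L (j \<diamondop> b) a" and ?ab = "L (j \<diamondop> a) b"
  let ?Q = "L (j \<diamondop> a) (iv a)" and ?R = "L (j \<diamondop> a \<diamondop> b) (iv a)"
  have o: "?a \<in> obj C" "?b \<in> obj C" "?ba \<in> obj C" "?ab \<in> obj C" "?Q \<in> obj C" "?R \<in> obj C" "l a \<in> obj C"
    using j a b by simp_all
  have e1: "?b \<star> ?ba = ?a \<star> ?ab" using L_swap[of j a b] j a b by simp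
  have jab: "j \<diamondop> b \<diamondop> a = j \<diamondop> a \<diamondop> b" using j a b by (simp add: m_ac)
  have e2: "?ab \<star> ?R = ?Q \<star> ?b"
    using L_swap[of "j \<diamondop> a" "iv a" b] j a b by simp
  have e3: "?a \<star> ?Q = l a" "?ba \<star> ?R = l a" using cup_down(2)[of j a] cup_down(2)[of "j \<diamondop> b" a] j a b jab by simp_all
  have e4: "?a \<star> ?ab \<star> ?R = l a \<star> ?b" using e2 e3 o tens_assoc_obj[of ?a ?Q ?b] by simp
  have s: "\<beta> ?b (l a) = B j b a (iv a) \<triangleright> \<^bold>1 (?b \<star> l a)" "?b \<star> l a = l a \<star> ?b"
    using braid_scalar(1,3)[of j b a] j a b by (simp_all add: lam1_def)
  let ?G = "contract ?a (l a) (?ab \<star> ?R) ?b"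
  have G: "?G \<in> arr C" using o e4 by simp
  let ?G' = "contract (?a \<star> ?ab) (l a) ?R ?b"
  have G': "?G' \<in> arr C" using o e4 by simp
  have "\<^bold>1 ?b \<boxtimes> contract ?ba (l a) ?R \<I> = B j b a (iv a) \<triangleright> ?G'"
    using contract_left[of ?ba "l a" ?R \<I> ?b "B j b a (iv a)"] o e1 e3 s by simp
  then have "\<^bold>1 ?b \<boxtimes> cup (j \<diamondop> b) (Dn a) = (n (j \<diamondop> b) a (iv a) * B j b a (iv a)) \<triangleright> ?G'"
    using cup_down(1)[of "j \<diamondop> b" a] j a b o e3 jab smul_smul'[OF G'] by simp
  moreover have "\<^bold>1 ?a \<boxtimes> X (j \<diamondop> a) (Up a) (Dn b)
      = (inverse (om a (iv a) b) * p (j \<diamondop> a) (iv a) b) \<triangleright> (\<^bold>1 ?a \<boxtimes> \<beta> (ld a) ?ab \<boxtimes> \<^bold>1 ?R)"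
    using over_up_down[of "j \<diamondop> a" a b] j a b o by simp
  ultimately have 1: "(\<^bold>1 ?b \<boxtimes> cup (j \<diamondop> b) (Dn a)) \<cdot> (\<^bold>1 ?a \<boxtimes> X (j \<diamondop> a) (Up a) (Dn b))
      = (n (j \<diamondop> b) a (iv a) * B j b a (iv a) * (inverse (om a (iv a) b) * p (j \<diamondop> a) (iv a) b)) \<triangleright> ?G"
    using o e4 contract_unbraid[of ?a "l a" ?R ?ab ?b] dual_symmetric(2)[of "j \<diamondop> a" b a] j a b
    by (simp add: mult.commute)
  have 2: "cup j (Dn a) \<boxtimes> \<^bold>1 ?b = n j a (iv a) \<triangleright> ?G"
    using cup_down(1)[OF j a] o e2 e3 contract_right[of ?a "l a" ?Q \<I> ?b] by simp
  have "n (j \<diamondop> b) a (iv a) * B j b a (iv a) * (inverse (om a (iv a) b) * p (j \<diamondop> a) (iv a) b)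
      = inverse (p j a b) * n j a (iv a)"
    using phi_under_up[OF j a b] phi_scalar(3)[OF j a b] om_nonzero[OF a b]
    by (simp add: field_simps)
  then show ?thesis unfolding 1 2 smul_smul'[OF G] by simp
qed

text \<open>\<open>braid_past_dual\<close> strips off the dual of \<open>l b\<close>. What remains
  is \<open>slide_under_down\<close> with color \<open>iv b\<close>, whose scalar cancels against
  that of the crossing of \<open>Dn a\<close> with \<open>Up b\<close>, so no weight is
  left.\<close>

lemma slide_under_up:
  assumes k: "k \<in> carrier A" and a: "a \<in> carrier A" and b: "b \<in> carrier A"
  shows "(\<^bold>1 (Pt k (Up b)) \<boxtimes> cup (k \<diamondop> iv b) (Dn a))
      \<cdot> (X k (Dn a) (Up b) \<boxtimes> \<^bold>1 (Pt (k \<diamondop> iv b \<diamondop> a) (Up a)))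
      \<cdot> (\<^bold>1 (L k a) \<boxtimes> X (k \<diamondop> a) (Up a) (Up b))
      = cup k (Dn a) \<boxtimes> \<^bold>1 (Pt k (Up b))"
proof -
  have kba: "k \<diamondop> iv b \<diamondop> a = k \<diamondop> a \<diamondop> iv b" using k a b by (simp add: m_ac)
  let ?D = "ld b" and ?P = "L k a" and ?S = "Pt (k \<diamondop> a) (Up a)" and ?R = "L (k \<diamondop> a) (iv b)"
    and ?T = "Pt (k \<diamondop> a \<diamondop> iv b) (Up a)" and ?M = "L k (iv b)"
    and ?Y = "X (k \<diamondop> a) (Up a) (Dn (iv b))" and ?c = "cup k (Dn a)"
    and ?d = "cup (k \<diamondop> iv b) (Dn a)"
  have o: "?D \<in> obj C" "?P \<in> obj C" "?S \<in> obj C" "?R \<in> obj C" "?T \<in> obj C" "?M \<in> obj C"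
    using k a b by (simp_all del: zest_point.simps)
  have e: "?M \<star> L (k \<diamondop> iv b) a = ?P \<star> ?R" using L_swap[of k a "iv b"] k a b by simp
  have Y: "?Y \<in> arr C" "src C ?Y = ?S \<star> ?M" "tgt C ?Y = ?R \<star> ?T"
    using k a b by simp_all
  have c: "?c \<in> arr C" "src C ?c = ?P \<star> ?S" "tgt C ?c = \<I>" using k a by simp_all
  have Z: "\<^bold>1 ?M \<boxtimes> ?d \<in> arr C" "src C (\<^bold>1 ?M \<boxtimes> ?d) = ?P \<star> ?R \<star> ?T" "tgt C (\<^bold>1 ?M \<boxtimes> ?d) = ?M"
    using k a b kba e o tens_assoc_obj[of ?M "L (k \<diamondop> iv b) a" ?T] by (simp_all del: tens_assoc)
  have dd: "?d \<in> arr C" using k a b by simp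
  have 1: "X k (Dn a) (Up b) = p k a (iv b) \<triangleright> (\<beta> ?P ?D \<boxtimes> \<^bold>1 ?R)"
    using over_down_up k a b by simp
  have 2: "X (k \<diamondop> a) (Up a) (Up b) = (\<^bold>1 ?D \<boxtimes> ?Y) \<cdot> (\<beta> ?S ?D \<boxtimes> \<^bold>1 ?M)"
    using over_up_up[of "k \<diamondop> a" a b] k a b by simp
  have 3: "(\<^bold>1 ?M \<boxtimes> ?d) \<cdot> (\<^bold>1 ?P \<boxtimes> ?Y) = inverse (p k a (iv b)) \<triangleright> (?c \<boxtimes> \<^bold>1 ?M)"
    using slide_under_down[of k a "iv b"] k a b by simp
  have 4: "(\<^bold>1 ?D \<boxtimes> (\<^bold>1 ?M \<boxtimes> ?d)) \<cdot> (\<beta> ?P ?D \<boxtimes> \<^bold>1 (?R \<star> ?T)) \<cdot> (\<^bold>1 ?P \<boxtimes> ((\<^bold>1 ?D \<boxtimes> ?Y) \<cdot> (\<beta> ?S ?D \<boxtimes> \<^bold>1 ?M)))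
      = inverse (p k a (iv b)) \<triangleright> (?c \<boxtimes> \<^bold>1 (?D \<star> ?M))"
    by (rule braid_past_dual) (use o Y c Z 3 in simp_all)
  have 5: "\<^bold>1 (Pt k (Up b)) \<boxtimes> ?d = \<^bold>1 ?D \<boxtimes> (\<^bold>1 ?M \<boxtimes> ?d)" using o dd by (simp add: tens_id[symmetric])
  have 6: "X k (Dn a) (Up b) \<boxtimes> \<^bold>1 (Pt (k \<diamondop> iv b \<diamondop> a) (Up a)) = p k a (iv b) \<triangleright> (\<beta> ?P ?D \<boxtimes> \<^bold>1 (?R \<star> ?T))"
    unfolding 1 kba using o by (simp add: tens_id)
  have t: "(\<beta> ?P ?D \<boxtimes> \<^bold>1 (?R \<star> ?T)) \<in> arr C" "src C (\<beta> ?P ?D \<boxtimes> \<^bold>1 (?R \<star> ?T)) = ?P \<star> ?D \<star> ?R \<star> ?T"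
      "tgt C (\<beta> ?P ?D \<boxtimes> \<^bold>1 (?R \<star> ?T)) = ?D \<star> ?P \<star> ?R \<star> ?T"
    using o by (simp_all del: zest_point.simps)
  have u: "\<^bold>1 ?P \<boxtimes> ((\<^bold>1 ?D \<boxtimes> ?Y) \<cdot> (\<beta> ?S ?D \<boxtimes> \<^bold>1 ?M)) \<in> arr C"
      "tgt C (\<^bold>1 ?P \<boxtimes> ((\<^bold>1 ?D \<boxtimes> ?Y) \<cdot> (\<beta> ?S ?D \<boxtimes> \<^bold>1 ?M))) = ?P \<star> ?D \<star> ?R \<star> ?T"
    using o Y by (simp_all del: zest_point.simps)
  have v: "\<^bold>1 ?D \<boxtimes> (\<^bold>1 ?M \<boxtimes> ?d) \<in> arr C" "src C (\<^bold>1 ?D \<boxtimes> (\<^bold>1 ?M \<boxtimes> ?d)) = ?D \<star> ?P \<star> ?R \<star> ?T"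
    using Z o by simp_all
  have "(\<^bold>1 (Pt k (Up b)) \<boxtimes> ?d) \<cdot> (X k (Dn a) (Up b) \<boxtimes> \<^bold>1 (Pt (k \<diamondop> iv b \<diamondop> a) (Up a)))
      \<cdot> (\<^bold>1 ?P \<boxtimes> X (k \<diamondop> a) (Up a) (Up b))
    = p k a (iv b) \<triangleright> ((\<^bold>1 ?D \<boxtimes> (\<^bold>1 ?M \<boxtimes> ?d)) \<cdot> (\<beta> ?P ?D \<boxtimes> \<^bold>1 (?R \<star> ?T)) \<cdot> (\<^bold>1 ?P \<boxtimes> ((\<^bold>1 ?D \<boxtimes> ?Y) \<cdot> (\<beta> ?S ?D \<boxtimes> \<^bold>1 ?M))))"
    unfolding 5 6 2 using t u v by (simp del: tens_arr tens_assoc)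
  also have "\<dots> = ?c \<boxtimes> \<^bold>1 (?D \<star> ?M)"
    unfolding 4 using phi_scalar(3)[of k a "iv b"] k a b c o by (simp del: zest_point.simps)
  finally show ?thesis by simp
qed

text \<open>\<open>slide_over_up\<close>, read backwards, replaces the cup of \<open>b\<close> by
  one further left, at the cost of \<open>p j a b\<close> and a crossing of \<open>Dn a\<close> with
  \<open>Up b\<close>. This crossing and the given one are the two that
  \<open>slide_under_up\<close> removes.\<close>

lemma slide_over_up_up:
  assumes j: "j \<in> carrier A" and a: "a \<in> carrier A" and b: "b \<in> carrier A"
  shows "cup j (Dn a) \<cdot> (\<^bold>1 (L j a) \<boxtimes> cup (j \<diamondop> a) (Dn b) \<boxtimes> \<^bold>1 (Pt (j \<diamondop> a) (Up a)))
        \<cdot> (\<^bold>1 (L j b \<star> L (j \<diamondop> b) a) \<boxtimes> X (j \<diamondop> b \<diamondop> a) (Up a) (Up b))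
      = p j a b \<triangleright> (cup j (Dn b) \<cdot> (\<^bold>1 (L j b) \<boxtimes> cup (j \<diamondop> b) (Dn a) \<boxtimes> \<^bold>1 (Pt (j \<diamondop> b) (Up b))))"
proof -
  have jab: "j \<diamondop> b \<diamondop> a = j \<diamondop> a \<diamondop> b" using j a b by (simp add: m_ac)
  have jaba: "j \<diamondop> a \<diamondop> b \<diamondop> iv a = j \<diamondop> b" using jab j a b inv_mult_cancel(1)[of "j \<diamondop> b" a] by simp
  let ?a = "L j a" and ?b = "L j b" and ?ba = "L (j \<diamondop> b) a" and ?ab = "L (j \<diamondop> a) b"
    and ?A = "Pt (j \<diamondop> a) (Up a)" and ?B = "Pt (j \<diamondop> b) (Up b)"
    and ?B' = "Pt (j \<diamondop> a \<diamondop> b) (Up b)" and ?A' = "Pt (j \<diamondop> b \<diamondop> a) (Up a)"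
    and ?f = "X (j \<diamondop> b) (Dn a) (Up b)" and ?g = "X (j \<diamondop> b \<diamondop> a) (Up a) (Up b)"
  have o: "?a \<in> obj C" "?b \<in> obj C" "?ba \<in> obj C" "?ab \<in> obj C" "?A \<in> obj C" "?B \<in> obj C"
      "?A' \<in> obj C" "?B' \<in> obj C"
    using j a b by (simp_all del: zest_point.simps)
  have c: "cup j (Dn a) \<in> arr C" "src C (cup j (Dn a)) = ?a \<star> ?A" "tgt C (cup j (Dn a)) = \<I>"
      "cup j (Dn b) \<in> arr C" "src C (cup j (Dn b)) = ?b \<star> ?B" "tgt C (cup j (Dn b)) = \<I>"
    using j a b by (simp_all)
  have f: "?f \<in> arr C" "src C ?f = ?ba \<star> ?B'" "tgt C ?f = ?B \<star> ?a"
    using j a b jab by simp_all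
  have g: "?g \<in> arr C" "src C ?g = ?A' \<star> ?B" "tgt C ?g = ?B' \<star> ?A"
    using j a b jab jaba by simp_all
  have "\<^bold>1 ?a \<boxtimes> cup (j \<diamondop> a) (Dn b) = p j a b \<triangleright> ((cup j (Dn b) \<boxtimes> \<^bold>1 ?a) \<cdot> (\<^bold>1 ?b \<boxtimes> ?f))"
    unfolding slide_over_up[OF j a b] using phi_scalar(3)[OF j a b] j a b by simp
  then have 1: "\<^bold>1 ?a \<boxtimes> cup (j \<diamondop> a) (Dn b) \<boxtimes> \<^bold>1 ?A
      = p j a b \<triangleright> ((cup j (Dn b) \<boxtimes> \<^bold>1 (?a \<star> ?A)) \<cdot> (\<^bold>1 ?b \<boxtimes> ?f \<boxtimes> \<^bold>1 ?A))"
    using o c f j a b tens_assoc[of "\<^bold>1 ?a" "cup (j \<diamondop> a) (Dn b)" "\<^bold>1 ?A"]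
    by (simp add: whisker_right tens_id del: tens_assoc zest_point.simps) (simp add: tens_id del: zest_point.simps)
  \<comment> \<open>The two cups lie side by side, so they can be taken in either order.\<close>
  have 2: "cup j (Dn a) \<cdot> (cup j (Dn b) \<boxtimes> \<^bold>1 (?a \<star> ?A)) = cup j (Dn b) \<cdot> (\<^bold>1 (?b \<star> ?B) \<boxtimes> cup j (Dn a))"
    using slide[of "cup j (Dn b)" "cup j (Dn a)" "?b \<star> ?B" \<I> "?a \<star> ?A" \<I>] c by (simp del: zest_point.simps)
  have 3: "(\<^bold>1 ?B \<boxtimes> cup j (Dn a)) \<cdot> (?f \<boxtimes> \<^bold>1 ?A) \<cdot> (\<^bold>1 ?ba \<boxtimes> ?g) = cup (j \<diamondop> b) (Dn a) \<boxtimes> \<^bold>1 ?B"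
    using slide_under_up[of "j \<diamondop> b" a b] j a b by (simp del: zest_point.simps)
  have 4: "\<^bold>1 (?b \<star> ?ba) \<boxtimes> ?g = \<^bold>1 ?b \<boxtimes> \<^bold>1 ?ba \<boxtimes> ?g" "\<^bold>1 (?b \<star> ?B) \<boxtimes> cup j (Dn a) = \<^bold>1 ?b \<boxtimes> \<^bold>1 ?B \<boxtimes> cup j (Dn a)"
    using o c g by (simp_all add: tens_id[symmetric] del: zest_point.simps)
  have "cup j (Dn a) \<cdot> (\<^bold>1 ?a \<boxtimes> cup (j \<diamondop> a) (Dn b) \<boxtimes> \<^bold>1 ?A) \<cdot> (\<^bold>1 (?b \<star> ?ba) \<boxtimes> ?g)
      = p j a b \<triangleright> ((cup j (Dn a) \<cdot> (cup j (Dn b) \<boxtimes> \<^bold>1 (?a \<star> ?A))) \<cdot> (\<^bold>1 ?b \<boxtimes> ?f \<boxtimes> \<^bold>1 ?A) \<cdot> (\<^bold>1 (?b \<star> ?ba) \<boxtimes> ?g))"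
    unfolding 1 using o c f g by (simp del: zest_point.simps)
  also have "\<dots> = p j a b \<triangleright> (cup j (Dn b) \<cdot> (\<^bold>1 ?b \<boxtimes> ((\<^bold>1 ?B \<boxtimes> cup j (Dn a)) \<cdot> (?f \<boxtimes> \<^bold>1 ?A) \<cdot> (\<^bold>1 ?ba \<boxtimes> ?g))))"
    unfolding 2 4 using o c f g by (simp add: whisker_left del: zest_point.simps)
  finally show ?thesis unfolding 3 .
qed

end

subsection \<open>Absorbing boundary words into a stack of strands\<close>

text \<open>The head of the list is the rightmost strand, next to the word to be absorbed. If the
  color \<open>a\<close> is absent, \<open>remove1\<close> leaves the list unchanged;
  \<open>pushable\<close> excludes this case.\<close>

primrec push :: "'a list \<Rightarrow> 'a point \<Rightarrow> 'a list" where
  "push xs (Dn a) = a # xs"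
| "push xs (Up a) = remove1 a xs"

primrec pushable :: "'a list \<Rightarrow> 'a point list \<Rightarrow> bool" where
  "pushable xs [] = True"
| "pushable xs (q # w) = ((\<forall>a. q = Up a \<longrightarrow> a \<in> set xs) \<and> pushable (push xs q) w)"

text \<open>A generous bound on the strands needed per color. It is additive on \<open>Juxt\<close>,
  since the upper boundary of the left factor may consume strands before the right factor is
  absorbed, and 2 on a crossing, since both its points may be upward and of one color.\<close>

primrec width :: "'a tangle \<Rightarrow> nat" where
  "width Empty = 0"
| "width (Strand q) = 1"
| "width (OverL q r) = 2"
| "width (OverR q r) = 2"
| "width (Cap q) = 2"
| "width (Cup q) = 2"
| "width (Stack S T) = width S + width T"
| "width (Juxt S T) = width S + width T"

lemma length_boundary_le_width: "length (upper T) \<le> width T" "length (lower T) \<le> width T"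
  by (induction T) auto

lemma mset_cons_remove1: "a \<in> set xs \<Longrightarrow> mset xs = mset (a # remove1 a xs)"
  by simp

lemma mset_push: "mset xs = mset ys \<Longrightarrow> mset (push xs q) = mset (push ys q)"
  by (cases q) auto

lemma mset_pushes: "mset xs = mset ys \<Longrightarrow> mset (foldl push xs w) = mset (foldl push ys w)"
proof (induction w arbitrary: xs ys)
  case (Cons q w)
  show ?case using Cons.IH[OF mset_push[OF Cons.prems]] by simp
qed simp

lemma count_push: "count (mset xs) c \<le> count (mset (push xs q)) c + 1"
  by (cases q) auto

lemma count_pushes: "count (mset xs) c \<le> count (mset (foldl push xs w)) c + length w"
proof (induction w arbitrary: xs)
  case (Cons q w)
  show ?case using count_push[of xs c q] Cons.IH[of "push xs q"] by simp
qed simp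

lemma pushable_append: "pushable xs (v @ w) \<longleftrightarrow> pushable xs v \<and> pushable (foldl push xs v) w"
  by (induction v arbitrary: xs) auto

lemma pushable_if_count:
  "\<lbrakk>\<forall>c\<in>S. length w \<le> count (mset xs) c; color ` set w \<subseteq> S\<rbrakk> \<Longrightarrow> pushable xs w"
proof (induction w arbitrary: xs)
  case (Cons q w)
  have "length w \<le> count (mset (push xs q)) c" if "c \<in> S" for c
    using Cons.prems(1) that count_push[of xs c q] by fastforce
  moreover have "a \<in> set xs" if "q = Up a" for a
    using Cons.prems that by (metis Suc_le_lessD count_greater_zero_iff image_subset_iff le_zero_eq length_Cons
        list.set_intros(1) not_less_eq_eq point.sel(2) set_mset_mset zero_less_Suc order_less_le_trans)
  ultimately show ?case using Cons by auto
qed simp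

lemma mset_push_commute:
  "\<lbrakk>color q \<in># mset xs; color r \<in># mset xs; color q = color r \<Longrightarrow> 2 \<le> count (mset xs) (color q)\<rbrakk>
    \<Longrightarrow> mset (push (push xs q) r) = mset (push (push xs r) q)"
  by (cases q; cases r) (auto intro!: multiset_eqI simp: not_in_iff count_eq_zero_iff)

text \<open>The step for juxtaposition: by interchange, absorbing the left word commutes with
  \<open>t\<close>, so the relations \<open>1\<close> for \<open>s\<close> and \<open>2\<close> for
  \<open>t\<close> can be applied one after the other and their scalars multiply.\<close>

lemma (in strict_monoidal_category) interleave:
  assumes s: "s \<in> arr C" "src C s = u" "tgt C s = l" and t: "t \<in> arr C" "src C t = v" "tgt C t = m"
    and k1: "k1 \<in> arr C" "src C k1 = F \<star> l" "tgt C k1 = G"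
    and k1': "k1' \<in> arr C" "src C k1' = F \<star> u" "tgt C k1' = G"
    and k2: "k2 \<in> arr C" "src C k2 = G \<star> m" and k2': "k2' \<in> arr C" "src C k2' = G \<star> v"
    and F: "F \<in> obj C"
    and 1: "k1 \<cdot> (\<^bold>1 F \<boxtimes> s) = c \<triangleright> k1'" and 2: "k2 \<cdot> (\<^bold>1 G \<boxtimes> t) = d \<triangleright> k2'"
  shows "(k2 \<cdot> (k1 \<boxtimes> \<^bold>1 m)) \<cdot> (\<^bold>1 F \<boxtimes> s \<boxtimes> t) = (c * d) \<triangleright> (k2' \<cdot> (k1' \<boxtimes> \<^bold>1 v))"
proof -
  have o: "u \<in> obj C" "l \<in> obj C" "v \<in> obj C" "m \<in> obj C" "G \<in> obj C"
    using s t k1 by auto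
  have "(\<^bold>1 F \<boxtimes> s) \<boxtimes> t = ((\<^bold>1 F \<boxtimes> s) \<boxtimes> \<^bold>1 m) \<cdot> (\<^bold>1 (F \<star> u) \<boxtimes> t)"
    by (rule slide(1)[symmetric]) (use s t F in simp_all)
  then have "(k2 \<cdot> (k1 \<boxtimes> \<^bold>1 m)) \<cdot> (\<^bold>1 F \<boxtimes> s \<boxtimes> t)
      = k2 \<cdot> ((k1 \<cdot> (\<^bold>1 F \<boxtimes> s)) \<boxtimes> \<^bold>1 m) \<cdot> (\<^bold>1 (F \<star> u) \<boxtimes> t)"
    using s t k1 k2 F o by (simp add: whisker_right)
  also have "\<dots> = c \<triangleright> (k2 \<cdot> ((k1' \<boxtimes> \<^bold>1 m) \<cdot> (\<^bold>1 (F \<star> u) \<boxtimes> t)))"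
    unfolding 1 using t k1' k2 F o by simp
  also have "(k1' \<boxtimes> \<^bold>1 m) \<cdot> (\<^bold>1 (F \<star> u) \<boxtimes> t) = (\<^bold>1 G \<boxtimes> t) \<cdot> (k1' \<boxtimes> \<^bold>1 v)"
    using slide[of k1' t "F \<star> u" G v m] k1' t by simp
  also have "k2 \<cdot> ((\<^bold>1 G \<boxtimes> t) \<cdot> (k1' \<boxtimes> \<^bold>1 v)) = (k2 \<cdot> (\<^bold>1 G \<boxtimes> t)) \<cdot> (k1' \<boxtimes> \<^bold>1 v)"
    using t k1' k2 o by simp
  finally show ?thesis unfolding 2 using k1' k2' o by simp
qed

context unit_dim_zesting
begin

primrec reg where
  "reg [] = eA"
| "reg (a # xs) = reg xs \<diamondop> a"

primrec strands where
  "strands [] = \<I>"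
| "strands (a # xs) = strands xs \<star> L (reg xs) a"

primrec word where
  "word i [] = \<I>"
| "word i (q # w) = Pt i q \<star> word (across A i q) w"

text \<open>For an upward point a strand of its color is regarded as the last one of the stack,
  which is legitimate by \<open>remove1_strands\<close>; hence the cup has the base color of the
  remaining stack.\<close>

primrec absorb_point where
  "absorb_point xs (Dn a) = \<^bold>1 (strands (a # xs))"
| "absorb_point xs (Up a) = \<^bold>1 (strands (remove1 a xs)) \<boxtimes> cup (reg (remove1 a xs)) (Dn a)"

primrec absorb where
  "absorb xs [] = \<^bold>1 (strands xs)"
| "absorb xs (q # w) = absorb (push xs q) w \<cdot> (absorb_point xs q \<boxtimes> \<^bold>1 (word (across A (reg xs) q) w))"

lemma reg_closed [simp]: "set xs \<subseteq> carrier A \<Longrightarrow> reg xs \<in> carrier A"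
  by (induction xs) auto

lemma strands_invertible: "set xs \<subseteq> carrier A \<Longrightarrow> invertible C (strands xs)"
  by (induction xs) (auto intro!: invertible_tens invertible_unit)

lemma strands_obj [simp]: "set xs \<subseteq> carrier A \<Longrightarrow> strands xs \<in> obj C"
  using strands_invertible invertible_obj by blast

lemma across_closed [simp]: "\<lbrakk>i \<in> carrier A; color q \<in> carrier A\<rbrakk> \<Longrightarrow> across A i q \<in> carrier A"
  by (cases q) auto

lemma acrosses_closed [simp]:
  "\<lbrakk>i \<in> carrier A; color ` set w \<subseteq> carrier A\<rbrakk> \<Longrightarrow> foldl (across A) i w \<in> carrier A"
  by (induction w arbitrary: i) auto

lemma across_commute:
  "\<lbrakk>i \<in> carrier A; color q \<in> carrier A; color r \<in> carrier A\<rbrakk>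
    \<Longrightarrow> across A (across A i q) r = across A (across A i r) q"
  by (cases q; cases r) (simp_all add: m_ac)

lemma across_flip [simp]:
  "\<lbrakk>i \<in> carrier A; color q \<in> carrier A\<rbrakk> \<Longrightarrow> across A (across A i q) (flip q) = i"
  by (cases q) simp_all

lemma color_flip [simp]: "color (flip q) = color q"
  by (cases q) simp_all

lemma word_obj [simp]: "\<lbrakk>i \<in> carrier A; color ` set w \<subseteq> carrier A\<rbrakk> \<Longrightarrow> word i w \<in> obj C"
  by (induction w arbitrary: i) auto

lemma word_append:
  "\<lbrakk>i \<in> carrier A; color ` set v \<subseteq> carrier A; color ` set w \<subseteq> carrier A\<rbrakk>
    \<Longrightarrow> word i (v @ w) = word i v \<star> word (foldl (across A) i v) w"
  by (induction v arbitrary: i) auto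

lemma set_remove1: "set xs \<subseteq> S \<Longrightarrow> set (remove1 a xs) \<subseteq> S"
  using set_remove1_subset[of a xs] by blast

lemma set_push [simp]: "\<lbrakk>set xs \<subseteq> carrier A; color q \<in> carrier A\<rbrakk> \<Longrightarrow> set (push xs q) \<subseteq> carrier A"
  by (cases q) (simp_all add: set_remove1)

lemma set_pushes [simp]:
  "\<lbrakk>set xs \<subseteq> carrier A; color ` set w \<subseteq> carrier A\<rbrakk> \<Longrightarrow> set (foldl push xs w) \<subseteq> carrier A"
proof (induction w arbitrary: xs)
  case (Cons q w)
  then show ?case using Cons.IH[of "push xs q"] by simp
qed simp

lemma remove1_hd: "remove1 a (a # xs) = xs"
  by simp

text \<open>Repeated use of \<open>L_swap\<close> moves a strand of color \<open>a\<close> to the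
  right end of the stack without changing the object.\<close>

lemma remove1_strands:
  assumes "a \<in> set xs" "set xs \<subseteq> carrier A"
  shows "reg xs = reg (remove1 a xs) \<diamondop> a"
    "strands xs = strands (remove1 a xs) \<star> L (reg (remove1 a xs)) a"
proof -
  have "reg xs = reg (remove1 a xs) \<diamondop> a \<and> strands xs = strands (remove1 a xs) \<star> L (reg (remove1 a xs)) a"
    using assms
  proof (induction xs)
    case (Cons x xs)
    show ?case
    proof (cases "x = a")
      case False
      then have IH: "reg xs = reg (remove1 a xs) \<diamondop> a"
          "strands xs = strands (remove1 a xs) \<star> L (reg (remove1 a xs)) a"
        using Cons by auto
      have c: "a \<in> carrier A" "x \<in> carrier A" "set (remove1 a xs) \<subseteq> carrier A"
        using Cons.prems by (auto simp: set_remove1)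
      have "L (reg (remove1 a xs)) a \<star> L (reg (remove1 a xs) \<diamondop> a) x
          = L (reg (remove1 a xs)) x \<star> L (reg (remove1 a xs) \<diamondop> x) a"
        using c by (intro L_swap) simp_all
      then show ?thesis using IH c False by (simp add: m_ac)
    qed simp
  qed simp
  then show "reg xs = reg (remove1 a xs) \<diamondop> a"
    "strands xs = strands (remove1 a xs) \<star> L (reg (remove1 a xs)) a" by auto
qed

lemma strands_mset:
  "\<lbrakk>mset xs = mset ys; set xs \<subseteq> carrier A\<rbrakk> \<Longrightarrow> reg xs = reg ys \<and> strands xs = strands ys"
proof (induction xs arbitrary: ys)
  case (Cons x xs)
  have s: "set ys = set (x # xs)" using Cons.prems(1) by (metis mset_eq_setD)
  have "mset xs = mset (remove1 x ys)" using Cons.prems(1)[symmetric] by simp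
  then have "reg xs = reg (remove1 x ys) \<and> strands xs = strands (remove1 x ys)"
    using Cons.IH Cons.prems(2) by simp
  then show ?case using remove1_strands[of x ys] s Cons.prems(2) by simp
qed simp

lemma reg_push:
  "\<lbrakk>pushable xs [q]; set xs \<subseteq> carrier A; color q \<in> carrier A\<rbrakk> \<Longrightarrow> reg (push xs q) = across A (reg xs) q"
  using remove1_strands(1)[of "color q" xs] by (cases q) (auto simp: set_remove1)

lemma reg_pushes:
  "\<lbrakk>pushable xs w; set xs \<subseteq> carrier A; color ` set w \<subseteq> carrier A\<rbrakk>
    \<Longrightarrow> reg (foldl push xs w) = foldl (across A) (reg xs) w"
proof (induction w arbitrary: xs)
  case (Cons q w)
  then show ?case using reg_push[of xs q] Cons.IH[of "push xs q"] by simp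
qed simp

lemma absorb_point_arr [simp]:
  assumes "pushable xs [q]" "set xs \<subseteq> carrier A" "color q \<in> carrier A"
  shows "absorb_point xs q \<in> arr C" "src C (absorb_point xs q) = strands xs \<star> Pt (reg xs) q"
    "tgt C (absorb_point xs q) = strands (push xs q)"
proof -
  have "absorb_point xs q \<in> arr C \<and> src C (absorb_point xs q) = strands xs \<star> Pt (reg xs) q
    \<and> tgt C (absorb_point xs q) = strands (push xs q)"
  proof (cases q)
    case (Up a)
    then show ?thesis
      using assms remove1_strands[of a xs] set_remove1[of xs "carrier A" a] by simp
  qed (use assms in simp)
  then show "absorb_point xs q \<in> arr C" "src C (absorb_point xs q) = strands xs \<star> Pt (reg xs) q"
    "tgt C (absorb_point xs q) = strands (push xs q)" by auto
qed

lemma absorb_arr: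
  "\<lbrakk>pushable xs w; set xs \<subseteq> carrier A; color ` set w \<subseteq> carrier A\<rbrakk>
    \<Longrightarrow> absorb xs w \<in> arr C \<and> src C (absorb xs w) = strands xs \<star> word (reg xs) w
      \<and> tgt C (absorb xs w) = strands (foldl push xs w)"
proof (induction w arbitrary: xs)
  case (Cons q w)
  then show ?case
    using reg_push[of xs q] Cons.IH[of "push xs q"] absorb_point_arr[of xs q] by simp
qed simp

lemma absorb_append:
  "\<lbrakk>pushable xs (v @ w); set xs \<subseteq> carrier A; color ` set v \<subseteq> carrier A; color ` set w \<subseteq> carrier A\<rbrakk>
    \<Longrightarrow> absorb xs (v @ w) = absorb (foldl push xs v) w \<cdot> (absorb xs v \<boxtimes> \<^bold>1 (word (foldl (across A) (reg xs) v) w))"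
proof (induction v arbitrary: xs)
  case Nil
  then show ?case using absorb_arr[of xs w] by (simp add: tens_id)
next
  case (Cons q v)
  let ?xs = "push xs q" and ?i = "across A (reg xs) q"
  have c: "set ?xs \<subseteq> carrier A" "pushable ?xs (v @ w)" "pushable xs [q]" "color q \<in> carrier A"
      "color ` set v \<subseteq> carrier A" "pushable ?xs v" "pushable (foldl push ?xs v) w" "set xs \<subseteq> carrier A"
    using Cons.prems by (auto simp: pushable_append)
  have r: "reg ?xs = ?i" "?i \<in> carrier A" using reg_push c by simp_all
  let ?j = "foldl (across A) ?i v"
  have j: "?j \<in> carrier A" "reg (foldl push ?xs v) = ?j"
    using c r reg_pushes[of ?xs v] acrosses_closed[of ?i v] by simp_all
  have f: "absorb ?xs v \<in> arr C" "src C (absorb ?xs v) = strands ?xs \<star> word ?i v"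
      "tgt C (absorb ?xs v) = strands (foldl push ?xs v)"
    using absorb_arr[of ?xs v] c r by simp_all
  have g: "absorb (foldl push ?xs v) w \<in> arr C"
      "src C (absorb (foldl push ?xs v) w) = strands (foldl push ?xs v) \<star> word ?j w"
    using absorb_arr[of "foldl push ?xs v" w] c j Cons.prems set_pushes[of ?xs v] by simp_all
  have h: "absorb_point xs q \<in> arr C" "src C (absorb_point xs q) = strands xs \<star> Pt (reg xs) q"
    "tgt C (absorb_point xs q) = strands ?xs"
    using c by simp_all
  have o: "word ?i v \<in> obj C" "word ?j w \<in> obj C" "strands ?xs \<in> obj C"
    using c r j Cons.prems by simp_all
  have IH: "absorb ?xs (v @ w) = absorb (foldl push ?xs v) w \<cdot> (absorb ?xs v \<boxtimes> \<^bold>1 (word ?j w))"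
    using Cons.IH[of ?xs] c r Cons.prems by simp
  have "absorb xs ((q # v) @ w)
      = (absorb (foldl push ?xs v) w \<cdot> (absorb ?xs v \<boxtimes> \<^bold>1 (word ?j w))) \<cdot> (absorb_point xs q \<boxtimes> \<^bold>1 (word ?i v \<star> word ?j w))"
    using IH word_append[of ?i v w] r c Cons.prems by simp
  also have "\<dots> = absorb (foldl push ?xs v) w \<cdot> ((absorb ?xs v \<cdot> (absorb_point xs q \<boxtimes> \<^bold>1 (word ?i v))) \<boxtimes> \<^bold>1 (word ?j w))"
    using f g h o by (simp add: whisker_right tens_id)
  finally show ?case by simp
qed

lemma absorb_point_mset:
  "\<lbrakk>mset xs = mset ys; set xs \<subseteq> carrier A; color q \<in> carrier A\<rbrakk> \<Longrightarrow> absorb_point xs q = absorb_point ys q"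
  using strands_mset[of xs ys] strands_mset[of "remove1 (color q) xs" "remove1 (color q) ys"]
    set_remove1[of xs "carrier A" "color q"] by (cases q) simp_all

text \<open>This permits rearranging the stack so that the strands needed for the upward points of a
  crossing come first.\<close>

lemma absorb_mset:
  "\<lbrakk>mset xs = mset ys; set xs \<subseteq> carrier A; color ` set w \<subseteq> carrier A\<rbrakk> \<Longrightarrow> absorb xs w = absorb ys w"
proof (induction w arbitrary: xs ys)
  case Nil
  then show ?case using strands_mset[of xs ys] by simp
next
  case (Cons q w)
  then have "absorb (push xs q) w = absorb (push ys q) w"
    by (intro Cons.IH mset_push set_push) simp_all
  then show ?case using Cons.prems absorb_point_mset[of xs ys q] strands_mset[of xs ys] by simp
qed

subsection \<open>The zest functor after absorption\<close>

abbreviation "zf \<equiv> zest_functor C A deg \<zeta>"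
abbreviation "Z \<equiv> shadow_Z A p"

lemma boundary_colors:
  "tangle_diagram A T \<Longrightarrow> color ` set (upper T) \<subseteq> carrier A \<and> color ` set (lower T) \<subseteq> carrier A"
  by (induction T) auto

lemma boundary_region:
  "\<lbrakk>tangle_diagram A T; i \<in> carrier A\<rbrakk> \<Longrightarrow> foldl (across A) i (lower T) = foldl (across A) i (upper T)"
proof (induction T arbitrary: i)
  case (Juxt S T)
  have "foldl (across A) i (upper S) \<in> carrier A"
    using Juxt.prems boundary_colors[of S] by (intro acrosses_closed) auto
  then show ?case using Juxt by simp
qed (auto simp: across_commute)

lemma zf_arr:
  "\<lbrakk>tangle_diagram A T; i \<in> carrier A\<rbrakk>
    \<Longrightarrow> zf i T \<in> arr C \<and> src C (zf i T) = word i (upper T) \<and> tgt C (zf i T) = word i (lower T)"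
proof (induction T arbitrary: i)
  case (Juxt S T)
  have "foldl (across A) i (upper S) \<in> carrier A"
    using Juxt.prems boundary_colors[of S] by (intro acrosses_closed) auto
  then show ?case
    using Juxt boundary_colors[of S] boundary_colors[of T] boundary_region[of S i]
    by (simp add: rightmost_def word_append)
qed auto

section \<open>Absorption of the elementary tangles\<close>

lemma two_points:
  assumes "pushable xs [q, r]" "set xs \<subseteq> carrier A" "color q \<in> carrier A" "color r \<in> carrier A"
  shows "absorb xs [q, r] = absorb_point (push xs q) r \<cdot> (absorb_point xs q \<boxtimes> \<^bold>1 (Pt (across A (reg xs) q) r))"
proof -
  have c: "pushable xs [q]" "pushable (push xs q) [r]" "set (push xs q) \<subseteq> carrier A"
      "reg (push xs q) = across A (reg xs) q"
    using assms reg_push[of xs q] by simp_all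
  have s: "set (push (push xs q) r) \<subseteq> carrier A" using c assms by (intro set_push)
  show ?thesis
    using absorb_point_arr[OF c(1)] absorb_point_arr[OF c(2)] c s assms by simp
qed

lemma absorb_down_first:
  assumes "pushable (a # xs) [r]" "set xs \<subseteq> carrier A" "a \<in> carrier A" "color r \<in> carrier A"
  shows "absorb xs [Dn a, r] = absorb_point (a # xs) r"
proof -
  have "absorb_point (a # xs) r \<in> arr C"
      "src C (absorb_point (a # xs) r) = strands xs \<star> L (reg xs) a \<star> Pt (reg xs \<diamondop> a) r"
    using absorb_point_arr[OF assms(1)] assms by simp_all
  then show ?thesis using two_points[of xs "Dn a" r] assms by (simp add: tens_id del: absorb.simps)
qed

lemma absorb_down_second:
  assumes "pushable xs [q]" "set xs \<subseteq> carrier A" "a \<in> carrier A" "color q \<in> carrier A"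
  shows "absorb xs [q, Dn a] = absorb_point xs q \<boxtimes> \<^bold>1 (L (across A (reg xs) q) a)"
  using absorb_point_arr[OF assms(1,2,4)] two_points[of xs q "Dn a"] assms reg_push[of xs q]
    set_push[of xs q] strands_obj[of "push xs q"]
  by (simp del: absorb.simps set_push)

text \<open>True also for \<open>a = b\<close>. With the splitting rule for \<open>remove1\<close>
  switched off below, equal and distinct colors are handled uniformly.\<close>

lemma remove1_second [simp]: "remove1 b (a # b # ys) = a # ys"
  by simp

declare absorb.simps(2) [simp del] remove1.simps(2) [simp del] remove1_hd [simp]

text \<open>By \<open>absorb_mset\<close> the stack may be written as \<open>ys\<close> followed by
  one strand for each upward point. The identity on the strands of \<open>ys\<close> splits off, and
  a slide lemma finishes each case; two downward points give a scalar directly. Two strands per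
  color cover the case of two upward points of one color.\<close>

lemma absorb_overL:
  assumes c: "color q \<in> carrier A" "color r \<in> carrier A" "set xs \<subseteq> carrier A"
    and cnt: "\<And>c. c \<in> carrier A \<Longrightarrow> 2 \<le> count (mset xs) c"
  shows "absorb xs [r, q] \<cdot> (\<^bold>1 (strands xs) \<boxtimes> X (reg xs) q r) = Z (reg xs) (OverL q r) \<triangleright> absorb xs [q, r]"
proof (cases q; cases r)
  fix a b assume *: "q = Dn a" "r = Dn b"
  let ?j = "reg xs"
  have ab: "a \<in> carrier A" "b \<in> carrier A" "?j \<in> carrier A" using c * by simp_all
  have o: "strands xs \<in> obj C" using c by simp
  have e: "L ?j b \<star> L (?j \<diamondop> b) a = L ?j a \<star> L (?j \<diamondop> a) b" using L_swap ab by simp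
  show ?thesis
    using * ab o e two_points[of xs q r] two_points[of xs r q] c over_down_down[of ?j a b]
    by (simp add: tens_id boltzmann_def)
next
  fix a b assume *: "q = Dn a" "r = Up b"
  have ab: "a \<in> carrier A" "b \<in> carrier A" using c * by simp_all
  define ys where "ys = remove1 b xs"
  have "b \<in> set xs" using cnt[OF ab(2)] by (metis count_mset_0_iff not_numeral_le_zero)
  then have m: "mset xs = mset (b # ys)" by (simp add: ys_def)
  have ys: "set ys \<subseteq> carrier A" "set (b # ys) \<subseteq> carrier A" using c ab by (simp_all add: ys_def set_remove1)
  let ?j = "reg ys" and ?F = "strands ys"
  have o: "?j \<in> carrier A" "?F \<in> obj C" using ys by simp_all
  have r: "reg xs = ?j \<diamondop> b" "strands xs = ?F \<star> L ?j b" using strands_mset[OF m c(3)] by simp_all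
  have x: "X (?j \<diamondop> b) q r \<in> arr C" "src C (X (?j \<diamondop> b) q r) = L (?j \<diamondop> b) a \<star> Pt (?j \<diamondop> b \<diamondop> a) (Up b)"
      "tgt C (X (?j \<diamondop> b) q r) = Pt (?j \<diamondop> b) (Up b) \<star> L ?j a"
    using * ab o by simp_all
  have 1: "absorb xs [r, q] = \<^bold>1 ?F \<boxtimes> cup ?j (Dn b) \<boxtimes> \<^bold>1 (L ?j a)"
    using absorb_mset[OF m c(3), of "[r, q]"] absorb_down_second[of "b # ys" r a] * ab ys o by simp
  have 2: "absorb xs [q, r] = \<^bold>1 ?F \<boxtimes> \<^bold>1 (L ?j a) \<boxtimes> cup (?j \<diamondop> a) (Dn b)"
    using absorb_mset[OF m c(3), of "[q, r]"] absorb_down_first[of a "b # ys" r] * ab ys o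
    by (simp add: tens_id[symmetric])
  \<comment> \<open>The left region is \<open>?j \<diamondop> b\<close>; facing the crossing down
    moves it across \<open>Up b\<close> to \<open>?j\<close>. The strands are not parallel, so the
    crossing is negative.\<close>
  have 3: "Z (reg xs) (OverL q r) = inverse (p ?j a b)"
    using * ab o r by (simp add: boltzmann_def)
  have "absorb xs [r, q] \<cdot> (\<^bold>1 (strands xs) \<boxtimes> X (reg xs) q r)
      = \<^bold>1 ?F \<boxtimes> ((cup ?j (Dn b) \<boxtimes> \<^bold>1 (L ?j a)) \<cdot> (\<^bold>1 (L ?j b) \<boxtimes> X (?j \<diamondop> b) q r))"
    unfolding 1 r using o ab x by (simp add: whisker_left tens_id[symmetric])
  also have "\<dots> = inverse (p ?j a b) \<triangleright> absorb xs [q, r]"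
    unfolding 2[unfolded *] * slide_over_up[OF o(1) ab] using o ab by simp
  finally show ?thesis unfolding 3 .
next
  fix a b assume *: "q = Up a" "r = Dn b"
  have ab: "a \<in> carrier A" "b \<in> carrier A" using c * by simp_all
  define ys where "ys = remove1 a xs"
  have "a \<in> set xs" using cnt[OF ab(1)] by (metis count_mset_0_iff not_numeral_le_zero)
  then have m: "mset xs = mset (a # ys)" by (simp add: ys_def)
  have ys: "set ys \<subseteq> carrier A" "set (a # ys) \<subseteq> carrier A" using c ab by (simp_all add: ys_def set_remove1)
  let ?j = "reg ys" and ?F = "strands ys"
  have o: "?j \<in> carrier A" "?F \<in> obj C" using ys by simp_all
  have r: "reg xs = ?j \<diamondop> a" "strands xs = ?F \<star> L ?j a" using strands_mset[OF m c(3)] by simp_all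
  have x: "X (?j \<diamondop> a) q r \<in> arr C" "src C (X (?j \<diamondop> a) q r) = Pt (?j \<diamondop> a) (Up a) \<star> L ?j b"
      "tgt C (X (?j \<diamondop> a) q r) = L (?j \<diamondop> a) b \<star> Pt (?j \<diamondop> a \<diamondop> b) (Up a)"
    using * ab o by simp_all
  have e: "L ?j a \<star> L (?j \<diamondop> a) b = L ?j b \<star> L (?j \<diamondop> b) a" "?j \<diamondop> a \<diamondop> b = ?j \<diamondop> b \<diamondop> a"
    using L_swap[of ?j a b] ab o by (simp_all add: m_ac)
  have 1: "absorb xs [q, r] = \<^bold>1 ?F \<boxtimes> cup ?j (Dn a) \<boxtimes> \<^bold>1 (L ?j b)"
    using absorb_mset[OF m c(3), of "[q, r]"] absorb_down_second[of "a # ys" q b] * ab ys o by simp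
  have 2: "absorb xs [r, q] = \<^bold>1 ?F \<boxtimes> \<^bold>1 (L ?j b) \<boxtimes> cup (?j \<diamondop> b) (Dn a)"
    using absorb_mset[OF m c(3), of "[r, q]"] absorb_down_first[of b "a # ys" q] * ab ys o
    by (simp add: tens_id[symmetric])
  have 3: "Z (reg xs) (OverL q r) = inverse (p ?j a b)"
    using * ab o r by (simp add: boltzmann_def)
  have d: "cup (?j \<diamondop> b) (Dn a) \<in> arr C"
      "src C (cup (?j \<diamondop> b) (Dn a)) = L (?j \<diamondop> b) a \<star> Pt (?j \<diamondop> b \<diamondop> a) (Up a)"
    using o ab by simp_all
  have "absorb xs [r, q] \<cdot> (\<^bold>1 (strands xs) \<boxtimes> X (reg xs) q r)
      = \<^bold>1 ?F \<boxtimes> ((\<^bold>1 (L ?j b) \<boxtimes> cup (?j \<diamondop> b) (Dn a)) \<cdot> (\<^bold>1 (L ?j a) \<boxtimes> X (?j \<diamondop> a) q r))"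
  proof -
    have "L ?j a \<star> L (?j \<diamondop> a) b \<star> Pt (?j \<diamondop> a \<diamondop> b) (Up a) = L ?j b \<star> L (?j \<diamondop> b) a \<star> Pt (?j \<diamondop> b \<diamondop> a) (Up a)"
      unfolding e(2) by (intro tens_eq e) (use o ab in simp_all)
    then show ?thesis unfolding 2 r using o ab x d by (simp add: whisker_left tens_id[symmetric] del: zest_point.simps)
  qed
  also have "\<dots> = inverse (p ?j a b) \<triangleright> absorb xs [q, r]"
    unfolding 1[unfolded *] * slide_under_down[OF o(1) ab] using o ab by simp
  finally show ?thesis unfolding 3 .
next
  fix a b assume *: "q = Up a" "r = Up b"
  have ab: "a \<in> carrier A" "b \<in> carrier A" using c * by simp_all
  define ys where "ys = remove1 b (remove1 a xs)"
  have a: "a \<in> set xs" using cnt[OF ab(1)] by (metis count_mset_0_iff not_numeral_le_zero)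
  have "b \<in> set xs" using cnt[OF ab(2)] by (metis count_mset_0_iff not_numeral_le_zero)
  \<comment> \<open>If \<open>a = b\<close>, the first removal takes away one copy;
    \<open>cnt\<close> guarantees a second.\<close>
  then have "count (mset (remove1 a xs)) b \<noteq> 0" using cnt[OF ab(2)] by auto
  then have "b \<in> set (remove1 a xs)" by (metis count_mset_0_iff)
  then have "mset (remove1 a xs) = mset (b # ys)" unfolding ys_def by (rule mset_cons_remove1)
  then have "mset (a # remove1 a xs) = mset (a # b # ys)" by (simp only: mset.simps)
  then have m: "mset xs = mset (a # b # ys)" by (simp only: mset_cons_remove1[OF a, symmetric])
  have ys: "set ys \<subseteq> carrier A" "set (a # b # ys) \<subseteq> carrier A"
    using c ab by (simp_all add: ys_def set_remove1)
  let ?j = "reg ys" and ?F = "strands ys"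
  have o: "?j \<in> carrier A" "?F \<in> obj C" using ys by simp_all
  have r: "reg xs = ?j \<diamondop> b \<diamondop> a" "strands xs = ?F \<star> L ?j b \<star> L (?j \<diamondop> b) a"
    using strands_mset[OF m c(3)] o ab by simp_all
  have e: "L ?j a \<star> L (?j \<diamondop> a) b = L ?j b \<star> L (?j \<diamondop> b) a" "?j \<diamondop> b \<diamondop> a = ?j \<diamondop> a \<diamondop> b"
      "?j \<diamondop> a \<diamondop> b \<diamondop> iv a = ?j \<diamondop> b"
    using L_swap[of ?j a b] ab o inv_mult_cancel(1)[of "?j \<diamondop> b" a] by (simp_all add: m_ac)
  let ?A = "Pt (?j \<diamondop> a) (Up a)" and ?B = "Pt (?j \<diamondop> b) (Up b)"
  have x: "X (?j \<diamondop> b \<diamondop> a) q r \<in> arr C" "src C (X (?j \<diamondop> b \<diamondop> a) q r) = Pt (?j \<diamondop> b \<diamondop> a) (Up a) \<star> ?B"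
      "tgt C (X (?j \<diamondop> b \<diamondop> a) q r) = Pt (?j \<diamondop> a \<diamondop> b) (Up b) \<star> ?A"
    using * ab o e by (simp_all)
  have 1: "absorb xs [q, r] = \<^bold>1 ?F \<boxtimes> (cup ?j (Dn b) \<cdot> (\<^bold>1 (L ?j b) \<boxtimes> cup (?j \<diamondop> b) (Dn a) \<boxtimes> \<^bold>1 ?B))"
    using absorb_mset[OF m c(3), of "[q, r]"] two_points[of "a # b # ys" q r] * ab ys o e
    by (simp add: whisker_left tens_id[symmetric])
  have 2: "absorb xs [r, q] = \<^bold>1 ?F \<boxtimes> (cup ?j (Dn a) \<cdot> (\<^bold>1 (L ?j a) \<boxtimes> cup (?j \<diamondop> a) (Dn b) \<boxtimes> \<^bold>1 ?A))"
  proof -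
    have "mset xs = mset (b # a # ys)" using m by simp
    then show ?thesis
      using absorb_mset[of xs "b # a # ys" "[r, q]"] two_points[of "b # a # ys" r q] * ab ys o c
      by (simp add: whisker_left tens_id[symmetric])
  qed
  \<comment> \<open>The half turn moves the region right of both strands to the left, and this
    region has color \<open>?j\<close>.\<close>
  have 3: "Z (reg xs) (OverL q r) = p ?j a b"
    using * ab o r by (simp add: boltzmann_def)
  have d: "cup ?j (Dn a) \<in> arr C" "src C (cup ?j (Dn a)) = L ?j a \<star> ?A"
      "cup (?j \<diamondop> a) (Dn b) \<in> arr C"
      "src C (cup (?j \<diamondop> a) (Dn b)) = L (?j \<diamondop> a) b \<star> Pt (?j \<diamondop> a \<diamondop> b) (Up b)" "tgt C (cup (?j \<diamondop> a) (Dn b)) = \<I>"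
    using o ab by simp_all
  have "absorb xs [r, q] \<cdot> (\<^bold>1 (strands xs) \<boxtimes> X (reg xs) q r)
      = \<^bold>1 ?F \<boxtimes> (cup ?j (Dn a) \<cdot> (\<^bold>1 (L ?j a) \<boxtimes> cup (?j \<diamondop> a) (Dn b) \<boxtimes> \<^bold>1 ?A)
          \<cdot> (\<^bold>1 (L ?j b \<star> L (?j \<diamondop> b) a) \<boxtimes> X (?j \<diamondop> b \<diamondop> a) q r))"
  proof -
    have "L ?j b \<star> L (?j \<diamondop> b) a \<star> Pt (?j \<diamondop> a \<diamondop> b) (Up b) \<star> ?A
        = L ?j a \<star> L (?j \<diamondop> a) b \<star> Pt (?j \<diamondop> a \<diamondop> b) (Up b) \<star> ?A"
      by (intro tens_eq e(1)[symmetric]) (use o ab in \<open>simp_all del: zest_point.simps\<close>)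
    then show ?thesis unfolding 2 r using o ab x d by (simp add: whisker_left tens_id[symmetric] del: zest_point.simps)
  qed
  also have "\<dots> = p ?j a b \<triangleright> absorb xs [q, r]"
    unfolding 1[unfolded *] * slide_over_up_up[OF o(1) ab] using o ab by simp
  finally show ?thesis unfolding 3 .
qed

lemma Z_overR:
  assumes "i \<in> carrier A" "color q \<in> carrier A" "color r \<in> carrier A"
  shows "Z i (OverR q r) = inverse (Z i (OverL r q))" "Z i (OverR q r) \<noteq> 0"
  using assms phi_scalar(3) by (cases q; cases r; simp add: boltzmann_def m_ac)+

text \<open>Composing \<open>absorb_overL\<close> for the inverse crossing with that crossing's
  inverse gives the claim, since the weights are inverse as well.\<close>

lemma absorb_overR:
  assumes c: "color q \<in> carrier A" "color r \<in> carrier A" "set xs \<subseteq> carrier A"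
    and cnt: "\<And>c. c \<in> carrier A \<Longrightarrow> 2 \<le> count (mset xs) c"
  shows "absorb xs [r, q] \<cdot> (\<^bold>1 (strands xs) \<boxtimes> minv C (X (reg xs) r q))
      = Z (reg xs) (OverR q r) \<triangleright> absorb xs [q, r]"
proof -
  let ?i = "reg xs" and ?F = "strands xs"
  let ?x = "\<^bold>1 ?F \<boxtimes> X ?i r q" and ?y = "\<^bold>1 ?F \<boxtimes> minv C (X ?i r q)" and ?z = "Z ?i (OverL r q)"
  have i: "?i \<in> carrier A" "?F \<in> obj C" using c by simp_all
  have p: "pushable xs [q, r]" "pushable xs [r, q]"
    using c cnt by (auto intro!: pushable_if_count[of "carrier A"] simp: numeral_2_eq_2 simp del: pushable.simps)
  have k: "absorb xs [q, r] \<in> arr C" "src C (absorb xs [q, r]) = ?F \<star> Pt ?i q \<star> Pt (across A ?i q) r"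
    "absorb xs [r, q] \<in> arr C" "src C (absorb xs [r, q]) = ?F \<star> Pt ?i r \<star> Pt (across A ?i r) q"
    using absorb_arr[OF p(1)] absorb_arr[OF p(2)] c i by simp_all
  have x: "X ?i r q \<in> arr C" "is_iso C (X ?i r q)"
    "src C (X ?i r q) = Pt ?i r \<star> Pt (across A ?i r) q" "tgt C (X ?i r q) = Pt ?i q \<star> Pt (across A ?i q) r"
    using c i by simp_all
  have xy: "?x \<cdot> ?y = \<^bold>1 (?F \<star> Pt ?i q \<star> Pt (across A ?i q) r)"
    using x i c by (simp add: interchange' tens_id)
  have "absorb xs [q, r] \<cdot> (?x \<cdot> ?y) = (absorb xs [q, r] \<cdot> ?x) \<cdot> ?y"
    using x k i by simp
  also have "absorb xs [q, r] \<cdot> ?x = ?z \<triangleright> absorb xs [r, q]"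
    by (rule absorb_overL) (use c cnt in auto)
  finally have "absorb xs [q, r] = ?z \<triangleright> (absorb xs [r, q] \<cdot> ?y)"
    unfolding xy using x k i by simp
  moreover have "?z \<noteq> 0" using Z_overR[OF i(1) c(1,2)] by auto
  moreover have "absorb xs [r, q] \<cdot> ?y \<in> arr C" using x k i by simp
  ultimately show ?thesis using Z_overR(1)[OF i(1) c(1,2)] by (simp del: shadow_Z.simps)
qed

text \<open>For \<open>q = Up a\<close> absorption cups the upward point off to the left and lets
  the downward point take the place of the used strand, whereas the cup joins it to the right;
  \<open>cup_down_cup_up\<close> equates the two.\<close>

lemma absorb_cup:
  assumes c: "color q \<in> carrier A" "set xs \<subseteq> carrier A" and m: "color q \<in> set xs"
  shows "absorb xs [q, flip q] = \<^bold>1 (strands xs) \<boxtimes> cup (reg xs) q"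
proof (cases q)
  case (Dn a)
  then show ?thesis using absorb_down_first[of a xs "Up a"] c by simp
next
  case (Up a)
  define ys where "ys = remove1 a xs"
  have m: "mset xs = mset (a # ys)" unfolding ys_def using m Up by (intro mset_cons_remove1) simp
  have ys: "set ys \<subseteq> carrier A" "a \<in> carrier A" using c Up by (simp_all add: ys_def set_remove1)
  have r: "reg xs = reg ys \<diamondop> a" "strands xs = strands ys \<star> L (reg ys) a"
    using strands_mset[OF m c(2)] by simp_all
  have "absorb xs [q, flip q] = \<^bold>1 (strands ys) \<boxtimes> cup (reg ys) (Dn a) \<boxtimes> \<^bold>1 (L (reg ys) a)"
    using absorb_mset[OF m c(2), of "[q, flip q]"] absorb_down_second[of "a # ys" "Up a" a] Up ys by simp
  also have "\<dots> = \<^bold>1 (strands xs) \<boxtimes> cup (reg xs) q"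
    unfolding r Up using ys cup_down_cup_up[of "reg ys" a] by (simp add: tens_id[symmetric])
  finally show ?thesis .
qed

lemma absorb_cap:
  assumes c: "color q \<in> carrier A" "set xs \<subseteq> carrier A" and m: "color q \<in> set xs"
  shows "absorb xs [q, flip q] \<cdot> (\<^bold>1 (strands xs) \<boxtimes> cap (reg xs) q) = \<^bold>1 (strands xs)"
  unfolding absorb_cup[OF assms] using c cup_cap[of "reg xs" q] by (simp add: interchange')

text \<open>Needed for juxtaposition: whether the upper or the lower boundary of the left factor has
  been absorbed, the right factor meets the same stack up to order.\<close>

lemma boundary_mset:
  "\<lbrakk>tangle_diagram A T; set xs \<subseteq> carrier A; \<forall>c\<in>carrier A. width T \<le> count (mset xs) c\<rbrakk>
    \<Longrightarrow> mset (foldl push xs (lower T)) = mset (foldl push xs (upper T))"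
proof (induction T arbitrary: xs)
  case (OverL q r)
  have "color c \<in># mset xs" if "color c \<in> carrier A" for c
    using OverL.prems(3) that by (metis count_eq_zero_iff not_numeral_le_zero width.simps(3))
  then show ?case using mset_push_commute[of r xs q] OverL.prems by simp
next
  case (OverR q r)
  have "color c \<in># mset xs" if "color c \<in> carrier A" for c
    using OverR.prems(3) that by (metis count_eq_zero_iff not_numeral_le_zero width.simps(4))
  then show ?case using mset_push_commute[of r xs q] OverR.prems by simp
next
  case (Cap q)
  then have "color q \<in># mset xs" by (metis count_eq_zero_iff not_numeral_le_zero tangle_diagram.simps(5) width.simps(5))
  then show ?case by (cases q) simp_all
next
  case (Cup q)
  then have "color q \<in># mset xs" by (metis count_eq_zero_iff not_numeral_le_zero tangle_diagram.simps(6) width.simps(6))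
  then show ?case by (cases q) simp_all
next
  case (Stack S T)
  have "mset (foldl push xs (lower S)) = mset (foldl push xs (upper S))"
    using Stack.prems by (intro Stack.IH) auto
  moreover have "mset (foldl push xs (lower T)) = mset (foldl push xs (upper T))"
    using Stack.prems by (intro Stack.IH) auto
  ultimately show ?case using Stack.prems by simp
next
  case (Juxt S T)
  let ?ys = "foldl push xs (upper S)"
  have S: "tangle_diagram A S" and T: "tangle_diagram A T" using Juxt.prems by auto
  have "mset (foldl push xs (lower S)) = mset ?ys"
    using Juxt.prems by (intro Juxt.IH) auto
  then have "mset (foldl push (foldl push xs (lower S)) (lower T)) = mset (foldl push ?ys (lower T))"
    by (rule mset_pushes)
  also have "\<dots> = mset (foldl push ?ys (upper T))"
  proof (rule Juxt.IH(2)[OF T])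
    show "set ?ys \<subseteq> carrier A" using Juxt.prems boundary_colors[OF S] by (intro set_pushes) auto
    show "\<forall>c\<in>carrier A. width T \<le> count (mset ?ys) c"
    proof
      fix c assume "c \<in> carrier A"
      then show "width T \<le> count (mset ?ys) c"
        using Juxt.prems(3) count_pushes[of xs c "upper S"] length_boundary_le_width(1)[of S] by fastforce
    qed
  qed
  finally show ?case by simp
qed auto

text \<open>Absorption intertwines the zest functor with multiplication by \<open>Z\<close>. The
  stack varies in the induction, because the right factor of \<open>Juxt\<close> starts from the
  stack left by the upper boundary of the left factor; additivity of \<open>width\<close> pays for
  the strands lost there.\<close>

lemma absorb_functor:
  "\<lbrakk>tangle_diagram A T; set xs \<subseteq> carrier A; \<forall>c\<in>carrier A. width T \<le> count (mset xs) c\<rbrakk>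
    \<Longrightarrow> absorb xs (lower T) \<cdot> (\<^bold>1 (strands xs) \<boxtimes> zf (reg xs) T) = Z (reg xs) T \<triangleright> absorb xs (upper T)"
proof (induction T arbitrary: xs)
  case Empty
  then show ?case by simp
next
  case (Strand q)
  then have c: "color q \<in> carrier A" by simp
  have "pushable xs [q]" using Strand.prems c by (intro pushable_if_count[of "carrier A"]) auto
  then show ?case using absorb_arr[of xs "[q]"] Strand.prems c by (simp add: tens_id)
next
  case (OverL q r)
  have "absorb xs [r, q] \<cdot> (\<^bold>1 (strands xs) \<boxtimes> X (reg xs) q r) = Z (reg xs) (OverL q r) \<triangleright> absorb xs [q, r]"
    using OverL by (intro absorb_overL) auto
  then show ?case by simp
next
  case (OverR q r)
  have "absorb xs [r, q] \<cdot> (\<^bold>1 (strands xs) \<boxtimes> minv C (X (reg xs) r q)) = Z (reg xs) (OverR q r) \<triangleright> absorb xs [q, r]"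
    using OverR by (intro absorb_overR) auto
  then show ?case by simp
next
  case (Cap q)
  then have c: "color q \<in> carrier A" by simp
  then have "color q \<in> set xs" using Cap.prems by (metis count_mset_0_iff not_numeral_le_zero width.simps(5))
  then show ?case using absorb_cap[of q xs] Cap.prems c by simp
next
  case (Cup q)
  then have c: "color q \<in> carrier A" by simp
  then have "color q \<in> set xs" using Cup.prems by (metis count_mset_0_iff not_numeral_le_zero width.simps(6))
  then show ?case using absorb_cup[of q xs] Cup.prems c by simp
next
  case (Stack S T)
  let ?i = "reg xs" and ?F = "strands xs"
  have S: "tangle_diagram A S" and T: "tangle_diagram A T" and ST: "upper S = lower T" using Stack.prems by auto
  have i: "?i \<in> carrier A" "?F \<in> obj C" using Stack.prems by simp_all
  have w: "\<forall>c\<in>carrier A. width S \<le> count (mset xs) c" "\<forall>c\<in>carrier A. width T \<le> count (mset xs) c"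
    using Stack.prems(3) by auto
  have "pushable xs (lower S)" "pushable xs (upper S)" "pushable xs (upper T)"
    using Stack.prems boundary_colors[OF S] boundary_colors[OF T]
      length_boundary_le_width[of S] length_boundary_le_width[of T]
    by (auto intro!: pushable_if_count[of "carrier A"] intro: order_trans)
  then have k: "absorb xs (lower S) \<in> arr C" "src C (absorb xs (lower S)) = ?F \<star> word ?i (lower S)"
      "absorb xs (lower T) \<in> arr C" "src C (absorb xs (lower T)) = ?F \<star> word ?i (lower T)"
      "absorb xs (upper T) \<in> arr C"
    using absorb_arr boundary_colors[OF S] boundary_colors[OF T] Stack.prems(2) ST by simp_all
  have zS: "zf ?i S \<in> arr C" "src C (zf ?i S) = word ?i (lower T)" "tgt C (zf ?i S) = word ?i (lower S)"
    using zf_arr[OF S i(1)] ST by simp_all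
  have zT: "zf ?i T \<in> arr C" "src C (zf ?i T) = word ?i (upper T)" "tgt C (zf ?i T) = word ?i (lower T)"
    using zf_arr[OF T i(1)] by simp_all
  have IHS: "absorb xs (lower S) \<cdot> (\<^bold>1 ?F \<boxtimes> zf ?i S) = Z ?i S \<triangleright> absorb xs (lower T)"
    using Stack.IH(1)[OF S Stack.prems(2)] w ST by simp
  have IHT: "absorb xs (lower T) \<cdot> (\<^bold>1 ?F \<boxtimes> zf ?i T) = Z ?i T \<triangleright> absorb xs (upper T)"
    using Stack.IH(2)[OF T Stack.prems(2)] w by simp
  have "absorb xs (lower S) \<cdot> (\<^bold>1 ?F \<boxtimes> (zf ?i S \<cdot> zf ?i T))
      = (absorb xs (lower S) \<cdot> (\<^bold>1 ?F \<boxtimes> zf ?i S)) \<cdot> (\<^bold>1 ?F \<boxtimes> zf ?i T)"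
    using k zS zT i by (simp add: whisker_left)
  also have "\<dots> = Z ?i S \<triangleright> (absorb xs (lower T) \<cdot> (\<^bold>1 ?F \<boxtimes> zf ?i T))"
    unfolding IHS using k zT i by simp
  finally show ?case unfolding IHT using k by simp
next
  case (Juxt S T)
  let ?i = "reg xs" and ?F = "strands xs" and ?ys = "foldl push xs (upper S)"
  let ?j = "foldl (across A) ?i (upper S)"
  have S: "tangle_diagram A S" and T: "tangle_diagram A T" using Juxt.prems by auto
  note cS = boundary_colors[OF S] and cT = boundary_colors[OF T]
  have wS: "\<forall>c\<in>carrier A. width S \<le> count (mset xs) c" using Juxt.prems by auto
  have wT: "width T \<le> count (mset ?ys) c" if "c \<in> carrier A" for c
    using that Juxt.prems(3) count_pushes[of xs c "upper S"] length_boundary_le_width(1)[of S] by fastforce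
  have ys: "set ?ys \<subseteq> carrier A" using Juxt.prems cS by (intro set_pushes) auto
  have pS: "pushable xs (lower S)" "pushable xs (upper S)"
    using wS cS length_boundary_le_width[of S] by (auto intro!: pushable_if_count[of "carrier A"] intro: order_trans)
  have pT: "pushable ?ys (lower T)" "pushable ?ys (upper T)"
    using wT cT length_boundary_le_width[of T] by (auto intro!: pushable_if_count[of "carrier A"] intro: order_trans)
  have m: "mset (foldl push xs (lower S)) = mset ?ys"
    using boundary_mset[OF S] Juxt.prems(2) wS by simp
  have "set (foldl push xs (lower S)) \<subseteq> carrier A" using Juxt.prems cS by (intro set_pushes) auto
  note m' = absorb_mset[OF m this] strands_mset[OF m this]
  have pST: "pushable xs (lower S @ lower T)" "pushable xs (upper S @ upper T)"
    using Juxt.prems(1,3) cS cT length_boundary_le_width[of "Juxt S T"]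
    by (auto intro!: pushable_if_count[of "carrier A"] intro: order_trans simp: image_subset_iff)
  have i: "?i \<in> carrier A" "?F \<in> obj C" "?j \<in> carrier A" "reg ?ys = ?j"
    using Juxt.prems cS pS reg_pushes[of xs "upper S"] by simp_all
  have zS: "zf ?i S \<in> arr C" "src C (zf ?i S) = word ?i (upper S)" "tgt C (zf ?i S) = word ?i (lower S)"
    using zf_arr[OF S i(1)] by simp_all
  have zT: "zf ?j T \<in> arr C" "src C (zf ?j T) = word ?j (upper T)" "tgt C (zf ?j T) = word ?j (lower T)"
    using zf_arr[OF T i(3)] by simp_all
  have lS: "absorb xs (lower S) \<in> arr C" "src C (absorb xs (lower S)) = ?F \<star> word ?i (lower S)"
      "tgt C (absorb xs (lower S)) = strands ?ys"
    using absorb_arr[OF pS(1)] cS Juxt.prems(2) m' by simp_all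
  have uS: "absorb xs (upper S) \<in> arr C" "src C (absorb xs (upper S)) = ?F \<star> word ?i (upper S)"
      "tgt C (absorb xs (upper S)) = strands ?ys"
    using absorb_arr[OF pS(2)] cS Juxt.prems(2) by simp_all
  have lT: "absorb ?ys (lower T) \<in> arr C" "src C (absorb ?ys (lower T)) = strands ?ys \<star> word ?j (lower T)"
    using absorb_arr[OF pT(1) ys] cT i by simp_all
  have uT: "absorb ?ys (upper T) \<in> arr C" "src C (absorb ?ys (upper T)) = strands ?ys \<star> word ?j (upper T)"
    using absorb_arr[OF pT(2) ys] cT i by simp_all
  have 1: "absorb xs (lower S @ lower T) = absorb ?ys (lower T) \<cdot> (absorb xs (lower S) \<boxtimes> \<^bold>1 (word ?j (lower T)))"
    using absorb_append[OF pST(1)] Juxt.prems(2) cS cT m' boundary_region[OF S i(1)] by simp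
  have 2: "absorb xs (upper S @ upper T) = absorb ?ys (upper T) \<cdot> (absorb xs (upper S) \<boxtimes> \<^bold>1 (word ?j (upper T)))"
    using absorb_append[OF pST(2)] Juxt.prems(2) cS cT by simp
  have IHS: "absorb xs (lower S) \<cdot> (\<^bold>1 ?F \<boxtimes> zf ?i S) = Z ?i S \<triangleright> absorb xs (upper S)"
    using Juxt.IH(1)[OF S] Juxt.prems wS by simp
  have IHT: "absorb ?ys (lower T) \<cdot> (\<^bold>1 (strands ?ys) \<boxtimes> zf ?j T) = Z ?j T \<triangleright> absorb ?ys (upper T)"
    using Juxt.IH(2)[OF T ys] wT i by simp
  have "(absorb ?ys (lower T) \<cdot> (absorb xs (lower S) \<boxtimes> \<^bold>1 (word ?j (lower T)))) \<cdot> (\<^bold>1 ?F \<boxtimes> zf ?i S \<boxtimes> zf ?j T)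
      = (Z ?i S * Z ?j T) \<triangleright> (absorb ?ys (upper T) \<cdot> (absorb xs (upper S) \<boxtimes> \<^bold>1 (word ?j (upper T))))"
    by (rule interleave[OF zS zT lS uS lT uT i(2) IHS IHT])
  then show ?case by (simp add: 1 2 rightmost_def)
qed

lemma zest_invariant_link:
  assumes D: "link_diagram A D" and i: "i \<in> carrier A"
  shows "zest_invariant C A deg \<zeta> i D = Z i D"
proof -
  have T: "tangle_diagram A D" "upper D = []" "lower D = []" using D by (auto simp: link_diagram_def)
  obtain cs where cs: "set cs = carrier A" using finite_A finite_list by blast
  \<comment> \<open>\<open>width D\<close> copies of every color give the supply demanded by
    \<open>absorb_functor\<close>.\<close>
  define ys where "ys = concat (replicate (width D) cs)"
  \<comment> \<open>The additional strand corrects the region to the right of the stack from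
    \<open>reg ys\<close> to the prescribed base color \<open>i\<close>.\<close>
  define xs where "xs = (i \<otimes>\<^bsub>A\<^esub> inv\<^bsub>A\<^esub> reg ys) # ys"
  have ys: "set ys \<subseteq> carrier A" using cs by (auto simp: ys_def)
  have xs: "set xs \<subseteq> carrier A" "reg xs = i"
    using ys i by (auto simp: xs_def m_comm[of "reg ys"] m_assoc)
  have "m \<le> count (mset (concat (replicate m cs))) c" if "c \<in> carrier A" for m c
  proof (induction m)
    case (Suc m)
    have "1 \<le> count (mset cs) c" using that cs by (simp add: Suc_le_eq)
    moreover have "count (mset (concat (replicate (Suc m) cs))) c
        = count (mset cs) c + count (mset (concat (replicate m cs))) c" by simp
    ultimately show ?case using Suc.IH by linarith
  qed simp
  then have "\<forall>c\<in>carrier A. width D \<le> count (mset xs) c"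
    by (auto simp: xs_def ys_def intro: le_SucI)
  then have eq: "\<^bold>1 (strands xs) \<cdot> (\<^bold>1 (strands xs) \<boxtimes> zf i D) = Z i D \<triangleright> \<^bold>1 (strands xs)"
    using absorb_functor[OF T(1) xs(1)] T xs(2) by simp
  have z: "zf i D \<in> arr C" "src C (zf i D) = \<I>" "tgt C (zf i D) = \<I>"
    using zf_arr[OF T(1) i] T by simp_all
  have s: "zf i D = zest_invariant C A deg \<zeta> i D \<triangleright> \<^bold>1 \<I>"
    unfolding zest_invariant_def by (rule scalar_smul_id[OF invertible_unit z])
  \<comment> \<open>Both boundary words are empty, so absorption is the identity and
    \<open>eq\<close> compares two multiples of the identity of \<open>strands xs\<close>.\<close>
  have "zest_invariant C A deg \<zeta> i D \<triangleright> \<^bold>1 (strands xs) = Z i D \<triangleright> \<^bold>1 (strands xs)"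
    using eq xs by (subst (asm) s) simp
  then show ?thesis by (rule smul_id_cancel[OF strands_invertible[OF xs(1)]])
qed

end

theorem theorem31:
  fixes C :: "('o, 'm, 'k::{alg_closed_field, field_char_0}) ribbon_structure"
    and A :: "('a, 'b) monoid_scheme"
    and deg :: "'o \<Rightarrow> 'a"
    and \<zeta> :: "('a, 'o, 'm, 'k) zesting"
    and D :: "'a tangle" and i :: 'a
  assumes "ribbon_zesting C A deg \<zeta>"
    and "strict_symmetric_cocycle C A (lam \<zeta>)"
    and "\<forall>a \<in> carrier A. eps \<zeta> a = 1"
    and "link_diagram A D"
    and "i \<in> carrier A"
  shows "zest_invariant C A deg \<zeta> i D = shadow_Z A (\<lambda>j a b. scalar C (phi C A \<zeta> j a b)) i D"
proof -
  interpret unit_dim_zesting C A deg \<zeta>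
    using assms(1-3)
    by (simp add: unit_dim_zesting_def strict_zesting_def strict_zesting_axioms_def unit_dim_zesting_axioms_def)
  have "p = (\<lambda>j a b. scalar C (phi C A \<zeta> j a b))" by (simp add: fun_eq_iff p_def)
  then show ?thesis using zest_invariant_link[OF assms(4,5)] by simp
qed

end
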